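(* Let $1\le n_1<n_2<\cdots<n_l$ and $m_1,\dots,m_l\ge 1$ be integers, put $n=\sum_{i=1}^l n_im_i$ and $m=\sum_{i=1}^l m_i$, and let $P=\prod_{i=1}^l P_i$, where $P_i$ is the product of $m_i$ copies of the $n_i$-dimensional simplex $\Delta^{n_i}$. Let $\omega:\{1,\dots,m\}\to\mathbb{N}$ be the dimension function of $P$. Then there is a bijection between the set of weakly $\mathbb{Z}_2^n$-equivariant homeomorphism classes of small covers over $P$ and the set of $\omega$-equivalence classes of acyclic $\omega$-vector weighted digraphs with $m$ labeled vertices $v_1,\dots,v_m$.
   Context: Small covers. For a simple convex polytope $P$ of dimension $n$, a small cover over $P$ is an $n$-dimensional smooth closed manifold with a locally standard $\mathbb{Z}_2^n$-action (locally modelled on the action of $\mathbb{Z}_2^n$ on $\mathbb{R}^n$ by sign changes of coordinates) whose orbit space is $P$. A homeomorphism $f:M\to M'$ of $\mathbb{Z}_2^n$-spaces is weakly $\mathbb{Z}_2^n$-equivariant if there is an automorphism $\theta$ of $\mathbb{Z}_2^n$ with $f(g\cdot x)=\theta(g)\cdot f(x)$ for all $g,x$. Dimension function of $P$. For $1\le i\le l$, $1\le j\le m_i$ put $N^i_j=\big(\sum_{\alpha=1}^{i-1}m_\alpha\big)+j$; then $\omega(N^i_j)=n_i$. Digraphs. Here $\mathbb{N}$ denotes the positive integers. A digraph with labeled vertices $v_1,\dots,v_m$ is $\omega$-vector weighted if every edge $(v_i,v_j)$ is assigned a non-zero vector in $\mathbb{Z}_2^{\omega(i)}$, called its weight. It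 is acyclic if it contains no directed cycle. Write $\omega(v_i)=\omega(i)$ and let $\omega(u,w)$ be the weight of the edge from $u$ to $w$; by convention the weight of $(u,w)$ is the zero vector if and only if there is no edge from $u$ to $w$. $N_G^-(v)$ and $N_G^+(v)$ denote the sets of in-neighbors and out-neighbors of $v$ in $G$. A permutation $\sigma\in S_r$ acts on $x\in\mathbb{Z}_2^r$ by permuting coordinates, $(\sigma\cdot x)_t=x_{\sigma(t)}$. For a vertex $v$ of $G$, $\sigma\in S_{\omega(v)}$ and $1\le k\le\omega(v)$, the $(\sigma,k)$-local complementation of $G$ at $v$ is the $\omega$-vector weighted digraph with the same vertices in which the weight of $(u,w)$ is: (i) $\omega(u,w)+\omega(u,v)$ if $(u,w)\in N_G^-(v)\times N_G^+(v)$ and $(\omega(v,w))_k=1$; (ii) $\sigma\cdot\omega(v,w)$ if $u=v$ and $(\omega(v,w))_k=0$; (iii) $\sigma\cdot\omega(v,w)+e_{\sigma^{-1}(k)}$ if $u=v$ and $(\omega(v,w))_k=1$, where $e_i\in\mathbb{Z}_2^{\omega(v)}$ is the vector all of whose coordinates are $1$ except the $i$-th one, which is $0$; (iv) $\omega(u,w)$ otherwise. (The edges are exactly the pairs whose weight is non-zero.) Two $\omega$-vector weighted digraphs on $v_1,\dots,v_m$ are $\omega$-equivalent if one is obtained from the other by a finite sequence of the following operations: (1) reordering vertices with the same image under $\omega$: for a permutation $\mu$ of $\{1,\dots,m\}$ with $\omega\circ\mu=\omega$, the new weight of $(v_p,v_q)$ is the old weight of $(v_{\mu(p)},v_{\mu(q)})$;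 (2) for a vertex $v$ and $\sigma\in S_{\omega(v)}$, replacing the weight $\omega(v,w)$ of every edge from $v$ by $\sigma\cdot\omega(v,w)$; (3) a $(\sigma,k)$-local complementation at some vertex. *)

theory Defs
  imports
    "HOL-Analysis.Analysis"
    "HOL-Combinatorics.Permutations"
    "HOL-Library.Z2"
    "HOL-Library.Equipollence"
begin

section \<open>Smooth closed manifolds\<close>

text \<open>
  The two predicates below are meant for an open set \<open>S\<close>.
\<close>

primrec Ck_on ::
  "nat \<Rightarrow> ('a::real_normed_vector \<Rightarrow> 'b::real_normed_vector) \<Rightarrow> 'a set \<Rightarrow> bool" where
  "Ck_on 0 f S \<longleftrightarrow> continuous_on S f"
| "Ck_on (Suc k) f S \<longleftrightarrow>
     (\<exists>D. (\<forall>x\<in>S. (f has_derivative D x) (at x)) \<and> (\<forall>v. Ck_on k (\<lambda>x. D x v) S))"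

definition smooth_on ::
  "('a::real_normed_vector \<Rightarrow> 'b::real_normed_vector) \<Rightarrow> 'a set \<Rightarrow> bool" where
  "smooth_on f S \<longleftrightarrow> (\<forall>k. Ck_on k f S)"

text \<open>
  A chart is a pair of a domain and a map; the values of the map outside the domain are irrelevant.
\<close>

type_synonym ('a, 'n) chart = "'a set \<times> ('a \<Rightarrow> real^'n)"

definition is_chart :: "'a topology \<Rightarrow> ('a, 'n::finite) chart \<Rightarrow> bool" where
  "is_chart T c \<longleftrightarrow> (case c of (U, \<phi>) \<Rightarrow>
     openin T U \<and> open (\<phi> ` U) \<and>
     homeomorphic_map (subtopology T U) (top_of_set (\<phi> ` U)) \<phi>)"

definition smooth_in_charts ::
  "('a, 'n::finite) chart set \<Rightarrow> ('b, 'n) chart set \<Rightarrow> ('a \<Rightarrow> 'b) \<Rightarrow> bool" where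
  "smooth_in_charts A B f \<longleftrightarrow> (\<forall>(U, \<phi>)\<in>A. \<forall>(V, \<psi>)\<in>B.
     smooth_on (\<lambda>y. \<psi> (f (inv_into U \<phi> y))) (\<phi> ` {x \<in> U. f x \<in> V}))"

definition smooth_atlas :: "'a topology \<Rightarrow> ('a, 'n::finite) chart set \<Rightarrow> bool" where
  "smooth_atlas T A \<longleftrightarrow>
     (\<forall>c\<in>A. is_chart T c) \<and> (\<Union>(U, \<phi>)\<in>A. U) = topspace T \<and> smooth_in_charts A A (\<lambda>x. x)"

definition smooth_closed_manifold :: "'a topology \<Rightarrow> ('a, 'n::finite) chart set \<Rightarrow> bool" where
  "smooth_closed_manifold T A \<longleftrightarrow>
     Hausdorff_space T \<and> second_countable T \<and> compact_space T \<and> smooth_atlas T A"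


section \<open>Locally standard actions and small covers\<close>

text \<open>
  The group \<open>\<int>\<^sub>2\<^sup>n\<close> is the additive group of the type \<open>bit^'n\<close> with \<open>n = CARD('n)\<close>.
  In the record below only the values of \<open>act\<close> on points of \<open>mtop\<close> matter, and \<open>atlas\<close>
  need not be maximal.
\<close>

record ('a, 'n) Z2_manifold =
  mtop :: "'a topology"
  atlas :: "('a, 'n) chart set"
  act :: "bit^'n \<Rightarrow> 'a \<Rightarrow> 'a"

definition Z2_automorphism :: "(bit^'n::finite \<Rightarrow> bit^'n) \<Rightarrow> bool" where
  "Z2_automorphism \<theta> \<longleftrightarrow> bij \<theta> \<and> (\<forall>g h. \<theta> (g + h) = \<theta> g + \<theta> h)"

definition sign_change :: "bit^'n::finite \<Rightarrow> real^'n \<Rightarrow> real^'n" where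
  "sign_change g x = (\<chi> i. if g $ i = 1 then - x $ i else x $ i)"

definition smooth_Z2_action :: "('a, 'n::finite) Z2_manifold \<Rightarrow> bool" where
  "smooth_Z2_action M \<longleftrightarrow>
     (\<forall>x\<in>topspace (mtop M). act M 0 x = x) \<and>
     (\<forall>g h. \<forall>x\<in>topspace (mtop M). act M (g + h) x = act M g (act M h x)) \<and>
     (\<forall>g. continuous_map (mtop M) (mtop M) (act M g) \<and>
          smooth_in_charts (atlas M) (atlas M) (act M g))"

text \<open>
  Every point has an invariant open neighbourhood that is diffeomorphic to an (automatically
  invariant) open subset of \<open>\<real>\<^sup>n\<close>, equivariantly up to an automorphism of \<open>\<int>\<^sub>2\<^sup>n\<close>.  The
  automorphism depends on the neighbourhood.
  A chart is a diffeomorphism onto its image iff it is compatible with the given atlas.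
\<close>

definition locally_standard :: "('a, 'n::finite) Z2_manifold \<Rightarrow> bool" where
  "locally_standard M \<longleftrightarrow> (\<forall>x\<in>topspace (mtop M). \<exists>U \<phi> \<theta>.
     x \<in> U \<and> smooth_atlas (mtop M) (insert (U, \<phi>) (atlas M)) \<and>
     Z2_automorphism \<theta> \<and>
     (\<forall>g. \<forall>y\<in>U. act M g y \<in> U \<and> \<phi> (act M g y) = sign_change (\<theta> g) (\<phi> y)))"

text \<open>
  The orbit space of \<open>M\<close> is \<open>P\<close> as a manifold with corners: \<open>\<pi>\<close> induces a homeomorphism from the
  orbit space to \<open>P\<close> which respects the stratification by codimension.  In a locally standard
  chart the orbit of \<open>x\<close> lies in the codimension \<open>k\<close> stratum of the corner model (exactly \<open>k\<close>
  coordinates vanish) iff the isotropy group of \<open>x\<close> has rank \<open>k\<close>, that is, order \<open>2 ^ k\<close>.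
  Without the last condition only the topological ball underlying \<open>P\<close> would be recorded.
\<close>

definition orbit_space_is :: "('a, 'n::finite) Z2_manifold \<Rightarrow> (real^'n) set \<Rightarrow> bool" where
  "orbit_space_is M P \<longleftrightarrow> (\<exists>\<pi>.
     quotient_map (mtop M) (top_of_set P) \<pi> \<and>
     (\<forall>x\<in>topspace (mtop M). \<forall>y\<in>topspace (mtop M). \<pi> x = \<pi> y \<longleftrightarrow> (\<exists>g. y = act M g x)) \<and>
     (\<forall>x\<in>topspace (mtop M). \<forall>F. F face_of P \<and> \<pi> x \<in> rel_interior F \<longrightarrow>
        card {g. act M g x = x} = 2 ^ nat (aff_dim P - aff_dim F)))"

definition small_cover :: "(real^'n::finite) set \<Rightarrow> ('a, 'n) Z2_manifold \<Rightarrow> bool" where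
  "small_cover P M \<longleftrightarrow>
     smooth_closed_manifold (mtop M) (atlas M) \<and> smooth_Z2_action M \<and>
     locally_standard M \<and> orbit_space_is M P"

definition weakly_equivariantly_homeomorphic ::
  "('a, 'n::finite) Z2_manifold \<Rightarrow> ('a, 'n) Z2_manifold \<Rightarrow> bool" where
  "weakly_equivariantly_homeomorphic M M' \<longleftrightarrow> (\<exists>f \<theta>.
     homeomorphic_map (mtop M) (mtop M') f \<and> Z2_automorphism \<theta> \<and>
     (\<forall>g. \<forall>x\<in>topspace (mtop M). f (act M g x) = act M' (\<theta> g) (f x)))"

definition small_cover_classes ::
  "(real^'n::finite) set \<Rightarrow> ('a, 'n) Z2_manifold set set" where
  "small_cover_classes P = {M. small_cover P M} //
     {(M, M'). small_cover P M \<and> small_cover P M' \<and> weakly_equivariantly_homeomorphic M M'}"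


section \<open>Products of simplices\<close>

text \<open>
  \<open>\<Delta>\<^sup>k\<close> is the convex hull of the origin and the unit vectors of \<open>\<real>\<^sup>k\<close>.  The map \<open>e\<close> names the
  coordinates of \<open>\<real>\<^sup>n\<close>: \<open>e (i, j, t)\<close> is the \<open>t\<close>-th coordinate of the \<open>j\<close>-th copy of
  \<open>\<Delta>\<close> of dimension \<open>ns i\<close>.  It is required to be a bijection from \<open>coordinates l ns ms\<close>.
\<close>

definition coordinates :: "nat \<Rightarrow> (nat \<Rightarrow> nat) \<Rightarrow> (nat \<Rightarrow> nat) \<Rightarrow> (nat \<times> nat \<times> nat) set" where
  "coordinates l ns ms = (SIGMA i:{1..l}. {1..ms i} \<times> {1..ns i})"

definition simplex_product ::
  "nat \<Rightarrow> (nat \<Rightarrow> nat) \<Rightarrow> (nat \<Rightarrow> nat) \<Rightarrow> (nat \<times> nat \<times> nat \<Rightarrow> 'n::finite) \<Rightarrow> (real^'n) set" where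
  "simplex_product l ns ms e = {x. \<forall>i\<in>{1..l}. \<forall>j\<in>{1..ms i}.
     (\<forall>t\<in>{1..ns i}. 0 \<le> x $ e (i, j, t)) \<and> (\<Sum>t=1..ns i. x $ e (i, j, t)) \<le> 1}"


section \<open>Vector weighted digraphs\<close>

text \<open>
  Vectors in \<open>\<int>\<^sub>2\<^sup>r\<close> with \<open>r\<close> varying are functions on the naturals supported in \<open>{1..r}\<close>.
  A weighted digraph is its weight function, extended by zero outside the vertex set
  \<open>{1..m}\<close>; the edges are the pairs of nonzero weight.
\<close>

type_synonym Z2_vector = "nat \<Rightarrow> bit"
type_synonym weights = "nat \<Rightarrow> nat \<Rightarrow> Z2_vector"

definition zero_vec :: Z2_vector where
  "zero_vec = (\<lambda>t. 0)"

definition add_vec :: "Z2_vector \<Rightarrow> Z2_vector \<Rightarrow> Z2_vector" where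
  "add_vec x y = (\<lambda>t. x t + y t)"

definition Z2_space :: "nat \<Rightarrow> Z2_vector set" where
  "Z2_space r = {x. \<forall>t. t \<notin> {1..r} \<longrightarrow> x t = 0}"

definition permute_vec :: "(nat \<Rightarrow> nat) \<Rightarrow> Z2_vector \<Rightarrow> Z2_vector" where
  "permute_vec \<sigma> x = (\<lambda>t. x (\<sigma> t))"

definition co_unit :: "nat \<Rightarrow> nat \<Rightarrow> Z2_vector" where
  "co_unit r i = (\<lambda>t. if t \<in> {1..r} \<and> t \<noteq> i then 1 else 0)"

definition weighted_digraph :: "nat \<Rightarrow> (nat \<Rightarrow> nat) \<Rightarrow> weights \<Rightarrow> bool" where
  "weighted_digraph m \<omega> W \<longleftrightarrow>
     (\<forall>u\<in>{1..m}. \<forall>w\<in>{1..m}. W u w \<in> Z2_space (\<omega> u)) \<and>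
     (\<forall>u w. u \<notin> {1..m} \<or> w \<notin> {1..m} \<longrightarrow> W u w = zero_vec)"

definition edges :: "weights \<Rightarrow> (nat \<times> nat) set" where
  "edges W = {(u, w). W u w \<noteq> zero_vec}"

definition in_neighbors :: "weights \<Rightarrow> nat \<Rightarrow> nat set" where
  "in_neighbors W v = {u. (u, v) \<in> edges W}"

definition out_neighbors :: "weights \<Rightarrow> nat \<Rightarrow> nat set" where
  "out_neighbors W v = {w. (v, w) \<in> edges W}"

definition acyclic_weighted_digraphs :: "nat \<Rightarrow> (nat \<Rightarrow> nat) \<Rightarrow> weights set" where
  "acyclic_weighted_digraphs m \<omega> = {W. weighted_digraph m \<omega> W \<and> acyclic (edges W)}"

definition reorder_vertices :: "(nat \<Rightarrow> nat) \<Rightarrow> weights \<Rightarrow> weights" where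
  "reorder_vertices \<mu> W = (\<lambda>p q. W (\<mu> p) (\<mu> q))"

definition permute_weights_at :: "nat \<Rightarrow> (nat \<Rightarrow> nat) \<Rightarrow> weights \<Rightarrow> weights" where
  "permute_weights_at v \<sigma> W = (\<lambda>u w. if u = v then permute_vec \<sigma> (W u w) else W u w)"

definition local_complementation ::
  "(nat \<Rightarrow> nat) \<Rightarrow> (nat \<Rightarrow> nat) \<Rightarrow> nat \<Rightarrow> nat \<Rightarrow> weights \<Rightarrow> weights" where
  "local_complementation \<omega> \<sigma> k v W = (\<lambda>u w.
     if (u, w) \<in> in_neighbors W v \<times> out_neighbors W v \<and> W v w k = 1
       then add_vec (W u w) (W u v)
     else if u = v \<and> W v w k = 0
       then permute_vec \<sigma> (W v w)
     else if u = v \<and> W v w k = 1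
       then add_vec (permute_vec \<sigma> (W v w)) (co_unit (\<omega> v) (inv \<sigma> k))
     else W u w)"

inductive omega_step :: "nat \<Rightarrow> (nat \<Rightarrow> nat) \<Rightarrow> weights \<Rightarrow> weights \<Rightarrow> bool"
  for m :: nat and \<omega> :: "nat \<Rightarrow> nat" where
  reorder: "\<mu> permutes {1..m} \<Longrightarrow> (\<forall>p\<in>{1..m}. \<omega> (\<mu> p) = \<omega> p) \<Longrightarrow>
     omega_step m \<omega> W (reorder_vertices \<mu> W)"
| permute: "v \<in> {1..m} \<Longrightarrow> \<sigma> permutes {1..\<omega> v} \<Longrightarrow>
     omega_step m \<omega> W (permute_weights_at v \<sigma> W)"
| complement: "v \<in> {1..m} \<Longrightarrow> \<sigma> permutes {1..\<omega> v} \<Longrightarrow> k \<in> {1..\<omega> v} \<Longrightarrow>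
     omega_step m \<omega> W (local_complementation \<omega> \<sigma> k v W)"

text \<open>
  On acyclic digraphs every step preserves acyclicity and can be undone by further steps, so the
  reflexive transitive closure is an equivalence relation there.
\<close>

definition omega_equivalent :: "nat \<Rightarrow> (nat \<Rightarrow> nat) \<Rightarrow> weights \<Rightarrow> weights \<Rightarrow> bool" where
  "omega_equivalent m \<omega> = (omega_step m \<omega>)\<^sup>*\<^sup>*"

definition digraph_classes :: "nat \<Rightarrow> (nat \<Rightarrow> nat) \<Rightarrow> weights set set" where
  "digraph_classes m \<omega> = acyclic_weighted_digraphs m \<omega> //
     {(W, W'). W \<in> acyclic_weighted_digraphs m \<omega> \<and> W' \<in> acyclic_weighted_digraphs m \<omega> \<and>
               omega_equivalent m \<omega> W W'}"

end

theory Submission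
  imports Defs
begin

text \<open>
  A small cover is determined by its characteristic function, which sends a facet of \<open>P\<close> to the
  generator of the isotropy group of its interior points, up to automorphisms of \<open>\<int>\<^sub>2\<^sup>n\<close> and of the
  face poset of \<open>P\<close>.  Indeed the isotropy groups are constant on open faces, the orbit map has a
  global section because \<open>P\<close> is convex, and acting on the section identifies the small cover with a
  quotient of \<open>P \<times> \<int>\<^sub>2\<^sup>n\<close> that depends only on the characteristic function.  Local standardness says
  that the values at the facets through a vertex form a basis.

  Normalizing the basis at the origin, a characteristic function becomes a matrix with one column
  for each simplex.  Its blocks off the diagonal are the weights of a digraph, and the basis
  condition at the remaining vertices says that the digraph is acyclic.  The automorphisms of the face
  poset are generated by permutations of the simplices, permutations of the facets \<open>(v, i)\<close> with
  \<open>i \<noteq> 0\<close>, and exchanges of \<open>(v, 0)\<close> and \<open>(v, k)\<close>; after renormalization these are the three kinds of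
  moves on digraphs.
\<close>

section \<open>Linear algebra over the field with two elements\<close>

text \<open>Two facts carry the combinatorial half. Over the field with two elements the basis
  condition says that no nonempty set of facets with a common point has sum zero, which is visibly
  invariant under facet automorphisms. And a normalized characteristic function is fixed by the
  facet permutation that produces it from a given one, since the remaining linear map must fix all
  unit vectors. So it is enough to realize each facet permutation by moves; different composites of
  moves never have to be compared. On the topological side a weakly equivariant homeomorphism is
  only continuous and induces just a homeomorphism of \<open>P\<close>. That it permutes the facets
  is read off from the orders of the isotropy groups and the connectedness of the open faces. The
  orbit map is not part of the data of a small cover, so characteristic functions are attached to a
  manifold by a relation. Every digraph has to be realized by a manifold whose points belong to the
  given type; the model is therefore built in a Euclidean space and moved there by
  cardinality.\<close>

declare add_bit_eq_xor [simp del] mult_bit_eq_and [simp del]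

instance bit :: finite
proof
  have "(UNIV :: bit set) = {0, 1}"
    by (auto intro: bit_not_zero_iff[THEN iffD1])
  then show "finite (UNIV :: bit set)"
    by (metis finite.emptyI finite.insertI)
qed

lemma bit_add_self [simp]: "a + a = (0 :: bit)"
  by (cases a) simp_all

lemma bit_vec_add_self [simp]: "x + x = (0 :: bit^'n)"
  by (simp add: vec_eq_iff)

lemma bit_vec_diff [simp]: "x - y = (x + y :: bit^'n)"
  by (simp add: vec_eq_iff)

lemma bit_vec_add_eq_0_iff: "x + y = 0 \<longleftrightarrow> x = (y :: bit^'n)"
  by (metis bit_vec_diff eq_iff_diff_eq_0)

lemma bit_vec_add_add_self [simp]: "x + (x + y) = (y :: bit^'n)"
  by (metis add.assoc add.left_neutral bit_vec_add_self)

lemma bit_smult_vec: "a *s x = (if a = 1 then x else 0)" for x :: "bit^'n"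
  by (cases a) (simp_all add: vec_eq_iff)

definition add_hom :: "('a::plus \<Rightarrow> 'b::plus) \<Rightarrow> bool"
  where "add_hom f \<longleftrightarrow> (\<forall>x y. f (x + y) = f x + f y)"

lemma additive_add: "add_hom f \<Longrightarrow> f (x + y) = f x + f y"
  by (simp add: add_hom_def)

lemma additive_0: "add_hom f \<Longrightarrow> f 0 = 0" for f :: "'a::monoid_add \<Rightarrow> 'b::cancel_comm_monoid_add"
  by (metis add_0 add_cancel_right_right additive_add)

lemma additive_sum: "add_hom f \<Longrightarrow> f (sum g A) = (\<Sum>a\<in>A. f (g a))"
  for f :: "'a::comm_monoid_add \<Rightarrow> 'b::cancel_comm_monoid_add"
  by (induction A rule: infinite_finite_induct) (simp_all add: additive_0 additive_add)

lemma Z2_automorphism_iff: "Z2_automorphism \<theta> \<longleftrightarrow> bij \<theta> \<and> add_hom \<theta>"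
  by (simp add: Z2_automorphism_def add_hom_def)

lemma Z2_automorphism_id: "Z2_automorphism (\<lambda>x. x)"
  using bij_id by (simp add: Z2_automorphism_def id_def)

lemma Z2_automorphism_comp:
  "Z2_automorphism \<theta> \<Longrightarrow> Z2_automorphism \<eta> \<Longrightarrow> Z2_automorphism (\<lambda>x. \<theta> (\<eta> x))"
  using bij_comp[of \<eta> \<theta>] by (simp add: Z2_automorphism_def comp_def)

lemma Z2_automorphism_inv:
  assumes "Z2_automorphism \<theta>"
  shows "Z2_automorphism (inv \<theta>)"
proof -
  have b: "bij \<theta>" and a: "\<And>x y. \<theta> (x + y) = \<theta> x + \<theta> y"
    using assms by (auto simp: Z2_automorphism_def)
  have "inv \<theta> (x + y) = inv \<theta> x + inv \<theta> y" for x y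
    using a[of "inv \<theta> x" "inv \<theta> y"] b by (metis bij_inv_eq_iff)
  then show ?thesis
    using b by (simp add: Z2_automorphism_def bij_imp_bij_inv)
qed

lemma additive_bij_iff: "add_hom f \<Longrightarrow> bij f \<longleftrightarrow> (\<forall>x. f x = 0 \<longrightarrow> x = 0)"
  for f :: "bit^'n::finite \<Rightarrow> bit^'n"
proof -
  assume a: "add_hom f"
  have "inj f \<longleftrightarrow> (\<forall>x. f x = 0 \<longrightarrow> x = 0)"
    unfolding inj_def using a additive_0[OF a]
    by (metis additive_add bit_vec_add_eq_0_iff)
  moreover have "bij f \<longleftrightarrow> inj f"
    by (metis UNIV_I bij_def finite_UNIV_inj_surj finite_class.finite_UNIV)
  ultimately show ?thesis
    by simp
qed

text \<open>The matrix with columns \<open>B j\<close> applied to \<open>x\<close>. That the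
  \<open>B j\<close> form a basis is expressed throughout by \<open>bij (comb B)\<close>.\<close>

definition comb :: "('n::finite \<Rightarrow> bit^'n) \<Rightarrow> bit^'n \<Rightarrow> bit^'n"
  where "comb B x = (\<Sum>j\<in>UNIV. x $ j *s B j)"

lemma comb_add: "comb B (x + y) = comb B x + comb B y"
  by (simp add: comb_def vec.scale_left_distrib sum.distrib)

lemma additive_comb: "add_hom (comb B)"
  by (simp add: add_hom_def comb_add)

lemma comb_axis [simp]: "comb B (axis j 1) = B j"
proof -
  have "comb B (axis j 1) = (\<Sum>i\<in>UNIV. if i = j then B j else 0)"
    unfolding comb_def by (intro sum.cong) (auto simp: axis_def)
  then show ?thesis
    by simp
qed

lemma comb_eq_sum: "comb B x = (\<Sum>j | x $ j = 1. B j)"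
  unfolding comb_def by (simp add: bit_smult_vec sum.If_cases)

lemma vec_bit_eq_sum: "(x :: bit^'n::finite) = (\<Sum>j | x $ j = 1. axis j 1)"
proof -
  have "x = comb (\<lambda>j. axis j 1) x"
    by (simp add: comb_def vec_eq_iff axis_def if_distrib cong: if_cong)
  then show ?thesis
    by (simp add: comb_eq_sum)
qed

lemma additive_eqI:
  fixes f g :: "bit^'n::finite \<Rightarrow> bit^'n"
  assumes "add_hom f" "add_hom g" "\<And>j. f (axis j 1) = g (axis j 1)"
  shows "f x = g x"
  by (subst (1 2) vec_bit_eq_sum) (simp add: additive_sum assms)

lemma additive_comp_comb: "add_hom f \<Longrightarrow> f (comb B x) = comb (\<lambda>j. f (B j)) x"
  for f :: "bit^'n::finite \<Rightarrow> bit^'n"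
  by (simp add: comb_eq_sum additive_sum)

lemma Z2_automorphism_comb: "Z2_automorphism (comb B) \<longleftrightarrow> bij (comb B)"
  by (simp add: Z2_automorphism_iff additive_comb)

text \<open>An additive map that reaches all unit vectors is onto, hence invertible since the space
  is finite. This gives invertibility of maps whose inverse would be awkward to write down.\<close>

lemma additive_surjI:
  fixes F :: "bit^'n::finite \<Rightarrow> bit^'n"
  assumes F: "add_hom F" and ax: "\<And>j. axis j 1 \<in> range F"
  shows "bij F"
proof -
  obtain g where g: "\<And>j. axis j 1 = F (g j)"
    using ax unfolding image_iff by metis
  have "x \<in> range F" for x
  proof -
    have "x = (\<Sum>j | x $ j = 1. F (g j))"
      using vec_bit_eq_sum[of x] by (simp add: g)
    also have "\<dots> = F (\<Sum>j | x $ j = 1. g j)"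
      by (simp add: additive_sum[OF F])
    finally show ?thesis
      by blast
  qed
  then have "surj F"
    by auto
  then show ?thesis
    by (simp add: bij_def finite_UNIV_surj_inj)
qed

lemma card_supported: "card {x :: bit^'n::finite. \<forall>j. x $ j = 1 \<longrightarrow> j \<in> J} = 2 ^ card J"
proof -
  have "bij_betw (\<lambda>x. {j. x $ j = 1}) {x :: bit^'n. \<forall>j. x $ j = 1 \<longrightarrow> j \<in> J} (Pow J)"
  proof (rule bij_betw_byWitness[where f' = "\<lambda>A. \<chi> j. if j \<in> A then 1 else 0"])
    show "\<forall>x\<in>{x :: bit^'n. \<forall>j. x $ j = 1 \<longrightarrow> j \<in> J}.
        (\<chi> j. if j \<in> {j. x $ j = 1} then 1 else 0) = x"
      by (auto simp: vec_eq_iff)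
  qed (auto split: if_splits)
  then show ?thesis
    by (simp add: bij_betw_same_card card_Pow)
qed

text \<open>For finite \<open>S\<close> in a group of exponent two this is the subgroup generated by
  the values of \<open>\<kappa>\<close> on \<open>S\<close>: two subset sums add up to the sum over
  the symmetric difference.\<close>

definition subset_sums :: "('f \<Rightarrow> 'a::comm_monoid_add) \<Rightarrow> 'f set \<Rightarrow> 'a set"
  where "subset_sums \<kappa> S = {sum \<kappa> A | A. A \<subseteq> S}"

lemma additive_subset_sums:
  "add_hom \<theta> \<Longrightarrow> \<theta> ` subset_sums \<kappa> S = subset_sums (\<lambda>f. \<theta> (\<kappa> f)) S"
  for \<theta> :: "'a::comm_monoid_add \<Rightarrow> 'b::cancel_comm_monoid_add"
  by (auto simp: subset_sums_def additive_sum image_iff)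
    (metis additive_sum)

lemma subset_sums_cong:
  "(\<And>f. f \<in> S \<Longrightarrow> \<kappa> f = \<mu> f) \<Longrightarrow> subset_sums \<kappa> S = subset_sums \<mu> S"
  unfolding subset_sums_def by (metis (no_types, lifting) subset_iff sum.cong)

lemma subset_sums_reindex:
  assumes "inj_on \<tau> S"
  shows "subset_sums \<kappa> (\<tau> ` S) = subset_sums (\<lambda>f. \<kappa> (\<tau> f)) S"
proof -
  have "sum \<kappa> (\<tau> ` A) = (\<Sum>f\<in>A. \<kappa> (\<tau> f))" if "A \<subseteq> S" for A
    using assms that by (simp add: sum.reindex inj_on_subset)
  moreover have "{A. A \<subseteq> \<tau> ` S} = (`) \<tau> ` {A. A \<subseteq> S}"
    by (auto simp: subset_image_iff)
  ultimately show ?thesis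
    unfolding subset_sums_def setcompr_eq_image by (simp add: image_image)
qed

section \<open>Facets of a product of simplices\<close>

text \<open>
  The facet \<open>(v, i)\<close> is the facet of the \<open>v\<close>-th simplex \<open>\<Delta>\<close> opposite to its \<open>i\<close>-th vertex; the vertex
  \<open>0\<close> is the origin.
\<close>

locale simplices =
  fixes m :: nat and \<omega> :: "nat \<Rightarrow> nat" and E :: "nat \<times> nat \<Rightarrow> 'n::finite"
  assumes bij_E: "bij_betw E (SIGMA v:{1..m}. {1..\<omega> v}) UNIV"
    and \<omega>_pos: "v \<in> {1..m} \<Longrightarrow> 1 \<le> \<omega> v"
begin

definition facets :: "(nat \<times> nat) set"
  where "facets = (SIGMA v:{1..m}. {0..\<omega> v})"

text \<open>The barycentric coordinate of the vertex opposite to the facet \<open>f\<close>, so that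
  \<open>f\<close> is cut out by its vanishing. The origin of each simplex receives the complement
  to one.\<close>

definition bary :: "nat \<times> nat \<Rightarrow> real^'n \<Rightarrow> real"
  where "bary f x = (if snd f = 0 then 1 - (\<Sum>t=1..\<omega> (fst f). x $ E (fst f, t)) else x $ E f)"

definition polytope :: "(real^'n) set"
  where "polytope = {x. \<forall>f\<in>facets. 0 \<le> bary f x}"

definition zero_facets :: "real^'n \<Rightarrow> (nat \<times> nat) set"
  where "zero_facets x = {f \<in> facets. bary f x = 0}"

text \<open>A vertex of the product is a choice of one vertex per simplex; the values of
  \<open>c\<close> outside \<open>{1..m}\<close> are arbitrary.\<close>

definition vertex :: "(nat \<Rightarrow> nat) \<Rightarrow> bool"
  where "vertex c \<longleftrightarrow> (\<forall>v\<in>{1..m}. c v \<le> \<omega> v)"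

definition blk :: "'n \<Rightarrow> nat"
  where "blk j = fst (inv_into (SIGMA v:{1..m}. {1..\<omega> v}) E j)"

definition idx :: "'n \<Rightarrow> nat"
  where "idx j = snd (inv_into (SIGMA v:{1..m}. {1..\<omega> v}) E j)"

text \<open>The facets through the vertex opposite to the facets \<open>(v, c v)\<close>, indexed by coordinates.\<close>

definition Fv :: "(nat \<Rightarrow> nat) \<Rightarrow> 'n \<Rightarrow> nat \<times> nat"
  where "Fv c j = (blk j, if idx j = c (blk j) then 0 else idx j)"

definition nonsing :: "(nat \<times> nat \<Rightarrow> bit^'n) \<Rightarrow> bool"
  where "nonsing \<kappa> \<longleftrightarrow> (\<forall>c. vertex c \<longrightarrow> bij (comb (\<lambda>j. \<kappa> (Fv c j))))"

text \<open>The automorphisms of the face poset, as permutations of the facets.\<close>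

definition facet_aut :: "(nat \<times> nat \<Rightarrow> nat \<times> nat) \<Rightarrow> bool"
  where "facet_aut \<tau> \<longleftrightarrow> bij_betw \<tau> facets facets \<and>
    (\<forall>f\<in>facets. \<forall>g\<in>facets. fst (\<tau> f) = fst (\<tau> g) \<longleftrightarrow> fst f = fst g)"

definition sim :: "(nat \<times> nat \<Rightarrow> bit^'n) \<Rightarrow> (nat \<times> nat \<Rightarrow> bit^'n) \<Rightarrow> bool"
  where "sim \<kappa> \<kappa>' \<longleftrightarrow> (\<exists>\<tau> \<theta>. facet_aut \<tau> \<and> Z2_automorphism \<theta> \<and> (\<forall>f\<in>facets. \<kappa>' (\<tau> f) = \<theta> (\<kappa> f)))"

lemma finite_facets [simp]: "finite facets"
  by (simp add: facets_def)

lemma facets_iff [simp]: "(v, i) \<in> facets \<longleftrightarrow> v \<in> {1..m} \<and> i \<le> \<omega> v"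
  by (auto simp: facets_def)

lemma blk_idx: "blk j \<in> {1..m}" "idx j \<in> {1..\<omega> (blk j)}" "E (blk j, idx j) = j"
proof -
  have "inv_into (SIGMA v:{1..m}. {1..\<omega> v}) E j \<in> (SIGMA v:{1..m}. {1..\<omega> v})"
    using bij_E by (auto simp: bij_betw_def inv_into_into)
  moreover have "E (inv_into (SIGMA v:{1..m}. {1..\<omega> v}) E j) = j"
    using bij_E by (auto simp: bij_betw_def f_inv_into_f)
  ultimately show "blk j \<in> {1..m}" "idx j \<in> {1..\<omega> (blk j)}" "E (blk j, idx j) = j"
    by (auto simp: blk_def idx_def mem_Sigma_iff split_beta)
qed

lemma blk_idx_ge: "1 \<le> blk j" "blk j \<le> m" "1 \<le> idx j" "idx j \<le> \<omega> (blk j)"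
  using blk_idx[of j] by auto

lemma blk_E [simp]: "v \<in> {1..m} \<Longrightarrow> t \<in> {1..\<omega> v} \<Longrightarrow> blk (E (v, t)) = v"
  and idx_E [simp]: "v \<in> {1..m} \<Longrightarrow> t \<in> {1..\<omega> v} \<Longrightarrow> idx (E (v, t)) = t"
  using bij_E by (auto simp: blk_def idx_def bij_betw_def)

lemma E_eq_iff: "v \<in> {1..m} \<Longrightarrow> t \<in> {1..\<omega> v} \<Longrightarrow> E (v, t) = j \<longleftrightarrow> blk j = v \<and> idx j = t"
  using blk_idx(3)[of j] by auto

lemma bij_betw_Fv:
  assumes "vertex c"
  shows "bij_betw (Fv c) UNIV {f \<in> facets. snd f \<noteq> c (fst f)}"
proof (rule bij_betw_imageI)
  show "inj (Fv c)"
  proof (rule injI)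
    fix i j assume *: "Fv c i = Fv c j"
    then have "blk i = blk j"
      by (simp add: Fv_def)
    moreover from this have "idx i = idx j"
      using * blk_idx_ge[of i] blk_idx_ge[of j] by (auto simp: Fv_def split: if_splits)
    ultimately show "i = j"
      by (metis blk_idx(3))
  qed
  show "range (Fv c) = {f \<in> facets. snd f \<noteq> c (fst f)}"
  proof (intro equalityI subsetI)
    fix f assume "f \<in> range (Fv c)"
    then obtain j where "f = Fv c j"
      by auto
    then show "f \<in> {f \<in> facets. snd f \<noteq> c (fst f)}"
      using blk_idx_ge[of j] by (auto simp: Fv_def split: if_splits)
  next
    fix f assume f: "f \<in> {f \<in> facets. snd f \<noteq> c (fst f)}"
    obtain v i where vi: "f = (v, i)"
      by (cases f)
    have v: "v \<in> {1..m}" and i: "i \<le> \<omega> v" "i \<noteq> c v"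
      using f by (auto simp: vi)
    \<comment> \<open>In \<open>Fv c\<close> the facet \<open>(v, 0)\<close> occupies the slot of
      the omitted facet \<open>(v, c v)\<close>.\<close>
    define t where "t = (if i = 0 then c v else i)"
    have t: "t \<in> {1..\<omega> v}"
      using assms v i by (auto simp: t_def vertex_def)
    have "Fv c (E (v, t)) = f"
      using v t i by (auto simp: Fv_def vi t_def)
    then show "f \<in> range (Fv c)"
      by (metis rangeI)
  qed
qed

lemma Fv_in_facets: "vertex c \<Longrightarrow> Fv c j \<in> facets"
  using bij_betw_Fv[of c] by (auto simp: bij_betw_def)

lemma Fv_neq: "vertex c \<Longrightarrow> (v, c v) \<noteq> Fv c j"
  using bij_betw_Fv[of c] unfolding bij_betw_def
  by (metis (mono_tags, lifting) fst_conv mem_Collect_eq rangeI snd_conv)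

lemma inj_Fv: "vertex c \<Longrightarrow> inj (Fv c)"
  using bij_betw_Fv[of c] by (auto simp: bij_betw_def)

lemma range_Fv: "vertex c \<Longrightarrow> range (Fv c) = {f \<in> facets. snd f \<noteq> c (fst f)}"
  using bij_betw_Fv[of c] by (auto simp: bij_betw_def)

lemma subset_range_Fv:
  assumes "vertex c" "S \<subseteq> facets" "\<And>v. (v, c v) \<notin> S"
  shows "S \<subseteq> range (Fv c)"
proof
  fix f assume f: "f \<in> S"
  then have "snd f \<noteq> c (fst f)"
    using assms(3)[of "fst f"] by (metis prod.collapse)
  then show "f \<in> range (Fv c)"
    using f assms(2) by (subst range_Fv[OF assms(1)]) auto
qed

lemma fst_Fv [simp]: "fst (Fv c j) = blk j"
  by (simp add: Fv_def)

lemma vertex_0: "vertex (\<lambda>v. 0)"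
  by (simp add: vertex_def)

lemma Fv_0: "Fv (\<lambda>v. 0) j = (blk j, idx j)"
  by (simp add: Fv_def)

text \<open>All facets of \<open>S\<close> pass through the vertex \<open>c\<close>, so a subset of
  \<open>S\<close> is the support of a coefficient vector with respect to the facets at
  \<open>c\<close>.\<close>

lemma subset_sums_eq_comb_image:
  assumes c: "vertex c" and S: "S \<subseteq> facets" "\<And>v. (v, c v) \<notin> S"
  shows "subset_sums \<kappa> S = comb (\<lambda>j. \<kappa> (Fv c j)) ` {x. \<forall>j. x $ j = 1 \<longrightarrow> Fv c j \<in> S}"
proof -
  note Sr = subset_range_Fv[OF c S]
  have "\<exists>x. sum \<kappa> A = comb (\<lambda>j. \<kappa> (Fv c j)) x \<and> (\<forall>j. x $ j = 1 \<longrightarrow> Fv c j \<in> S)"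
    if "A \<subseteq> S" for A
  proof -
    define x :: "bit^'n" where "x = (\<chi> j. if Fv c j \<in> A then 1 else 0)"
    have "A = Fv c ` {j. Fv c j \<in> A}"
      using that Sr by auto
    then have "sum \<kappa> A = (\<Sum>j | Fv c j \<in> A. \<kappa> (Fv c j))"
      using sum.reindex[of "Fv c" "{j. Fv c j \<in> A}" \<kappa>] inj_Fv[OF c]
      by (simp add: inj_on_subset)
    also have "\<dots> = comb (\<lambda>j. \<kappa> (Fv c j)) x"
      unfolding comb_eq_sum x_def by (intro sum.cong) (auto split: if_splits)
    finally show ?thesis
      using that by (auto simp: x_def split: if_splits intro!: exI[of _ x])
  qed
  moreover have "comb (\<lambda>j. \<kappa> (Fv c j)) x \<in> subset_sums \<kappa> S"
    if "\<forall>j. x $ j = 1 \<longrightarrow> Fv c j \<in> S" for x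
  proof -
    have "comb (\<lambda>j. \<kappa> (Fv c j)) x = sum \<kappa> (Fv c ` {j. x $ j = 1})"
      using sum.reindex[of "Fv c" "{j. x $ j = 1}" \<kappa>] inj_Fv[OF c]
      by (simp add: inj_on_subset comb_eq_sum)
    then show ?thesis
      using that unfolding subset_sums_def by blast
  qed
  ultimately show ?thesis
    unfolding subset_sums_def by blast
qed

lemma card_subset_sums:
  assumes \<kappa>: "nonsing \<kappa>" and c: "vertex c" and S: "S \<subseteq> facets" "\<And>v. (v, c v) \<notin> S"
  shows "card (subset_sums \<kappa> S) = 2 ^ card S"
proof -
  let ?J = "{j. Fv c j \<in> S}"
  have "bij (comb (\<lambda>j. \<kappa> (Fv c j)))"
    using \<kappa> c by (simp add: nonsing_def)
  then have "card (subset_sums \<kappa> S) = card {x :: bit^'n. \<forall>j. x $ j = 1 \<longrightarrow> j \<in> ?J}"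
    unfolding subset_sums_eq_comb_image[OF c S]
    by (subst card_image) (auto simp: bij_def inj_on_def)
  also have "\<dots> = 2 ^ card ?J"
    by (rule card_supported)
  also have "card ?J = card S"
  proof -
    have "S = Fv c ` ?J"
      using subset_range_Fv[OF c S] by auto
    then show ?thesis
      using card_image[of "Fv c" ?J] inj_Fv[OF c] by (simp add: inj_on_subset)
  qed
  finally show ?thesis .
qed

lemma nonsing_cong: "(\<And>f. f \<in> facets \<Longrightarrow> \<kappa> f = \<mu> f) \<Longrightarrow> nonsing \<kappa> \<longleftrightarrow> nonsing \<mu>"
  by (simp add: nonsing_def comb_def Fv_in_facets)

lemma nonsing_aut:
  assumes "nonsing \<kappa>" "Z2_automorphism \<theta>"
  shows "nonsing (\<lambda>f. \<theta> (\<kappa> f))"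
proof -
  have "comb (\<lambda>j. \<theta> (\<kappa> (Fv c j))) = \<theta> \<circ> comb (\<lambda>j. \<kappa> (Fv c j))" for c
    using assms by (auto simp: Z2_automorphism_iff additive_comp_comb)
  then show ?thesis
    using assms by (auto simp: nonsing_def Z2_automorphism_iff bij_comp)
qed

section \<open>Characteristic functions and acyclic digraphs\<close>

text \<open>The sets of facets with a common point.\<close>

definition face_set :: "(nat \<times> nat) set \<Rightarrow> bool"
  where "face_set A \<longleftrightarrow> A \<subseteq> facets \<and> (\<forall>v\<in>{1..m}. \<exists>i\<le>\<omega> v. (v, i) \<notin> A)"

lemma face_set_vertex:
  assumes "face_set A"
  obtains c where "vertex c" "\<And>v. (v, c v) \<notin> A"
proof -
  obtain c where c: "\<And>v. v \<in> {1..m} \<Longrightarrow> c v \<le> \<omega> v \<and> (v, c v) \<notin> A"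
    using assms unfolding face_set_def by metis
  have "(v, c v) \<notin> A" for v
    using c[of v] assms by (cases "v \<in> {1..m}") (auto simp: face_set_def)
  moreover have "vertex c"
    using c by (simp add: vertex_def)
  ultimately show ?thesis
    using that by blast
qed

text \<open>Over the field with two elements a linear relation is a set of vectors with sum zero,
  and every set of facets with a common point extends to the facets through some vertex. This form
  mentions neither vertices nor coordinates, so it transfers along facet automorphisms.\<close>

lemma nonsing_iff: "nonsing \<kappa> \<longleftrightarrow> (\<forall>A. face_set A \<and> sum \<kappa> A = 0 \<longrightarrow> A = {})"
proof (intro iffI allI impI; (elim conjE)?)
  fix A assume \<kappa>: "nonsing \<kappa>" and A: "face_set A" and s: "sum \<kappa> A = 0"
  obtain c where c: "vertex c" "\<And>v. (v, c v) \<notin> A"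
    using A by (rule face_set_vertex) blast
  have AF: "A \<subseteq> facets"
    using A by (simp add: face_set_def)
  have "card (subset_sums \<kappa> A) = 2 ^ card A"
    using card_subset_sums[OF \<kappa> c(1) AF c(2)] .
  moreover have "subset_sums \<kappa> A = sum \<kappa> ` Pow A"
    by (auto simp: subset_sums_def)
  \<comment> \<open>There are as many sums as subsets, so summation is injective on the subsets of
    \<open>A\<close>; then \<open>A\<close> and the empty set, both with sum zero, coincide.\<close>
  ultimately have "inj_on (sum \<kappa>) (Pow A)"
    using AF by (intro eq_card_imp_inj_on) (auto simp: card_Pow finite_subset)
  then show "A = {}"
    by (rule inj_onD) (auto simp: s)
next
  assume *: "\<forall>A. face_set A \<and> sum \<kappa> A = 0 \<longrightarrow> A = {}"
  show "nonsing \<kappa>"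
    unfolding nonsing_def
  proof (intro allI impI)
    fix c assume c: "vertex c"
    have "x = 0" if x: "comb (\<lambda>j. \<kappa> (Fv c j)) x = 0" for x
    proof -
      let ?A = "Fv c ` {j. x $ j = 1}"
      have "face_set ?A"
        unfolding face_set_def
      proof (intro conjI ballI)
        show "?A \<subseteq> facets"
          using Fv_in_facets[OF c] by auto
        show "\<exists>i\<le>\<omega> v. (v, i) \<notin> ?A" if "v \<in> {1..m}" for v
          using c that Fv_neq[OF c, of v] by (intro exI[of _ "c v"]) (auto simp: vertex_def)
      qed
      moreover have "sum \<kappa> ?A = 0"
        using x inj_Fv[OF c] by (subst sum.reindex) (auto simp: comb_eq_sum inj_on_def)
      ultimately have "?A = {}"
        using * by blast
      then show ?thesis
        by (auto simp: vec_eq_iff)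
    qed
    then show "bij (comb (\<lambda>j. \<kappa> (Fv c j)))"
      by (simp add: additive_bij_iff[OF additive_comb])
  qed
qed

section \<open>Facet automorphisms and similarity of characteristic functions\<close>

lemma facet_aut_in: "facet_aut \<tau> \<Longrightarrow> f \<in> facets \<Longrightarrow> \<tau> f \<in> facets"
  by (auto simp: facet_aut_def bij_betw_def)

lemma facet_aut_inj: "facet_aut \<tau> \<Longrightarrow> inj_on \<tau> facets"
  by (auto simp: facet_aut_def bij_betw_def)

lemma facet_aut_surj:
  assumes "facet_aut \<tau>" "g \<in> facets"
  obtains f where "f \<in> facets" "g = \<tau> f"
proof -
  have "g \<in> \<tau> ` facets"
    using assms by (simp add: facet_aut_def bij_betw_def)
  then show ?thesis
    using that by (elim imageE)
qed

lemma facet_aut_id: "facet_aut (\<lambda>f. f)"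
  by (simp add: facet_aut_def bij_betw_def)

lemma facet_aut_comp: "facet_aut \<tau> \<Longrightarrow> facet_aut \<rho> \<Longrightarrow> facet_aut (\<lambda>f. \<tau> (\<rho> f))"
  using bij_betw_trans[of \<rho> facets facets \<tau> facets] facet_aut_in[of \<rho>]
  by (auto simp: facet_aut_def comp_def)

lemma facet_aut_inv:
  assumes "facet_aut \<tau>"
  shows "facet_aut (inv_into facets \<tau>)"
proof -
  have b: "bij_betw \<tau> facets facets"
    using assms by (simp add: facet_aut_def)
  have i: "inv_into facets \<tau> f \<in> facets" "\<tau> (inv_into facets \<tau> f) = f" if "f \<in> facets" for f
    using b that by (auto simp: bij_betw_def inv_into_into f_inv_into_f)
  have "fst (inv_into facets \<tau> f) = fst (inv_into facets \<tau> g) \<longleftrightarrow> fst f = fst g" if "f \<in> facets" "g \<in> facets" for f g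
  proof -
    have "fst (\<tau> (inv_into facets \<tau> f)) = fst (\<tau> (inv_into facets \<tau> g)) \<longleftrightarrow>
        fst (inv_into facets \<tau> f) = fst (inv_into facets \<tau> g)"
      using assms i(1) that unfolding facet_aut_def by blast
    then show ?thesis
      by (simp only: i(2) that)
  qed
  then show ?thesis
    using bij_betw_inv_into[OF b] by (simp add: facet_aut_def)
qed

text \<open>A facet that \<open>A\<close> misses in the block carried to block \<open>v\<close> is
  mapped to a facet that the image misses in block \<open>v\<close>.\<close>

lemma face_set_image:
  assumes \<tau>: "facet_aut \<tau>" and A: "face_set A"
  shows "face_set (\<tau> ` A)"
  unfolding face_set_def
proof (intro conjI ballI)
  have AF: "A \<subseteq> facets"
    using A by (simp add: face_set_def)
  then show "\<tau> ` A \<subseteq> facets"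
    using facet_aut_in[OF \<tau>] by auto
  fix v assume v: "v \<in> {1..m}"
  then obtain f where f: "f \<in> facets" "(v, 0) = \<tau> f"
    using facet_aut_surj[OF \<tau>, of "(v, 0)"] by (metis facets_iff zero_le)
  then have "fst f \<in> {1..m}"
    by (cases f) auto
  then obtain i where i: "i \<le> \<omega> (fst f)" "(fst f, i) \<notin> A"
    using A unfolding face_set_def by blast
  have g: "(fst f, i) \<in> facets"
    using f i by (cases f) auto
  have "fst (\<tau> (fst f, i)) = fst (\<tau> f)"
    using \<tau> f g by (auto simp: facet_aut_def)
  then have "fst (\<tau> (fst f, i)) = v"
    using f(2) by (metis fst_conv)
  then have "\<tau> (fst f, i) = (v, snd (\<tau> (fst f, i)))"
    by (metis prod.collapse)
  moreover have "\<tau> (fst f, i) \<notin> \<tau> ` A"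
    using inj_on_image_mem_iff[OF facet_aut_inj[OF \<tau>] g AF] i by simp
  moreover have "\<tau> (fst f, i) \<in> facets"
    using facet_aut_in[OF \<tau> g] .
  ultimately show "\<exists>i\<le>\<omega> v. (v, i) \<notin> \<tau> ` A"
    by (metis facets_iff)
qed

text \<open>Similarity with the facet permutation kept explicit; only then is a normalized target
  unique, see \<open>tsim_determined\<close>.\<close>

definition tsim :: "(nat \<times> nat \<Rightarrow> nat \<times> nat) \<Rightarrow> (nat \<times> nat \<Rightarrow> bit^'n) \<Rightarrow> (nat \<times> nat \<Rightarrow> bit^'n) \<Rightarrow> bool"
  where "tsim \<tau> \<kappa> \<kappa>' \<longleftrightarrow> (\<exists>\<theta>. Z2_automorphism \<theta> \<and> (\<forall>f\<in>facets. \<kappa>' (\<tau> f) = \<theta> (\<kappa> f)))"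

lemma sim_iff_tsim: "sim \<kappa> \<kappa>' \<longleftrightarrow> (\<exists>\<tau>. facet_aut \<tau> \<and> tsim \<tau> \<kappa> \<kappa>')"
  by (auto simp: sim_def tsim_def)

lemma tsim_id: "tsim (\<lambda>f. f) \<kappa> \<kappa>"
  unfolding tsim_def using Z2_automorphism_id by (intro exI[of _ "\<lambda>x. x"]) auto

lemma tsim_trans:
  assumes "facet_aut \<tau>" "tsim \<tau> \<kappa> \<kappa>'" "tsim \<tau>' \<kappa>' \<kappa>''"
  shows "tsim (\<lambda>f. \<tau>' (\<tau> f)) \<kappa> \<kappa>''"
proof -
  obtain \<theta> \<eta> where "Z2_automorphism \<theta>" "\<forall>f\<in>facets. \<kappa>' (\<tau> f) = \<theta> (\<kappa> f)"
    and "Z2_automorphism \<eta>" "\<forall>f\<in>facets. \<kappa>'' (\<tau>' f) = \<eta> (\<kappa>' f)"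
    using assms unfolding tsim_def by auto
  then show ?thesis
    unfolding tsim_def using facet_aut_in[OF assms(1)] Z2_automorphism_comp[of \<eta> \<theta>]
    by (intro exI[of _ "\<lambda>x. \<eta> (\<theta> x)"]) auto
qed

lemma tsim_sym:
  assumes \<tau>: "facet_aut \<tau>" and t: "tsim \<tau> \<kappa> \<kappa>'"
  shows "tsim (inv_into facets \<tau>) \<kappa>' \<kappa>"
proof -
  obtain \<theta> where \<theta>: "Z2_automorphism \<theta>" "\<forall>f\<in>facets. \<kappa>' (\<tau> f) = \<theta> (\<kappa> f)"
    using t unfolding tsim_def by auto
  have "\<kappa> (inv_into facets \<tau> g) = inv \<theta> (\<kappa>' g)" if g: "g \<in> facets" for g
  proof -
    obtain f where f: "f \<in> facets" "g = \<tau> f"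
      using facet_aut_surj[OF \<tau> g] .
    then have "inv_into facets \<tau> g = f"
      using facet_aut_inj[OF \<tau>] by simp
    moreover have "inv \<theta> (\<theta> (\<kappa> f)) = \<kappa> f"
      using \<theta>(1) by (simp add: Z2_automorphism_def bij_def)
    ultimately show ?thesis
      using f \<theta>(2) by simp
  qed
  then show ?thesis
    unfolding tsim_def using Z2_automorphism_inv[OF \<theta>(1)] by (intro exI[of _ "inv \<theta>"]) auto
qed

lemma sim_refl: "sim \<kappa> \<kappa>"
  using facet_aut_id tsim_id sim_iff_tsim by blast

lemma sim_sym: "sim \<kappa> \<kappa>' \<Longrightarrow> sim \<kappa>' \<kappa>"
  using facet_aut_inv tsim_sym sim_iff_tsim by blast

lemma sim_trans: "sim \<kappa> \<kappa>' \<Longrightarrow> sim \<kappa>' \<kappa>'' \<Longrightarrow> sim \<kappa> \<kappa>''"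
  using facet_aut_comp tsim_trans sim_iff_tsim by meson

text \<open>Sums over a face set and over its image under \<open>\<tau>\<close> correspond under
  \<open>\<theta>\<close>, so the zero-sum criterion transfers.\<close>

lemma nonsing_sim:
  assumes "sim \<kappa> \<kappa>'" "nonsing \<kappa>"
  shows "nonsing \<kappa>'"
proof -
  obtain \<tau> \<theta> where \<tau>: "facet_aut \<tau>" and \<theta>: "Z2_automorphism \<theta>"
    and eq: "\<forall>f\<in>facets. \<kappa> (\<tau> f) = \<theta> (\<kappa>' f)"
    using sim_sym[OF assms(1)] unfolding sim_def by auto
  have "A = {}" if A: "face_set A" and s: "sum \<kappa>' A = 0" for A
  proof -
    have AF: "A \<subseteq> facets"
      using A by (simp add: face_set_def)
    have "sum \<kappa> (\<tau> ` A) = (\<Sum>f\<in>A. \<kappa> (\<tau> f))"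
      using facet_aut_inj[OF \<tau>] AF by (simp add: sum.reindex inj_on_subset)
    also have "\<dots> = (\<Sum>f\<in>A. \<theta> (\<kappa>' f))"
      using eq AF by (intro sum.cong) auto
    also have "\<dots> = \<theta> (sum \<kappa>' A)"
      using \<theta> by (simp add: Z2_automorphism_iff additive_sum)
    also have "\<dots> = 0"
      using \<theta> s by (simp add: Z2_automorphism_iff additive_0)
    finally show ?thesis
      using face_set_image[OF \<tau> A] assms(2) by (auto simp: nonsing_iff)
  qed
  then show ?thesis
    by (auto simp: nonsing_iff)
qed

section \<open>Normalized characteristic functions and acyclicity\<close>

definition normalized :: "(nat \<times> nat \<Rightarrow> bit^'n) \<Rightarrow> bool"
  where "normalized \<kappa> \<longleftrightarrow> (\<forall>j. \<kappa> (blk j, idx j) = axis j 1)"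

lemma normalized_E: "normalized \<kappa> \<Longrightarrow> v \<in> {1..m} \<Longrightarrow> t \<in> {1..\<omega> v} \<Longrightarrow> \<kappa> (v, t) = axis (E (v, t)) 1"
  unfolding normalized_def by (metis blk_E idx_E)

text \<open>Let \<open>y\<close> be the sum of the columns \<open>(w, 0)\<close> with
  \<open>w\<close> in \<open>T\<close>. The facets \<open>(w, 0)\<close> together with the
  coordinate facets in the support of \<open>y\<close> have sum \<open>y + y = 0\<close>. By
  nonsingularity they have no common point, so they exhaust some block. That block belongs to
  \<open>T\<close>, as otherwise \<open>(v, 0)\<close> would be missing, and on it \<open>y\<close>
  is all ones. One-element sets \<open>T\<close> compute the diagonal blocks, larger ones exclude
  cycles.\<close>

lemma normalized_nonsing_ex:
  assumes nor: "normalized \<kappa>" and \<kappa>: "nonsing \<kappa>" and T: "T \<subseteq> {1..m}" "T \<noteq> {}"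
  obtains v where "v \<in> T" "\<And>t. t \<in> {1..\<omega> v} \<Longrightarrow> (\<Sum>w\<in>T. \<kappa> (w, 0)) $ E (v, t) = 1"
proof (rule ccontr)
  note witness = that
  assume "\<not> thesis"
  then have no: "\<exists>t\<in>{1..\<omega> v}. (\<Sum>w\<in>T. \<kappa> (w, 0)) $ E (v, t) = 0" if "v \<in> T" for v
    using witness[OF that] bit_not_one_iff by blast
  define y where "y = (\<Sum>w\<in>T. \<kappa> (w, 0))"
  define A1 where "A1 = (\<lambda>v. (v, 0::nat)) ` T"
  define A2 where "A2 = (\<lambda>j. (blk j, idx j)) ` {j. y $ j = 1}"
  have fin: "finite A1" "finite A2"
    using T by (auto simp: A1_def A2_def finite_subset)
  have idx0: "idx j \<noteq> 0" for j
    using blk_idx_ge[of j] by linarith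
  have "sum \<kappa> A1 = y"
    unfolding A1_def y_def by (subst sum.reindex) (auto simp: inj_on_def)
  moreover have "sum \<kappa> A2 = y"
  proof -
    have "sum \<kappa> A2 = (\<Sum>j | y $ j = 1. \<kappa> (blk j, idx j))"
      unfolding A2_def by (subst sum.reindex) (auto simp: inj_on_def, metis blk_idx(3))
    also have "\<dots> = (\<Sum>j | y $ j = 1. axis j 1)"
      using nor by (simp add: normalized_def)
    finally show ?thesis
      using vec_bit_eq_sum[of y] by simp
  qed
  moreover have "A1 \<inter> A2 = {}"
    by (auto simp: A1_def A2_def) (use idx0 in metis)
  ultimately have "sum \<kappa> (A1 \<union> A2) = 0"
    using fin by (simp add: sum.union_disjoint)
  moreover have "face_set (A1 \<union> A2)"
    unfolding face_set_def
  proof (intro conjI ballI)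
    show "A1 \<union> A2 \<subseteq> facets"
      using T blk_idx_ge by (auto simp: A1_def A2_def)
    fix v assume v: "v \<in> {1..m}"
    show "\<exists>i\<le>\<omega> v. (v, i) \<notin> A1 \<union> A2"
    proof (cases "v \<in> T")
      case True
      then obtain t where t: "t \<in> {1..\<omega> v}" "y $ E (v, t) = 0"
        using no[OF True] unfolding y_def by blast
      then have "(v, t) \<notin> A1 \<union> A2"
        by (auto simp: A1_def A2_def) (metis bit.distinct(1) blk_idx(3))
      then show ?thesis
        using t by auto
    next
      case False
      then have "(v, 0) \<notin> A1 \<union> A2"
        by (auto simp: A1_def A2_def) (use idx0 in metis)
      then show ?thesis
        by auto
    qed
  qed
  ultimately have "A1 = {}"
    using \<kappa> by (auto simp: nonsing_iff)
  then show False
    using T by (simp add: A1_def)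
qed

text \<open>
  The characteristic function attached to a digraph: the columns belonging to the facets \<open>(v, 0)\<close>
  have all ones in the block of \<open>v\<close>, and the weights of the edges into \<open>v\<close> elsewhere.
\<close>

definition dchar :: "weights \<Rightarrow> nat \<times> nat \<Rightarrow> bit^'n"
  where "dchar W f = (if snd f = 0 then \<chi> j. if blk j = fst f then 1 else W (blk j) (fst f) (idx j)
    else axis (E f) 1)"

lemma idx_neq_0 [simp]: "idx j \<noteq> 0"
  using blk_idx_ge(3)[of j] by linarith

lemma normalized_dchar: "normalized (dchar W)"
  by (simp add: normalized_def dchar_def blk_idx(3))

lemma dchar_0 [simp]: "dchar W (v, 0) $ j = (if blk j = v then 1 else W (blk j) v (idx j))"
  by (simp add: dchar_def)

lemma dchar_pos: "i \<noteq> 0 \<Longrightarrow> dchar W (v, i) = axis (E (v, i)) 1"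
  by (simp add: dchar_def)

lemma edges_subset:
  assumes "weighted_digraph m \<omega> W"
  shows "edges W \<subseteq> {1..m} \<times> {1..m}"
proof clarify
  fix u w assume "(u, w) \<in> edges W"
  then have "W u w \<noteq> zero_vec"
    by (simp add: edges_def)
  then show "u \<in> {1..m} \<and> w \<in> {1..m}"
    using assms unfolding weighted_digraph_def by blast
qed

text \<open>\<open>dchar\<close> overwrites the diagonal blocks by ones and cannot see loops, hence
  the hypothesis on \<open>W v v\<close>. For the set \<open>T\<close> below, the columns
  \<open>(x, 0)\<close> with \<open>x\<close> in \<open>T\<close> contribute to a row
  \<open>(v, t)\<close> only the diagonal one and the entry of the single out-neighbour
  \<open>w\<close>. Where \<open>W v w t = 1\<close> these cancel, although nonsingularity demands a
  block of ones.\<close>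

lemma dchar_nonsing_imp_acyclic:
  assumes W: "weighted_digraph m \<omega> W" "\<And>v. W v v = zero_vec" and ns: "nonsing (dchar W)"
  shows "acyclic (edges W)"
proof (rule ccontr)
  \<comment> \<open>In a smallest set \<open>T\<close> without sinks every vertex has exactly one out-neighbour in \<open>T\<close>.\<close>
  let ?R = "\<lambda>T. T \<noteq> {} \<and> finite T \<and> (\<forall>u\<in>T. \<exists>w\<in>T. (u, w) \<in> edges W)"
  have sub: "edges W \<subseteq> {1..m} \<times> {1..m}"
    using edges_subset[OF W(1)] .
  then have fin: "finite (edges W)"
    by (meson finite_SigmaI finite_atLeastAtMost finite_subset)
  assume "\<not> acyclic (edges W)"
  then have "\<not> wf ((edges W)\<inverse>)"
    using fin by (metis acyclic_converse converse_converse wf_acyclic)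
  then obtain Q q where Q: "q \<in> Q" "\<And>u. u \<in> Q \<Longrightarrow> \<exists>w\<in>Q. (w, u) \<in> (edges W)\<inverse>"
    unfolding wf_eq_minimal by metis
  then have "Q \<subseteq> {1..m}"
    using sub by (auto; meson SigmaE2 converseD subsetD)
  then have "?R Q"
    using Q by (auto simp: finite_subset)
  then obtain T where T: "?R T" and min: "\<And>S. ?R S \<Longrightarrow> card T \<le> card S"
    using ex_has_least_nat[of ?R Q card] by blast
  have Tm: "T \<subseteq> {1..m}"
    using T sub by blast
  \<comment> \<open>The image of \<open>T\<close> under a choice of out-neighbours is again without
    sinks, so minimality of \<open>T\<close> makes the choice surjective.\<close>
  have surj: "s ` T = T" if s: "\<And>u. u \<in> T \<Longrightarrow> s u \<in> T \<and> (u, s u) \<in> edges W" for s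
  proof (rule card_seteq)
    show "finite T" "s ` T \<subseteq> T"
      using T s by auto
    have "?R (s ` T)"
      using T s by auto
    then show "card T \<le> card (s ` T)"
      by (rule min)
  qed
  \<comment> \<open>Two choice functions that differ only at \<open>u\<close> are both surjective.
    So the second takes the value \<open>a\<close> at some point other than \<open>u\<close>, where
    the first agrees with it, against injectivity of the first.\<close>
  have uniq: "a = b" if u: "u \<in> T" and ab: "a \<in> T" "b \<in> T" "(u, a) \<in> edges W" "(u, b) \<in> edges W" for u a b
  proof (rule ccontr)
    assume "a \<noteq> b"
    obtain s0 where s0: "\<And>u. u \<in> T \<Longrightarrow> s0 u \<in> T \<and> (u, s0 u) \<in> edges W"
      using T by metis
    define s where "s = s0(u := a)"
    define s' where "s' = s0(u := b)"
    have "s ` T = T"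
      by (rule surj) (use s0 ab in \<open>auto simp: s_def\<close>)
    moreover have "s' ` T = T"
      by (rule surj) (use s0 ab in \<open>auto simp: s'_def\<close>)
    ultimately have "inj_on s T" "a \<in> s' ` T"
      using T ab by (simp_all add: eq_card_imp_inj_on)
    then obtain u' where u': "u' \<in> T" "s' u' = a"
      by auto
    then have "u' \<noteq> u" "s u' = s u"
      using \<open>a \<noteq> b\<close> by (auto simp: s_def s'_def split: if_splits)
    then show False
      using \<open>inj_on s T\<close> u u' by (auto simp: inj_on_def)
  qed
  obtain v where v: "v \<in> T" "\<And>t. t \<in> {1..\<omega> v} \<Longrightarrow> (\<Sum>w\<in>T. dchar W (w, 0)) $ E (v, t) = 1"
    using normalized_nonsing_ex[OF normalized_dchar ns Tm] T by blast
  obtain w where w: "w \<in> T" "(v, w) \<in> edges W"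
    using T v by blast
  have wv: "w \<noteq> v"
    using w W(2) by (auto simp: edges_def)
  obtain t where t: "W v w t = 1"
    using w by (auto simp: edges_def zero_vec_def fun_eq_iff)
  have t': "t \<in> {1..\<omega> v}"
    using W(1) v w Tm t unfolding weighted_digraph_def Z2_space_def by (metis (mono_tags, lifting) bit.distinct(1) mem_Collect_eq subsetD)
  have vm: "v \<in> {1..m}"
    using v Tm by auto
  have "(\<Sum>x\<in>T. dchar W (x, 0)) $ E (v, t) = (\<Sum>x\<in>T. dchar W (x, 0) $ E (v, t))"
    by (simp add: sum_component)
  also have "\<dots> = (\<Sum>x\<in>{v, w}. dchar W (x, 0) $ E (v, t))"
  proof (rule sum.mono_neutral_right)
    show "finite T" "{v, w} \<subseteq> T"
      using T v w by auto
    show "\<forall>x\<in>T - {v, w}. dchar W (x, 0) $ E (v, t) = 0"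
    proof
      fix x assume x: "x \<in> T - {v, w}"
      then have "(v, x) \<notin> edges W"
        using uniq[of v x w] v w by auto
      then show "dchar W (x, 0) $ E (v, t) = 0"
        using x vm t' by (auto simp: edges_def zero_vec_def)
    qed
  qed
  also have "\<dots> = 0"
    using wv vm t' t by simp
  finally show False
    using v(2)[OF t'] by simp
qed

text \<open>If columns \<open>(v, 0)\<close> occur in a face set with sum zero, take a sink
  \<open>u\<close> among these \<open>v\<close>. In a row \<open>(u, k)\<close> whose facet is
  missing from the set only the diagonal entry of column \<open>(u, 0)\<close> survives, so the sum
  is not zero. Without such columns only distinct unit vectors are left.\<close>

lemma nonsing_dchar:
  assumes W: "W \<in> acyclic_weighted_digraphs m \<omega>"
  shows "nonsing (dchar W)"
  unfolding nonsing_iff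
proof (intro allI impI; elim conjE)
  fix A assume A: "face_set A" and s: "sum (dchar W) A = 0"
  have AF: "A \<subseteq> facets"
    using A by (simp add: face_set_def)
  have finA: "finite A"
    using AF finite_facets finite_subset by blast
  have sj: "(\<Sum>f\<in>A. dchar W f $ j) = 0" for j
    using s by (metis sum_component zero_index)
  have sub: "edges W \<subseteq> {1..m} \<times> {1..m}"
    using W by (intro edges_subset) (simp add: acyclic_weighted_digraphs_def)
  then have "finite (edges W)"
    by (meson finite_SigmaI finite_atLeastAtMost finite_subset)
  then have wf: "wf ((edges W)\<inverse>)"
    using W by (simp add: acyclic_weighted_digraphs_def finite_acyclic_wf_converse)
  have no0: "(v, 0) \<notin> A" for v
  proof
    assume "(v, 0) \<in> A"
    then obtain u where u: "(u, 0) \<in> A" and min: "\<And>w. (w, u) \<in> (edges W)\<inverse> \<Longrightarrow> (w, 0) \<notin> A"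
      using wfE_min[OF wf, of v "{v. (v, 0) \<in> A}"] by auto
    have um: "u \<in> {1..m}"
      using u AF by (auto dest: subsetD)
    then obtain k where k: "k \<le> \<omega> u" "(u, k) \<notin> A"
      using A unfolding face_set_def by blast
    then have k': "k \<in> {1..\<omega> u}"
      using u by (cases "k = 0") auto
    have "(\<Sum>f\<in>A. dchar W f $ E (u, k)) = (\<Sum>f\<in>{(u, 0)}. dchar W f $ E (u, k))"
    proof (rule sum.mono_neutral_right)
      show "\<forall>f\<in>A - {(u, 0)}. dchar W f $ E (u, k) = 0"
      proof
        fix f assume f: "f \<in> A - {(u, 0)}"
        obtain w i where wi: "f = (w, i)"
          by (cases f)
        show "dchar W f $ E (u, k) = 0"
        proof (cases "i = 0")
          case True
          then have "(w, u) \<notin> (edges W)\<inverse>"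
            using min f wi by auto
          then show ?thesis
            using True f um k' by (auto simp: wi edges_def zero_vec_def)
        next
          case False
          have "f \<in> facets"
            using f AF by auto
          then have "E (u, k) \<noteq> E (w, i)"
            using False f k k' um by (auto simp: wi E_eq_iff)
          then show ?thesis
            using False by (simp add: wi dchar_pos axis_def)
        qed
      qed
    qed (use finA u in auto)
    then show False
      using sj[of "E (u, k)"] um k' by simp
  qed
  show "A = {}"
  proof (rule ccontr)
    assume "A \<noteq> {}"
    then obtain u k where uk: "(u, k) \<in> A"
      by auto
    have k: "u \<in> {1..m}" "k \<in> {1..\<omega> u}"
      using uk AF no0[of u] by (cases "k = 0"; auto dest: subsetD)+
    have "(\<Sum>f\<in>A. dchar W f $ E (u, k)) = (\<Sum>f\<in>{(u, k)}. dchar W f $ E (u, k))"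
    proof (rule sum.mono_neutral_right)
      show "\<forall>f\<in>A - {(u, k)}. dchar W f $ E (u, k) = 0"
      proof
        fix f assume f: "f \<in> A - {(u, k)}"
        obtain w i where wi: "f = (w, i)"
          by (cases f)
        have "f \<in> facets" "i \<noteq> 0"
          using f AF no0[of w] wi by (auto intro!: gr0I)
        then have "E (u, k) \<noteq> E (w, i)"
          using f k by (auto simp: wi E_eq_iff)
        then show "dchar W f $ E (u, k) = 0"
          using \<open>i \<noteq> 0\<close> by (simp add: wi dchar_pos axis_def)
      qed
    qed (use finA uk in auto)
    then show False
      using sj[of "E (u, k)"] k by (simp add: dchar_pos)
  qed
qed

lemma nonsing_normal_form:
  assumes \<kappa>: "nonsing \<kappa>"
  obtains W where "W \<in> acyclic_weighted_digraphs m \<omega>" "sim \<kappa> (dchar W)"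
proof -
  define \<theta> where "\<theta> = comb (\<lambda>j. \<kappa> (Fv (\<lambda>v. 0) j))"
  have \<theta>: "Z2_automorphism \<theta>"
    using \<kappa> vertex_0 by (simp add: \<theta>_def Z2_automorphism_comb nonsing_def)
  have inv_\<theta>: "Z2_automorphism (inv \<theta>)"
    by (rule Z2_automorphism_inv[OF \<theta>])
  define \<kappa>' where "\<kappa>' = (\<lambda>f. inv \<theta> (\<kappa> f))"
  have ns: "nonsing \<kappa>'"
    unfolding \<kappa>'_def by (rule nonsing_aut[OF \<kappa> inv_\<theta>])
  have nor: "normalized \<kappa>'"
    unfolding normalized_def
  proof
    fix j
    have "\<theta> (axis j 1) = \<kappa> (blk j, idx j)"
      by (simp add: \<theta>_def Fv_0)
    then show "\<kappa>' (blk j, idx j) = axis j 1"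
      using \<theta> by (metis Z2_automorphism_def \<kappa>'_def bij_inv_eq_iff)
  qed
  define W :: weights where "W = (\<lambda>u w t. if u \<in> {1..m} \<and> w \<in> {1..m} \<and> u \<noteq> w \<and> t \<in> {1..\<omega> u}
    then \<kappa>' (w, 0) $ E (u, t) else 0)"
  have eq: "dchar W f = \<kappa>' f" if f: "f \<in> facets" for f
  proof -
    obtain v i where vi: "f = (v, i)" "v \<in> {1..m}" "i \<le> \<omega> v"
      using f by (cases f) auto
    show ?thesis
    proof (cases "i = 0")
      case True
      have "\<kappa>' (v, 0) $ j = 1" if "blk j = v" for j
      proof -
        \<comment> \<open>For the one-element set \<open>{v}\<close> this says that the diagonal
          block of column \<open>(v, 0)\<close> consists of ones.\<close>
        obtain u where u: "u \<in> {v}" "\<And>t. t \<in> {1..\<omega> u} \<Longrightarrow> (\<Sum>w\<in>{v}. \<kappa>' (w, 0)) $ E (u, t) = 1"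
          using normalized_nonsing_ex[OF nor ns, of "{v}"] vi by blast
        then show ?thesis
          using that blk_idx[of j] u(1) u(2)[of "idx j"] by simp
      qed
      then show ?thesis
        using True vi blk_idx_ge by (auto simp: vec_eq_iff W_def blk_idx(3))
    next
      case False
      then show ?thesis
        using vi normalized_E[OF nor, of v i] by (simp add: dchar_pos)
    qed
  qed
  have wd: "weighted_digraph m \<omega> W"
    by (auto simp: weighted_digraph_def W_def Z2_space_def zero_vec_def)
  have "nonsing (dchar W)"
    using ns eq nonsing_cong by blast
  moreover have "W v v = zero_vec" for v
    by (simp add: W_def zero_vec_def)
  ultimately have "W \<in> acyclic_weighted_digraphs m \<omega>"
    using dchar_nonsing_imp_acyclic[OF wd] wd by (simp add: acyclic_weighted_digraphs_def)
  moreover have "sim \<kappa> (dchar W)"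
    unfolding sim_def using facet_aut_id inv_\<theta> eq
    by (intro exI[of _ "\<lambda>f. f"] exI[of _ "inv \<theta>"]) (simp add: \<kappa>'_def)
  ultimately show ?thesis
    by (rule that)
qed

section \<open>Moves on digraphs\<close>

lemma dchar_pos_component:
  assumes "v \<in> {1..m}" "t \<le> \<omega> v" "t \<noteq> 0"
  shows "dchar W (v, t) $ i = (if blk i = v \<and> idx i = t then 1 else 0)"
  using assms by (auto simp: dchar_pos axis_def blk_idx(3))

text \<open>The values of \<open>dchar W\<close> include all unit vectors, so an additive
  \<open>\<theta>\<close> matching the two functions is automatically invertible. Each move is then
  verified by a formula for \<open>\<theta>\<close> alone.\<close>

lemma additive_dchar_imp_tsim:
  assumes \<tau>: "facet_aut \<tau>" and \<theta>: "add_hom \<theta>" and eq: "\<And>f. f \<in> facets \<Longrightarrow> dchar W (\<tau> f) = \<theta> (\<kappa> f)"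
  shows "tsim \<tau> \<kappa> (dchar W)"
proof -
  have ax: "axis j 1 \<in> range \<theta>" for j
  proof -
    have "(blk j, idx j) \<in> facets"
      using blk_idx_ge[of j] by simp
    then obtain f where "f \<in> facets" "(blk j, idx j) = \<tau> f"
      by (rule facet_aut_surj[OF \<tau>])
    then show ?thesis
      using eq normalized_dchar[of W] unfolding normalized_def by (metis rangeI)
  qed
  then have "bij \<theta>"
    by (rule additive_surjI[OF \<theta>])
  then show ?thesis
    unfolding tsim_def using \<theta> eq by (auto simp: Z2_automorphism_iff)
qed

text \<open>The columns show all weights except those of loops, and acyclicity makes the latter
  zero.\<close>

lemma dchar_inject:
  assumes W: "W \<in> acyclic_weighted_digraphs m \<omega>" "W' \<in> acyclic_weighted_digraphs m \<omega>"
    and eq: "\<And>v. v \<in> {1..m} \<Longrightarrow> dchar W (v, 0) = dchar W' (v, 0)"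
  shows "W = W'"
proof (intro ext)
  fix u w t
  have wd: "weighted_digraph m \<omega> W" "weighted_digraph m \<omega> W'"
    using W by (auto simp: acyclic_weighted_digraphs_def)
  show "W u w t = W' u w t"
  proof (cases "u \<in> {1..m} \<and> w \<in> {1..m}")
    case out: False
    then show ?thesis
      using wd unfolding weighted_digraph_def by metis
  next
    case uw: True
    show ?thesis
    proof (cases "u = w")
      case True
      have "V u u = zero_vec" if "V \<in> acyclic_weighted_digraphs m \<omega>" for V
        using that by (auto simp: acyclic_weighted_digraphs_def acyclic_def edges_def)
      then show ?thesis
        using True W by simp
    next
      case False
      show ?thesis
      proof (cases "t \<in> {1..\<omega> u}")
        case True
        then show ?thesis
          using uw eq[of w] dchar_0[of W w "E (u, t)"] dchar_0[of W' w "E (u, t)"] False by simp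
      next
        case out: False
        then show ?thesis
          using wd uw unfolding weighted_digraph_def Z2_space_def by simp
      qed
    qed
  qed
qed

text \<open>
  Hence the digraph obtained from a facet automorphism does not depend on how the automorphism is
  composed of elementary moves.
\<close>

lemma tsim_determined:
  assumes W: "W \<in> acyclic_weighted_digraphs m \<omega>" "W' \<in> acyclic_weighted_digraphs m \<omega>"
    and \<tau>: "facet_aut \<tau>" and t: "tsim \<tau> \<kappa> (dchar W)" "tsim \<tau> \<kappa> (dchar W')"
  shows "W = W'"
proof -
  have "tsim (\<lambda>f. \<tau> (inv_into facets \<tau> f)) (dchar W) (dchar W')"
    using tsim_trans[OF facet_aut_inv[OF \<tau>] tsim_sym[OF \<tau> t(1)] t(2)] .
  then obtain \<theta> where \<theta>: "Z2_automorphism \<theta>"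
    and eq: "\<forall>f\<in>facets. dchar W' (\<tau> (inv_into facets \<tau> f)) = \<theta> (dchar W f)"
    unfolding tsim_def by auto
  have eq': "dchar W' f = \<theta> (dchar W f)" if "f \<in> facets" for f
    using eq that \<tau> by (simp add: facet_aut_def bij_betw_def f_inv_into_f)
  \<comment> \<open>Both functions are normalized, so \<open>\<theta>\<close> fixes the unit
    vectors.\<close>
  have "\<theta> x = x" for x
  proof (rule additive_eqI)
    show "add_hom \<theta>" "add_hom (\<lambda>x :: bit^'n. x)"
      using \<theta> by (auto simp: Z2_automorphism_iff add_hom_def)
    fix j
    have "(blk j, idx j) \<in> facets"
      using blk_idx_ge[of j] by simp
    then show "\<theta> (axis j 1) = axis j 1"
      using eq'[of "(blk j, idx j)"] normalized_dchar[of W] normalized_dchar[of W']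
      by (simp add: normalized_def)
  qed
  then show ?thesis
    using eq' by (intro dchar_inject[OF W]) simp
qed

definition block_perm :: "nat \<Rightarrow> (nat \<Rightarrow> nat) \<Rightarrow> nat \<times> nat \<Rightarrow> nat \<times> nat"
  where "block_perm v \<rho> f = (if fst f = v then (v, \<rho> (snd f)) else f)"

lemma facet_autI:
  assumes "\<And>f. f \<in> facets \<Longrightarrow> \<tau> f \<in> facets" "inj_on \<tau> facets"
    and "\<And>f g. f \<in> facets \<Longrightarrow> g \<in> facets \<Longrightarrow> fst (\<tau> f) = fst (\<tau> g) \<longleftrightarrow> fst f = fst g"
  shows "facet_aut \<tau>"
proof -
  have "\<tau> ` facets = facets"
    using assms(1,2) by (intro endo_inj_surj) auto
  then show ?thesis
    using assms by (auto simp: facet_aut_def bij_betw_def)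
qed

lemma facet_aut_block_perm:
  assumes "v \<in> {1..m}" and \<rho>: "\<rho> permutes {0..\<omega> v}"
  shows "facet_aut (block_perm v \<rho>)"
proof (rule facet_autI)
  have "\<rho> i \<le> \<omega> v" if "i \<le> \<omega> v" for i
    using permutes_in_image[OF \<rho>, of i] that by simp
  then show "block_perm v \<rho> f \<in> facets" if "f \<in> facets" for f
    using that by (cases f) (auto simp: block_perm_def)
  show "inj_on (block_perm v \<rho>) facets"
    using permutes_inj[OF \<rho>] by (auto simp: inj_on_def block_perm_def split: if_splits)
qed (auto simp: block_perm_def)

text \<open>Acyclicity of the result of a move is obtained without looking at paths: similarity
  preserves nonsingularity, and nonsingularity of \<open>dchar\<close> excludes cycles.\<close>

lemma acyclic_from_tsim:
  assumes W: "W \<in> acyclic_weighted_digraphs m \<omega>" and \<tau>: "facet_aut \<tau>"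
    and t: "tsim \<tau> (dchar W) (dchar W')"
    and W': "weighted_digraph m \<omega> W'" "\<And>v. W' v v = zero_vec"
  shows "W' \<in> acyclic_weighted_digraphs m \<omega>"
proof -
  have "nonsing (dchar W')"
    using nonsing_sim[of "dchar W" "dchar W'"] nonsing_dchar[OF W] \<tau> t sim_iff_tsim by blast
  then show ?thesis
    using dchar_nonsing_imp_acyclic[OF W'] W' by (simp add: acyclic_weighted_digraphs_def)
qed

lemma acyclic_digraphD:
  assumes "W \<in> acyclic_weighted_digraphs m \<omega>"
  shows "weighted_digraph m \<omega> W" "W v v = zero_vec" "W u w = zero_vec \<or> W w u = zero_vec"
    "u \<notin> {1..m} \<or> w \<notin> {1..m} \<Longrightarrow> W u w = zero_vec"
    "u \<in> {1..m} \<Longrightarrow> t \<notin> {1..\<omega> u} \<Longrightarrow> W u w t = 0"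
proof -
  show wd: "weighted_digraph m \<omega> W" and 0: "W v v = zero_vec"
    using assms by (auto simp: acyclic_weighted_digraphs_def acyclic_def edges_def)
  have ac: "acyclic (edges W)"
    using assms by (simp add: acyclic_weighted_digraphs_def)
  show "W u w = zero_vec \<or> W w u = zero_vec"
  proof (rule ccontr)
    assume "\<not> ?thesis"
    then have "(u, w) \<in> edges W" "(w, u) \<in> edges W"
      by (auto simp: edges_def)
    then have "(u, u) \<in> (edges W)\<^sup>+"
      by (meson trancl.simps)
    then show False
      using ac by (simp add: acyclic_def)
  qed
  show *: "u \<notin> {1..m} \<or> w \<notin> {1..m} \<Longrightarrow> W u w = zero_vec" for u w
    using wd unfolding weighted_digraph_def by blast
  show "u \<in> {1..m} \<Longrightarrow> t \<notin> {1..\<omega> u} \<Longrightarrow> W u w t = 0"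
    using wd *[of u w] unfolding weighted_digraph_def Z2_space_def by (cases "w \<in> {1..m}") (auto simp: zero_vec_def)
qed

text \<open>Since \<open>permute_vec \<sigma>\<close> reads coordinate \<open>t\<close> from
  position \<open>\<sigma> t\<close>, the facet \<open>(v, t)\<close> moves to
  \<open>(v, inv \<sigma> t)\<close>, and \<open>\<theta>\<close> is the same coordinate permutation
  inside block \<open>v\<close>.\<close>

lemma tsim_permute:
  assumes W: "W \<in> acyclic_weighted_digraphs m \<omega>" and v: "v \<in> {1..m}" and \<sigma>: "\<sigma> permutes {1..\<omega> v}"
  shows "tsim (block_perm v (inv \<sigma>)) (dchar W) (dchar (permute_weights_at v \<sigma> W))"
proof (rule additive_dchar_imp_tsim)
  have \<sigma>0: "\<sigma> 0 = 0" "inv \<sigma> 0 = 0"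
    using \<sigma> permutes_inv[OF \<sigma>] by (auto intro: permutes_not_in)
  have "\<sigma> permutes {0..\<omega> v}"
    using \<sigma> by (rule permutes_subset) auto
  then show "facet_aut (block_perm v (inv \<sigma>))"
    using v permutes_inv by (blast intro: facet_aut_block_perm)
  let ?\<theta> = "\<lambda>x :: bit^'n. \<chi> i. if blk i = v then x $ E (v, \<sigma> (idx i)) else x $ i"
  show "add_hom ?\<theta>"
    by (simp add: add_hom_def vec_eq_iff)
  have \<sigma>in: "\<sigma> (idx i) \<in> {1..\<omega> v}" if "blk i = v" for i
    using permutes_in_image[OF \<sigma>] blk_idx(2)[of i] that by simp
  fix f assume f: "f \<in> facets"
  obtain w t where wt: "f = (w, t)" "w \<in> {1..m}" "t \<le> \<omega> w"
    using f by (cases f) auto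
  have inv: "inv \<sigma> t = s \<longleftrightarrow> \<sigma> s = t" for s t
    by (metis \<sigma> permutes_inverses)
  show "dchar (permute_weights_at v \<sigma> W) (block_perm v (inv \<sigma>) f) = ?\<theta> (dchar W f)"
  proof (cases "t = 0")
    case True
    then show ?thesis
      using v \<sigma>in by (auto simp: wt block_perm_def \<sigma>0 vec_eq_iff permute_weights_at_def permute_vec_def)
  next
    case False
    have "inv \<sigma> t \<in> {1..\<omega> v}" if "w = v"
      using permutes_in_image[OF permutes_inv[OF \<sigma>], of t] False that wt by auto
    then have t': "inv \<sigma> t \<noteq> 0" "inv \<sigma> t \<le> \<omega> v" if "w = v"
      using that by auto
    show ?thesis
      unfolding vec_eq_iff
    proof
      fix i
      have "idx i = inv \<sigma> t \<longleftrightarrow> \<sigma> (idx i) = t"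
        using inv[of t "idx i"] by auto
      then show "dchar (permute_weights_at v \<sigma> W) (block_perm v (inv \<sigma>) f) $ i = ?\<theta> (dchar W f) $ i"
        using False v wt t' \<sigma>in[of i] by (auto simp: wt(1) block_perm_def dchar_pos_component)
    qed
  qed
qed

lemma acyclic_permute:
  assumes W: "W \<in> acyclic_weighted_digraphs m \<omega>" and v: "v \<in> {1..m}" and \<sigma>: "\<sigma> permutes {1..\<omega> v}"
  shows "permute_weights_at v \<sigma> W \<in> acyclic_weighted_digraphs m \<omega>"
proof (rule acyclic_from_tsim[OF W _ tsim_permute[OF W v \<sigma>]])
  have "\<sigma> permutes {0..\<omega> v}"
    using \<sigma> by (rule permutes_subset) auto
  then show "facet_aut (block_perm v (inv \<sigma>))"
    using v permutes_inv by (blast intro: facet_aut_block_perm)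
  note A = acyclic_digraphD[OF W]
  show "permute_weights_at v \<sigma> W u u = zero_vec" for u
    using A(2) by (simp add: permute_weights_at_def permute_vec_def zero_vec_def)
  show "weighted_digraph m \<omega> (permute_weights_at v \<sigma> W)"
    unfolding weighted_digraph_def
  proof (intro conjI ballI allI impI)
    fix u w assume "u \<in> {1..m}" "w \<in> {1..m}"
    then show "permute_weights_at v \<sigma> W u w \<in> Z2_space (\<omega> u)"
      using A(5) permutes_not_in[OF \<sigma>] by (auto simp: Z2_space_def permute_weights_at_def permute_vec_def)
  next
    fix u w assume "u \<notin> {1..m} \<or> w \<notin> {1..m}"
    then show "permute_weights_at v \<sigma> W u w = zero_vec"
      using A(4)[of u w] by (auto simp: permute_weights_at_def permute_vec_def zero_vec_def)
  qed
qed

text \<open>The case distinction becomes a single correction term weighted by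
  \<open>W v w k\<close>: adding \<open>W u v\<close> has an effect only for in-neighbours
  \<open>u\<close>, the coefficient is one only for out-neighbours \<open>w\<close>, and the absence
  of a loop at \<open>v\<close> separates the cases.\<close>

lemma local_complementation_eq:
  assumes W: "W \<in> acyclic_weighted_digraphs m \<omega>"
  shows "local_complementation \<omega> \<sigma> k v W u w t = (if u = v then
      W v w (\<sigma> t) + W v w k * co_unit (\<omega> v) (inv \<sigma> k) t
    else W u w t + W v w k * W u v t)"
  using acyclic_digraphD(2)[OF W, of v]
  by (cases "W v w k")
    (auto simp: local_complementation_def add_vec_def permute_vec_def in_neighbors_def out_neighbors_def
      edges_def zero_vec_def)

text \<open>The facets \<open>(v, 0)\<close> and \<open>(v, k)\<close> change roles, so
  \<open>\<theta>\<close> must send the unit vector of row \<open>(v, k)\<close> to the column of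
  \<open>(v, 0)\<close> and permute the other rows of the block by \<open>\<sigma>\<close>. On a
  column \<open>(w, 0)\<close> with \<open>W v w k = 1\<close> this deletes the entry in row
  \<open>(v, k)\<close> and adds the column of \<open>(v, 0)\<close>, which is the local
  complementation; the deletion explains why \<open>co_unit\<close> has a zero at
  \<open>inv \<sigma> k\<close>.\<close>

lemma tsim_complement:
  assumes W: "W \<in> acyclic_weighted_digraphs m \<omega>" and v: "v \<in> {1..m}"
    and \<sigma>: "\<sigma> permutes {1..\<omega> v}" and k: "k \<in> {1..\<omega> v}"
  shows "tsim (block_perm v (inv \<sigma> \<circ> Transposition.transpose 0 k)) (dchar W)
    (dchar (local_complementation \<omega> \<sigma> k v W))" (is "tsim ?\<tau> _ (dchar ?W)")
proof (rule additive_dchar_imp_tsim)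
  have \<sigma>0: "\<sigma> 0 = 0" "inv \<sigma> 0 = 0"
    using \<sigma> permutes_inv[OF \<sigma>] by (auto intro: permutes_not_in)
  have "\<sigma> permutes {0..\<omega> v}"
    using \<sigma> by (rule permutes_subset) auto
  then have "inv \<sigma> \<circ> Transposition.transpose 0 k permutes {0..\<omega> v}"
    using k by (intro permutes_compose permutes_inv permutes_swap_id) auto
  then show "facet_aut ?\<tau>"
    using v by (blast intro: facet_aut_block_perm)
  let ?\<theta> = "\<lambda>x :: bit^'n. \<chi> i. x $ E (v, k) * dchar ?W (v, 0) $ i +
    (if blk i = v then (if \<sigma> (idx i) = k then 0 else x $ E (v, \<sigma> (idx i))) else x $ i)"
  show "add_hom ?\<theta>"
    by (simp add: add_hom_def vec_eq_iff algebra_simps)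
  have \<sigma>in: "\<sigma> (idx i) \<in> {1..\<omega> v}" if "blk i = v" for i
    using permutes_in_image[OF \<sigma>] blk_idx(2)[of i] that by simp
  have \<sigma>inv: "inv \<sigma> t = s \<longleftrightarrow> \<sigma> s = t" for s t
    by (metis \<sigma> permutes_inverses)
  note A = acyclic_digraphD[OF W]
  \<comment> \<open>The move leaves the column of \<open>(v, 0)\<close> unchanged, because there is
    no loop at \<open>v\<close>.\<close>
  have W0: "dchar ?W (v, 0) $ i = (if blk i = v then 1 else W (blk i) v (idx i))" for i
    using A(2)[of v] by (simp add: local_complementation_eq[OF W] zero_vec_def)
  fix f assume f: "f \<in> facets"
  obtain w t where wt: "f = (w, t)" "w \<in> {1..m}" "t \<le> \<omega> w"
    using f by (cases f) auto
  have kv: "k \<le> \<omega> v" "k \<noteq> 0"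
    using k by auto
  have sinv: "s = inv \<sigma> t \<longleftrightarrow> \<sigma> s = t" for s t
    unfolding \<sigma>inv[symmetric] by (rule eq_commute)
  have in_block: "inv \<sigma> t \<noteq> 0" "inv \<sigma> t \<le> \<omega> v" if "t \<noteq> 0" "t \<le> \<omega> v" for t
    using permutes_in_image[OF permutes_inv[OF \<sigma>], of t] that by auto
  have Ek: "blk (E (v, k)) = v" "idx (E (v, k)) = k"
    using v k by auto
  have E\<sigma>: "blk (E (v, \<sigma> (idx i))) = v" "idx (E (v, \<sigma> (idx i))) = \<sigma> (idx i)" if "blk i = v" for i
    using v \<sigma>in that by auto
  note lc = local_complementation_eq[OF W]
  consider "t = 0" "w = v" | "t = 0" "w \<noteq> v" | "t \<noteq> 0" "w \<noteq> v" | "t \<noteq> 0" "w = v" "t = k"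
    | "t \<noteq> 0" "w = v" "t \<noteq> k"
    by blast
  then show "dchar ?W (?\<tau> f) = ?\<theta> (dchar W f)"
    unfolding vec_eq_iff
  proof cases
    case 1
    have "?\<tau> f = (v, inv \<sigma> k)"
      by (simp add: wt 1 block_perm_def)
    then show "\<forall>i. dchar ?W (?\<tau> f) $ i = ?\<theta> (dchar W f) $ i"
      using Ek E\<sigma> in_block[OF kv(2,1)] v
      by (simp add: wt(1) 1 dchar_pos_component sinv W0 del: dchar_0) (simp add: Ek E\<sigma>)
  next
    case 2
    have "?\<tau> f = (w, 0)"
      by (simp add: wt 2 block_perm_def)
    \<comment> \<open>There is no two-cycle between \<open>v\<close> and \<open>w\<close>, so the
      diagonal block of column \<open>(w, 0)\<close> keeps its ones.\<close>
    moreover have "W (blk i) v (idx i) = 0" if "W v (blk i) k = 1" for i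
      using A(3)[of v "blk i"] that by (auto simp: zero_vec_def)
    moreover have "co_unit (\<omega> v) (inv \<sigma> k) (idx i) = (if \<sigma> (idx i) = k then 0 else 1)" if "blk i = v" for i
      using blk_idx(2)[of i] that by (auto simp: co_unit_def sinv)
    ultimately show "\<forall>i. dchar ?W (?\<tau> f) $ i = ?\<theta> (dchar W f) $ i"
      using Ek E\<sigma> 2 fun_cong[OF A(2)[of v], of k, unfolded zero_vec_def]
      by (cases "W v w k") (auto simp: wt(1) W0 lc simp del: bit_not_zero_iff bit_not_one_iff)
  next
    case 3
    then show "\<forall>i. dchar ?W (?\<tau> f) $ i = ?\<theta> (dchar W f) $ i"
      using Ek E\<sigma> wt by (auto simp: wt(1) block_perm_def dchar_pos_component)
  next
    case 4
    then show "\<forall>i. dchar ?W (?\<tau> f) $ i = ?\<theta> (dchar W f) $ i"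
      using Ek E\<sigma> wt by (auto simp: wt(1) block_perm_def dchar_pos_component \<sigma>0 W0 simp del: dchar_0)
  next
    case 5
    then have "?\<tau> f = (v, inv \<sigma> t)"
      by (simp add: wt(1) block_perm_def transpose_def)
    then show "\<forall>i. dchar ?W (?\<tau> f) $ i = ?\<theta> (dchar W f) $ i"
      using Ek E\<sigma> wt 5 in_block[of t] by (auto simp: wt(1) dchar_pos_component sinv)
  qed
qed

lemma acyclic_complement:
  assumes W: "W \<in> acyclic_weighted_digraphs m \<omega>" and v: "v \<in> {1..m}"
    and \<sigma>: "\<sigma> permutes {1..\<omega> v}" and k: "k \<in> {1..\<omega> v}"
  shows "local_complementation \<omega> \<sigma> k v W \<in> acyclic_weighted_digraphs m \<omega>"
proof (rule acyclic_from_tsim[OF W _ tsim_complement[OF W v \<sigma> k]])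
  have "\<sigma> permutes {0..\<omega> v}"
    using \<sigma> by (rule permutes_subset) auto
  then have "inv \<sigma> \<circ> Transposition.transpose 0 k permutes {0..\<omega> v}"
    using k by (intro permutes_compose permutes_inv permutes_swap_id) auto
  then show "facet_aut (block_perm v (inv \<sigma> \<circ> Transposition.transpose 0 k))"
    using v by (blast intro: facet_aut_block_perm)
  note A = acyclic_digraphD[OF W]
  note lc = local_complementation_eq[OF W]
  show "local_complementation \<omega> \<sigma> k v W u u = zero_vec" for u
    using A(2) A(3)[of u v] by (auto simp: fun_eq_iff lc zero_vec_def)
  show "weighted_digraph m \<omega> (local_complementation \<omega> \<sigma> k v W)"
    unfolding weighted_digraph_def
  proof (intro conjI ballI allI impI)
    fix u w assume "u \<in> {1..m}" "w \<in> {1..m}"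
    then show "local_complementation \<omega> \<sigma> k v W u w \<in> Z2_space (\<omega> u)"
      using A(5) permutes_not_in[OF \<sigma>] by (auto simp: Z2_space_def lc co_unit_def)
  next
    fix u w assume "u \<notin> {1..m} \<or> w \<notin> {1..m}"
    then show "local_complementation \<omega> \<sigma> k v W u w = zero_vec"
      using A(4)[of u w] A(4)[of v w] A(4)[of u v] v by (auto simp: fun_eq_iff lc zero_vec_def)
  qed
qed

text \<open>The new weight at \<open>(p, q)\<close> is read at \<open>(\<mu> p, \<mu> q)\<close>, so
  facets travel by the inverse of \<open>\<mu>\<close>.\<close>

lemma tsim_reorder:
  assumes \<mu>: "\<mu> permutes {1..m}" and \<omega>\<mu>: "\<forall>p\<in>{1..m}. \<omega> (\<mu> p) = \<omega> p"
    and inj: "\<tau> = (\<lambda>f. (inv \<mu> (fst f), snd f))"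
  shows "facet_aut \<tau>" "tsim \<tau> (dchar W) (dchar (reorder_vertices \<mu> W))"
proof -
  have inv: "inv \<mu> t = s \<longleftrightarrow> \<mu> s = t" "s = inv \<mu> t \<longleftrightarrow> \<mu> s = t" for s t
    by (metis \<mu> permutes_inverses)+
  have in_m: "inv \<mu> v \<in> {1..m}" "\<omega> (inv \<mu> v) = \<omega> v" if "v \<in> {1..m}" for v
  proof -
    show "inv \<mu> v \<in> {1..m}"
      using permutes_in_image[OF permutes_inv[OF \<mu>]] that by blast
    then show "\<omega> (inv \<mu> v) = \<omega> v"
      using \<omega>\<mu> inv by metis
  qed
  show \<tau>: "facet_aut \<tau>"
  proof (rule facet_autI)
    show "\<tau> f \<in> facets" if "f \<in> facets" for f
      using that in_m by (cases f) (auto simp: inj)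
    show "inj_on \<tau> facets"
      by (auto simp: inj_on_def inj inv) (metis inv(2))
    show "fst (\<tau> f) = fst (\<tau> g) \<longleftrightarrow> fst f = fst g" if "f \<in> facets" "g \<in> facets" for f g
      by (simp add: inj) (metis inv(2))
  qed
  have \<mu>in: "\<mu> (blk i) \<in> {1..m}" "\<omega> (\<mu> (blk i)) = \<omega> (blk i)" for i
    using permutes_in_image[OF \<mu>] blk_idx(1)[of i] \<omega>\<mu> by auto
  have E\<mu>: "blk (E (\<mu> (blk i), idx i)) = \<mu> (blk i)" "idx (E (\<mu> (blk i), idx i)) = idx i" for i
    using \<mu>in[of i] blk_idx(2)[of i] by simp_all
  show "tsim \<tau> (dchar W) (dchar (reorder_vertices \<mu> W))"
  proof (rule additive_dchar_imp_tsim[OF \<tau>])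
    let ?\<theta> = "\<lambda>x :: bit^'n. \<chi> i. x $ E (\<mu> (blk i), idx i)"
    show "add_hom ?\<theta>"
      by (simp add: add_hom_def vec_eq_iff)
    fix f assume "f \<in> facets"
    then obtain w t where wt: "f = (w, t)" "w \<in> {1..m}" "t \<le> \<omega> w"
      by (cases f) auto
    show "dchar (reorder_vertices \<mu> W) (\<tau> f) = ?\<theta> (dchar W f)"
    proof (cases "t = 0")
      case True
      have "\<mu> (inv \<mu> w) = w"
        using inv by blast
      then show ?thesis
        by (simp add: True wt(1) inj vec_eq_iff E\<mu> inv reorder_vertices_def)
    next
      case False
      then show ?thesis
        using wt in_m[OF wt(2)] by (simp add: inj vec_eq_iff E\<mu> inv dchar_pos_component)
    qed
  qed
qed

lemma acyclic_reorder:
  assumes W: "W \<in> acyclic_weighted_digraphs m \<omega>"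
    and \<mu>: "\<mu> permutes {1..m}" and \<omega>\<mu>: "\<forall>p\<in>{1..m}. \<omega> (\<mu> p) = \<omega> p"
  shows "reorder_vertices \<mu> W \<in> acyclic_weighted_digraphs m \<omega>"
proof (rule acyclic_from_tsim[OF W tsim_reorder[OF \<mu> \<omega>\<mu> refl]])
  note A = acyclic_digraphD[OF W]
  show "reorder_vertices \<mu> W u u = zero_vec" for u
    using A(2) by (simp add: reorder_vertices_def)
  have in_m: "\<mu> u \<in> {1..m} \<longleftrightarrow> u \<in> {1..m}" for u
    by (rule permutes_in_image[OF \<mu>])
  show "weighted_digraph m \<omega> (reorder_vertices \<mu> W)"
    unfolding weighted_digraph_def
  proof (intro conjI ballI allI impI)
    fix u w assume u: "u \<in> {1..m}" and "w \<in> {1..m}"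
    then show "reorder_vertices \<mu> W u w \<in> Z2_space (\<omega> u)"
      using A(5)[of "\<mu> u"] in_m[of u] \<omega>\<mu>[THEN bspec, OF u] by (simp add: Z2_space_def reorder_vertices_def)
  next
    fix u w assume "u \<notin> {1..m} \<or> w \<notin> {1..m}"
    then show "reorder_vertices \<mu> W u w = zero_vec"
      using A(4)[of "\<mu> u" "\<mu> w"] in_m by (simp only: reorder_vertices_def)
  qed
qed

lemma omega_step_sim:
  assumes "omega_step m \<omega> W W'" "W \<in> acyclic_weighted_digraphs m \<omega>"
  shows "W' \<in> acyclic_weighted_digraphs m \<omega> \<and> sim (dchar W) (dchar W')"
  using assms
proof cases
  case (reorder \<mu>)
  then show ?thesis
    using acyclic_reorder[OF assms(2)] tsim_reorder[of \<mu>] sim_iff_tsim by blast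
next
  case (permute v \<sigma>)
  have "\<sigma> permutes {0..\<omega> v}"
    using permute(3) by (rule permutes_subset) auto
  then have "facet_aut (block_perm v (inv \<sigma>))"
    using permute(2) permutes_inv by (blast intro: facet_aut_block_perm)
  then show ?thesis
    using permute acyclic_permute[OF assms(2)] tsim_permute[OF assms(2)] sim_iff_tsim by blast
next
  case (complement v \<sigma> k)
  have "\<sigma> permutes {0..\<omega> v}"
    using complement(3) by (rule permutes_subset) auto
  then have "inv \<sigma> \<circ> Transposition.transpose 0 k permutes {0..\<omega> v}"
    using complement(4) by (intro permutes_compose permutes_inv permutes_swap_id) auto
  then have "facet_aut (block_perm v (inv \<sigma> \<circ> Transposition.transpose 0 k))"
    using complement(2) by (blast intro: facet_aut_block_perm)
  then show ?thesis
    using complement acyclic_complement[OF assms(2)] tsim_complement[OF assms(2)] sim_iff_tsim by blast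
qed

lemma omega_equivalent_imp_sim:
  assumes "omega_equivalent m \<omega> W W'" "W \<in> acyclic_weighted_digraphs m \<omega>"
  shows "W' \<in> acyclic_weighted_digraphs m \<omega> \<and> sim (dchar W) (dchar W')"
  using assms unfolding omega_equivalent_def
proof (induction rule: rtranclp_induct)
  case base
  then show ?case
    using sim_refl by blast
next
  case (step W' W'')
  then show ?case
    using omega_step_sim sim_trans by blast
qed

text \<open>If \<open>\<rho>\<close> fixes \<open>0\<close> it is a coordinate permutation.
  Otherwise let \<open>k\<close> be the preimage of \<open>0\<close>: then \<open>\<rho>\<close> is
  the exchange of \<open>0\<close> and \<open>k\<close> followed by a permutation
  \<open>\<eta>\<close> fixing \<open>0\<close>, that is, one local complementation at
  \<open>k\<close> with \<open>\<sigma> = inv \<eta>\<close>.\<close>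

lemma block_perm_step:
  assumes W: "W \<in> acyclic_weighted_digraphs m \<omega>" and v: "v \<in> {1..m}" and \<rho>: "\<rho> permutes {0..\<omega> v}"
  obtains W' where "omega_step m \<omega> W W'" "W' \<in> acyclic_weighted_digraphs m \<omega>"
    "tsim (block_perm v \<rho>) (dchar W) (dchar W')"
proof (cases "\<rho> 0 = 0")
  case True
  have "\<rho> permutes {1..\<omega> v}"
    by (rule permutes_superset[OF \<rho>]) (use True in \<open>auto simp: not_less_eq_eq\<close>)
  then have \<sigma>: "inv \<rho> permutes {1..\<omega> v}" and inv: "inv (inv \<rho>) = \<rho>"
    by (simp_all add: permutes_inv permutes_inv_inv)
  then show ?thesis
    using that[OF omega_step.permute[where \<omega> = \<omega> and m = m and v = v, OF v \<sigma>] acyclic_permute[OF W v \<sigma>]] tsim_permute[OF W v \<sigma>]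
    by simp
next
  case False
  define k where "k = inv \<rho> 0"
  have \<rho>k: "\<rho> k = 0"
    unfolding k_def by (rule permutes_inverses(1)[OF \<rho>])
  have "k \<in> {0..\<omega> v}"
    using permutes_in_image[OF permutes_inv[OF \<rho>], of 0] by (simp add: k_def)
  moreover have "k \<noteq> 0"
    using False \<rho>k by metis
  ultimately have k: "k \<in> {1..\<omega> v}"
    by auto
  define \<eta> where "\<eta> = \<rho> \<circ> Transposition.transpose 0 k"
  have "\<eta> permutes {0..\<omega> v}"
    unfolding \<eta>_def using k by (intro permutes_compose permutes_swap_id \<rho>) auto
  then have "\<eta> permutes {1..\<omega> v}"
    by (rule permutes_superset) (auto simp: \<eta>_def \<rho>k not_less_eq_eq)
  then have \<sigma>: "inv \<eta> permutes {1..\<omega> v}" and inv: "inv (inv \<eta>) = \<eta>"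
    by (simp_all add: permutes_inv permutes_inv_inv)
  have "\<eta> \<circ> Transposition.transpose 0 k = \<rho>"
    by (simp add: \<eta>_def comp_assoc)
  then show ?thesis
    using that[OF omega_step.complement[where \<omega> = \<omega> and m = m and v = v, OF v \<sigma> k] acyclic_complement[OF W v \<sigma> k]]
      tsim_complement[OF W v \<sigma> k]
    by (simp add: inv)
qed

text \<open>Blocks go to blocks, which defines \<open>\<mu>\<close>; injectivity inside a block and
  counting show that only simplices of equal dimension are interchanged.\<close>

lemma facet_aut_cases:
  assumes \<tau>: "facet_aut \<tau>"
  obtains \<mu> \<rho> where "\<mu> permutes {1..m}" "\<And>v. v \<in> {1..m} \<Longrightarrow> \<omega> (\<mu> v) = \<omega> v"
    "\<And>v. v \<in> {1..m} \<Longrightarrow> \<rho> v permutes {0..\<omega> v}"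
    "\<And>v i. (v, i) \<in> facets \<Longrightarrow> \<tau> (v, i) = (\<mu> v, \<rho> v i)"
proof -
  define \<mu> where "\<mu> v = (if v \<in> {1..m} then fst (\<tau> (v, 0)) else v)" for v
  define \<rho> where "\<rho> v i = (if i \<le> \<omega> v then snd (\<tau> (v, i)) else i)" for v i
  have fst_eq: "fst (\<tau> f) = fst (\<tau> g) \<longleftrightarrow> fst f = fst g" if "f \<in> facets" "g \<in> facets" for f g
    using \<tau> that by (simp add: facet_aut_def)
  have eq: "\<tau> (v, i) = (\<mu> v, \<rho> v i)" if "(v, i) \<in> facets" for v i
    using that fst_eq[of "(v, i)" "(v, 0)"] by (auto simp: \<mu>_def \<rho>_def prod_eq_iff)
  have \<mu>in: "\<mu> v \<in> {1..m}" if "v \<in> {1..m}" for v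
    using that facet_aut_in[OF \<tau>, of "(v, 0)"] eq[of v 0] by simp
  have "inj_on \<mu> {1..m}"
    using fst_eq[of "(_, 0)" "(_, 0)"] by (auto simp: inj_on_def \<mu>_def)
  moreover from this have "\<mu> ` {1..m} = {1..m}"
    using \<mu>in by (intro endo_inj_surj) auto
  ultimately have \<mu>: "\<mu> permutes {1..m}"
    by (intro bij_imp_permutes) (auto simp: bij_betw_def \<mu>_def)
  have inj: "inj_on (\<rho> v) {0..\<omega> v}" if v: "v \<in> {1..m}" for v
  proof (rule inj_onI)
    fix i i' assume i: "i \<in> {0..\<omega> v}" "i' \<in> {0..\<omega> v}" "\<rho> v i = \<rho> v i'"
    then have "\<tau> (v, i) = \<tau> (v, i')"
      using eq v by simp
    then show "i = i'"
      using inj_onD[OF facet_aut_inj[OF \<tau>], of "(v, i)" "(v, i')"] i v by simp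
  qed
  have img: "\<rho> v ` {0..\<omega> v} = {0..\<omega> (\<mu> v)}" if v: "v \<in> {1..m}" for v
  proof (intro equalityI subsetI)
    fix t assume "t \<in> \<rho> v ` {0..\<omega> v}"
    then obtain i where "i \<le> \<omega> v" "t = \<rho> v i"
      by auto
    then show "t \<in> {0..\<omega> (\<mu> v)}"
      using facet_aut_in[OF \<tau>, of "(v, i)"] eq[of v i] v by simp
  next
    fix t assume "t \<in> {0..\<omega> (\<mu> v)}"
    then have "(\<mu> v, t) \<in> facets"
      using \<mu>in[OF v] by simp
    then obtain f where f: "f \<in> facets" "(\<mu> v, t) = \<tau> f"
      by (rule facet_aut_surj[OF \<tau>])
    then have "fst f = v"
      using fst_eq[of f "(v, 0)"] eq[of v 0] v by (metis facets_iff fst_conv zero_le)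
    then obtain i where "f = (v, i)"
      by (metis prod.collapse)
    then show "t \<in> \<rho> v ` {0..\<omega> v}"
      using f eq[of v i] by auto
  qed
  have \<omega>: "\<omega> (\<mu> v) = \<omega> v" if v: "v \<in> {1..m}" for v
    using card_image[OF inj[OF v]] img[OF v] by simp
  have "\<rho> v permutes {0..\<omega> v}" if v: "v \<in> {1..m}" for v
    using inj[OF v] img[OF v] \<omega>[OF v] by (intro bij_imp_permutes) (auto simp: bij_betw_def \<rho>_def)
  then show ?thesis
    using that[OF \<mu> \<omega> _ eq] by blast
qed

lemma tsim_cong: "(\<And>f. f \<in> facets \<Longrightarrow> \<tau> f = \<tau>' f) \<Longrightarrow> tsim \<tau> \<kappa> \<kappa>' \<longleftrightarrow> tsim \<tau>' \<kappa> \<kappa>'"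
  by (simp add: tsim_def)

text \<open>One move per simplex, with \<open>r\<close> the number of simplices treated. That the
  partial permutation is a facet automorphism is carried along because composing similarities
  requires it.\<close>

lemma block_perms_reachable:
  assumes W: "W \<in> acyclic_weighted_digraphs m \<omega>"
    and \<rho>: "\<And>v. v \<in> {1..m} \<Longrightarrow> \<rho> v permutes {0..\<omega> v}"
  shows "r \<le> m \<Longrightarrow> \<exists>W'. omega_equivalent m \<omega> W W' \<and> W' \<in> acyclic_weighted_digraphs m \<omega> \<and>
    facet_aut (\<lambda>f. (fst f, if fst f \<le> r then \<rho> (fst f) (snd f) else snd f)) \<and>
    tsim (\<lambda>f. (fst f, if fst f \<le> r then \<rho> (fst f) (snd f) else snd f)) (dchar W) (dchar W')"
proof (induction r)
  case 0
  have eq: "(fst f, if fst f \<le> 0 then \<rho> (fst f) (snd f) else snd f) = f" if "f \<in> facets" for f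
    using that by (cases f) auto
  have "facet_aut (\<lambda>f. (fst f, if fst f \<le> 0 then \<rho> (fst f) (snd f) else snd f))"
  proof (rule facet_autI)
    show "inj_on (\<lambda>f. (fst f, if fst f \<le> 0 then \<rho> (fst f) (snd f) else snd f)) facets"
      by (rule inj_onI) (simp only: eq)
  qed (simp_all only: eq fst_conv)
  moreover have "tsim (\<lambda>f. (fst f, if fst f \<le> 0 then \<rho> (fst f) (snd f) else snd f)) (dchar W) (dchar W)"
    unfolding tsim_def by (auto simp only: eq intro!: exI[of _ "\<lambda>x. x"] Z2_automorphism_id)
  ultimately show ?case
    using W unfolding omega_equivalent_def by blast
next
  case (Suc r)
  let ?\<tau> = "\<lambda>r f. (fst f, if fst f \<le> r then \<rho> (fst f) (snd f) else snd f)"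
  obtain W' where W': "omega_equivalent m \<omega> W W'" "W' \<in> acyclic_weighted_digraphs m \<omega>"
    and t: "facet_aut (?\<tau> r)" "tsim (?\<tau> r) (dchar W) (dchar W')"
    using Suc by auto
  have v: "Suc r \<in> {1..m}"
    using Suc.prems by simp
  obtain W'' where W'': "omega_step m \<omega> W' W''" "W'' \<in> acyclic_weighted_digraphs m \<omega>"
    "tsim (block_perm (Suc r) (\<rho> (Suc r))) (dchar W') (dchar W'')"
    using block_perm_step[OF W'(2) v \<rho>[OF v]] by blast
  have eq: "(\<lambda>f. block_perm (Suc r) (\<rho> (Suc r)) (?\<tau> r f)) = ?\<tau> (Suc r)"
    by (auto simp: block_perm_def fun_eq_iff le_Suc_eq)
  have "facet_aut (?\<tau> (Suc r))"
    using facet_aut_comp[OF facet_aut_block_perm[OF v \<rho>[OF v]] t(1)] unfolding eq .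
  moreover have "tsim (?\<tau> (Suc r)) (dchar W) (dchar W'')"
    using tsim_trans[OF t W''(3)] unfolding eq .
  moreover have "omega_equivalent m \<omega> W W''"
    using W' W'' unfolding omega_equivalent_def by simp
  ultimately show ?case
    using W'' by blast
qed

text \<open>Moves realizing the facet permutation \<open>\<tau>\<close> lead from \<open>W\<close>
  to some acyclic digraph; as the target belonging to \<open>\<tau>\<close> is unique, this digraph
  is \<open>W'\<close>.\<close>

lemma sim_imp_omega_equivalent:
  assumes W: "W \<in> acyclic_weighted_digraphs m \<omega>" and W': "W' \<in> acyclic_weighted_digraphs m \<omega>"
    and s: "sim (dchar W) (dchar W')"
  shows "omega_equivalent m \<omega> W W'"
proof -
  obtain \<tau> where \<tau>: "facet_aut \<tau>" and t: "tsim \<tau> (dchar W) (dchar W')"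
    using s sim_iff_tsim by blast
  obtain \<mu> \<rho> where \<mu>: "\<mu> permutes {1..m}" and \<omega>\<mu>: "\<And>v. v \<in> {1..m} \<Longrightarrow> \<omega> (\<mu> v) = \<omega> v"
    and \<rho>: "\<And>v. v \<in> {1..m} \<Longrightarrow> \<rho> v permutes {0..\<omega> v}"
    and eq: "\<And>v i. (v, i) \<in> facets \<Longrightarrow> \<tau> (v, i) = (\<mu> v, \<rho> v i)"
    using facet_aut_cases[OF \<tau>] by blast
  let ?\<tau> = "\<lambda>f. (fst f, if fst f \<le> m then \<rho> (fst f) (snd f) else snd f)"
  obtain V where V: "omega_equivalent m \<omega> W V" "V \<in> acyclic_weighted_digraphs m \<omega>"
    "facet_aut ?\<tau>" "tsim ?\<tau> (dchar W) (dchar V)"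
    using block_perms_reachable[OF W \<rho>, of m] by auto
  \<comment> \<open>Reordering by a permutation acts on the facets through its inverse.\<close>
  define \<nu> where "\<nu> = inv \<mu>"
  have \<nu>: "\<nu> permutes {1..m}" and inv: "inv \<nu> = \<mu>"
    using \<mu> by (simp_all add: \<nu>_def permutes_inv permutes_inv_inv)
  have \<omega>\<nu>: "\<forall>p\<in>{1..m}. \<omega> (\<nu> p) = \<omega> p"
  proof
    fix p assume "p \<in> {1..m}"
    then have "\<nu> p \<in> {1..m}"
      using permutes_in_image[OF \<nu>] by blast
    then have "\<omega> (\<mu> (\<nu> p)) = \<omega> (\<nu> p)"
      by (rule \<omega>\<mu>)
    moreover have "\<mu> (\<nu> p) = p"
      unfolding \<nu>_def by (rule permutes_inverses(1)[OF \<mu>])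
    ultimately show "\<omega> (\<nu> p) = \<omega> p"
      by simp
  qed
  let ?V = "reorder_vertices \<nu> V"
  have "tsim (\<lambda>f. (inv \<nu> (fst f), snd f)) (dchar V) (dchar ?V)"
    using tsim_reorder(2)[OF \<nu> \<omega>\<nu> refl] .
  then have V': "tsim (\<lambda>f. (inv \<nu> (fst (?\<tau> f)), snd (?\<tau> f))) (dchar W) (dchar ?V)"
    by (rule tsim_trans[OF V(3,4)])
  have e: "(inv \<nu> (fst (?\<tau> f)), snd (?\<tau> f)) = \<tau> f" if "f \<in> facets" for f
    using that eq by (cases f) (auto simp: inv)
  have "tsim \<tau> (dchar W) (dchar ?V)"
    by (rule iffD1[OF tsim_cong[OF e] V'])
  moreover have Vac: "?V \<in> acyclic_weighted_digraphs m \<omega>"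
    by (rule acyclic_reorder[OF V(2) \<nu> \<omega>\<nu>])
  ultimately have "?V = W'"
    using tsim_determined[OF _ W' \<tau> _ t] by blast
  moreover have "omega_step m \<omega> V ?V"
    by (rule omega_step.reorder[OF \<nu> \<omega>\<nu>])
  ultimately show ?thesis
    using V(1) unfolding omega_equivalent_def by simp
qed

lemma omega_equivalent_iff_sim:
  assumes "W \<in> acyclic_weighted_digraphs m \<omega>" "W' \<in> acyclic_weighted_digraphs m \<omega>"
  shows "omega_equivalent m \<omega> W W' \<longleftrightarrow> sim (dchar W) (dchar W')"
  using assms omega_equivalent_imp_sim sim_imp_omega_equivalent by blast

section \<open>Convex geometry of the product of simplices\<close>

lemma bary_E: "bary (blk j, idx j) x = x $ j"
  by (simp add: bary_def blk_idx(3))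

lemma bary_sum:
  assumes "v \<in> {1..m}"
  shows "(\<Sum>i\<le>\<omega> v. bary (v, i) x) = 1"
proof -
  have "(\<Sum>i\<le>\<omega> v. bary (v, i) x) = bary (v, 0) x + (\<Sum>i=1..\<omega> v. bary (v, i) x)"
    by (simp add: atMost_atLeast0 sum.atLeast_Suc_atMost)
  also have "(\<Sum>i=1..\<omega> v. bary (v, i) x) = (\<Sum>i=1..\<omega> v. x $ E (v, i))"
    by (intro sum.cong) (auto simp: bary_def)
  finally show ?thesis
    by (simp add: bary_def)
qed

lemma bary_affine: "bary f ((1 - t) *\<^sub>R x + t *\<^sub>R y) = (1 - t) * bary f x + t * bary f y"
proof -
  have "(\<Sum>i\<in>I. ((1 - t) *\<^sub>R x + t *\<^sub>R y) $ g i) = (1 - t) * (\<Sum>i\<in>I. x $ g i) + t * (\<Sum>i\<in>I. y $ g i)"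
    for I :: "nat set" and g
    by (simp add: sum.distrib sum_distrib_left)
  then show ?thesis
    by (simp only: bary_def) (simp add: algebra_simps)
qed

lemma continuous_on_bary [continuous_intros]: "continuous_on S g \<Longrightarrow> continuous_on S (\<lambda>x. bary f (g x))"
  unfolding bary_def by (cases "snd f = 0") (auto intro!: continuous_intros)

lemma bary_eqI:
  assumes "\<And>f. f \<in> facets \<Longrightarrow> bary f x = bary f y"
  shows "x = y"
proof -
  have "x $ j = y $ j" for j
    using assms[of "(blk j, idx j)"] blk_idx_ge[of j] by (simp add: bary_E)
  then show ?thesis
    by (simp add: vec_eq_iff)
qed

lemma bary_nonneg: "x \<in> polytope \<Longrightarrow> f \<in> facets \<Longrightarrow> 0 \<le> bary f x"
  by (simp add: polytope_def)

lemma convex_polytope: "convex polytope"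
  unfolding convex_alt by (auto simp: polytope_def bary_affine)

lemma closed_polytope: "closed polytope"
proof -
  have "polytope = (\<Inter>f\<in>facets. {x. 0 \<le> bary f x})"
    by (auto simp: polytope_def)
  then show ?thesis
    by (auto intro!: closed_INT closed_Collect_le continuous_intros)
qed

lemma bary_le_1:
  assumes "x \<in> polytope" "f \<in> facets"
  shows "bary f x \<le> 1"
proof -
  obtain v i where f: "f = (v, i)" "v \<in> {1..m}" "i \<le> \<omega> v"
    using assms(2) by (cases f) auto
  have "bary (v, i) x \<le> (\<Sum>i\<le>\<omega> v. bary (v, i) x)"
    using f assms(1) by (intro member_le_sum) (auto intro: bary_nonneg)
  then show ?thesis
    using f bary_sum by simp
qed

lemma polytope_subset_cbox: "polytope \<subseteq> cbox 0 1"
proof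
  fix x assume x: "x \<in> polytope"
  have "0 \<le> x $ j \<and> x $ j \<le> 1" for j
    using bary_nonneg[OF x, of "(blk j, idx j)"] bary_le_1[OF x, of "(blk j, idx j)"] blk_idx_ge[of j]
    by (simp add: bary_E)
  then show "x \<in> cbox 0 1"
    by (simp add: mem_box_cart)
qed

lemma compact_polytope: "compact polytope"
  using closed_polytope polytope_subset_cbox bounded_cbox bounded_subset compact_eq_bounded_closed by blast

lemma face_set_zero_facets:
  assumes "x \<in> polytope"
  shows "face_set (zero_facets x)"
  unfolding face_set_def
proof (intro conjI ballI)
  show "zero_facets x \<subseteq> facets"
    by (auto simp: zero_facets_def)
  fix v assume v: "v \<in> {1..m}"
  have "\<exists>i\<le>\<omega> v. bary (v, i) x \<noteq> 0"
    using bary_sum[OF v, of x] by (metis atMost_iff sum.neutral zero_neq_one)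
  then show "\<exists>i\<le>\<omega> v. (v, i) \<notin> zero_facets x"
    by (auto simp: zero_facets_def)
qed

lemma finite_zero_facets [simp]: "finite (zero_facets x)"
  by (simp add: zero_facets_def)

text \<open>The point with equal weights \<open>1 / k v\<close> on the indices that \<open>S\<close>
  leaves free in the simplex \<open>v\<close>, the barycenter of the face cut out by
  \<open>S\<close>. Such points serve as base points of the open faces throughout.\<close>

lemma face_set_point:
  assumes S: "face_set S"
  obtains q where "q \<in> polytope" "zero_facets q = S"
proof -
  define k where "k v = card {i. i \<le> \<omega> v \<and> (v, i) \<notin> S}" for v
  define q :: "real^'n" where "q = (\<chi> j. if (blk j, idx j) \<in> S then 0 else 1 / real (k (blk j)))"
  have k: "k v > 0" if "v \<in> {1..m}" for v
    using S that by (auto simp: face_set_def k_def card_gt_0_iff)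
  have pos: "bary (v, i) q = (if (v, i) \<in> S then 0 else 1 / real (k v))"
    if "v \<in> {1..m}" "i \<le> \<omega> v" "i \<noteq> 0" for v i
    using that by (simp add: bary_def q_def)
  have b: "bary (v, i) q = (if (v, i) \<in> S then 0 else 1 / real (k v))"
    if v: "v \<in> {1..m}" and i: "i \<le> \<omega> v" for v i
  proof (cases "i = 0")
    case True
    \<comment> \<open>The zeroth barycentric coordinate is not a coordinate of \<open>q\<close>; it
      is found from the block sum one.\<close>
    let ?g = "\<lambda>i. if (v, i) \<in> S then 0 else 1 / real (k v)"
    have "(\<Sum>i\<le>\<omega> v. ?g i) = (\<Sum>i | i \<le> \<omega> v \<and> (v, i) \<notin> S. 1 / real (k v))"
      by (intro sum.mono_neutral_cong_right) auto
    also have "\<dots> = 1"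
      using k[OF v] by (simp flip: k_def)
    finally have "(\<Sum>i\<le>\<omega> v. ?g i) = (\<Sum>i\<le>\<omega> v. bary (v, i) q)"
      using bary_sum[OF v] by simp
    then have "?g 0 + (\<Sum>i=1..\<omega> v. ?g i) = bary (v, 0) q + (\<Sum>i=1..\<omega> v. bary (v, i) q)"
      by (simp add: atMost_atLeast0 sum.atLeast_Suc_atMost)
    moreover have "(\<Sum>i=1..\<omega> v. ?g i) = (\<Sum>i=1..\<omega> v. bary (v, i) q)"
      using pos[OF v] by (intro sum.cong) auto
    ultimately show ?thesis
      using True by simp
  qed (use pos v i in auto)
  have "q \<in> polytope"
    by (auto simp: polytope_def b)
  moreover have "zero_facets q = S"
  proof -
    have "zero_facets q = {f \<in> facets. f \<in> S}"
      unfolding zero_facets_def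
    proof (intro Collect_cong conj_cong refl)
      fix f assume "f \<in> facets"
      then show "bary f q = 0 \<longleftrightarrow> f \<in> S"
        using k[of "fst f"] by (cases f) (auto simp: b)
    qed
    then show ?thesis
      using S by (auto simp: face_set_def)
  qed
  ultimately show ?thesis
    by (rule that)
qed

text \<open>The segment from an inner point \<open>q\<close> to an interior point \<open>x\<close>
  can be prolonged a little beyond \<open>x\<close>. If \<open>bary f\<close> vanished at
  \<open>x\<close>, it would be negative there.\<close>

lemma interior_polytope: "interior polytope = {x. \<forall>f\<in>facets. 0 < bary f x}"
proof (intro equalityI subsetI CollectI ballI)
  fix x f assume x: "x \<in> interior polytope" and f: "f \<in> facets"
  have "face_set {}"
    by (auto simp: face_set_def)
  then obtain q where q: "q \<in> polytope" "zero_facets q = {}"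
    by (rule face_set_point)
  have "continuous_on UNIV (\<lambda>t. (1 - t) *\<^sub>R x + t *\<^sub>R q)"
    by (intro continuous_intros)
  then have "open ((\<lambda>t. (1 - t) *\<^sub>R x + t *\<^sub>R q) -` interior polytope)"
    by (intro open_vimage) auto
  moreover have "0 \<in> (\<lambda>t. (1 - t) *\<^sub>R x + t *\<^sub>R q) -` interior polytope"
    using x by simp
  ultimately obtain e where e0: "e > 0" "ball 0 e \<subseteq> (\<lambda>t. (1 - t) *\<^sub>R x + t *\<^sub>R q) -` interior polytope"
    by (rule openE)
  have e: "e > 0" "(1 - t) *\<^sub>R x + t *\<^sub>R q \<in> interior polytope" if "\<bar>t\<bar> < e" for t
  proof -
    have "t \<in> ball 0 e"
      using that by simp
    then show "(1 - t) *\<^sub>R x + t *\<^sub>R q \<in> interior polytope"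
      using e0(2) by blast
  qed (rule e0)
  \<comment> \<open>The negative parameter gives a point beyond \<open>x\<close> on the side away
    from \<open>q\<close>.\<close>
  have "(1 - (- e / 2)) *\<^sub>R x + (- e / 2) *\<^sub>R q \<in> polytope"
    using e(2)[of "- e / 2"] e0(1) interior_subset by auto
  then have "0 \<le> (1 - (- e / 2)) * bary f x + (- e / 2) * bary f q"
    using bary_nonneg f bary_affine by metis
  moreover have "0 < bary f q"
  proof -
    have "bary f q \<noteq> 0"
      using q(2) f unfolding zero_facets_def by blast
    then show ?thesis
      using bary_nonneg[OF q(1) f] by simp
  qed
  then have "0 < e / 2 * bary f q"
    using e0(1) by simp
  ultimately have "0 < (1 + e / 2) * bary f x"
    by (simp add: algebra_simps)
  then show "0 < bary f x"
    using e0(1) by (simp add: zero_less_mult_iff)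
next
  fix x assume x: "x \<in> {x. \<forall>f\<in>facets. 0 < bary f x}"
  have "{x. \<forall>f\<in>facets. 0 < bary f x} = (\<Inter>f\<in>facets. {x. 0 < bary f x})"
    by auto
  moreover have "open (\<Inter>f\<in>facets. {x. 0 < bary f x})"
    by (intro open_INT ballI open_Collect_less continuous_intros) auto
  moreover have "{x. \<forall>f\<in>facets. 0 < bary f x} \<subseteq> polytope"
    by (auto simp: polytope_def less_imp_le)
  ultimately show "x \<in> interior polytope"
    using x by (metis interiorI)
qed

lemma mem_interior_polytope: "x \<in> polytope \<Longrightarrow> x \<in> interior polytope \<longleftrightarrow> zero_facets x = {}"
  by (auto simp: interior_polytope zero_facets_def less_le bary_nonneg)

lemma interior_polytope_nonempty: "interior polytope \<noteq> {}"
proof -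
  have "face_set {}"
    by (auto simp: face_set_def)
  then obtain q where "q \<in> polytope" "zero_facets q = {}"
    by (rule face_set_point)
  then show ?thesis
    using mem_interior_polytope by auto
qed

lemma aff_dim_polytope: "aff_dim polytope = int CARD('n)"
  using aff_dim_nonempty_interior[OF interior_polytope_nonempty] by simp

lemma zero_facets_segment:
  assumes "x \<in> polytope" "y \<in> polytope" "0 < t" "t < 1"
  shows "zero_facets ((1 - t) *\<^sub>R x + t *\<^sub>R y) = zero_facets x \<inter> zero_facets y"
  using assms by (auto simp: zero_facets_def bary_affine add_nonneg_eq_0_iff bary_nonneg)

text \<open>These are the relative interiors of the faces. The set of vanishing barycentric
  coordinates is constant along segments inside them, so they are convex.\<close>

lemma connected_stratum: "connected {x \<in> polytope. zero_facets x = S}"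
proof -
  have "(1 - u) *\<^sub>R x + u *\<^sub>R y \<in> {x \<in> polytope. zero_facets x = S}"
    if xy: "x \<in> {x \<in> polytope. zero_facets x = S}" "y \<in> {x \<in> polytope. zero_facets x = S}" and u: "0 \<le> u" "u \<le> 1" for x y u
  proof (cases "u = 0 \<or> u = 1")
    case True
    then have "(1 - u) *\<^sub>R x + u *\<^sub>R y = x \<or> (1 - u) *\<^sub>R x + u *\<^sub>R y = y"
      by (elim disjE) simp_all
    then show ?thesis
      by (elim disjE) (simp_all only: xy)
  next
    case False
    then have "zero_facets ((1 - u) *\<^sub>R x + u *\<^sub>R y) = zero_facets x \<inter> zero_facets y"
      using xy u by (intro zero_facets_segment) auto
    moreover have "(1 - u) *\<^sub>R x + u *\<^sub>R y \<in> polytope"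
      using convex_polytope xy u unfolding convex_alt by simp
    ultimately show ?thesis
      using xy by (simp only: mem_Collect_eq Int_absorb)
  qed
  then have "convex {x \<in> polytope. zero_facets x = S}"
    unfolding convex_alt by blast
  then show ?thesis
    by (rule convex_connected)
qed

lemma face_set_singleton:
  assumes "f \<in> facets"
  shows "face_set {f}"
  unfolding face_set_def
proof (intro conjI ballI)
  fix v assume "v \<in> {1..m}"
  then have "1 \<le> \<omega> v"
    by (rule \<omega>_pos)
  then show "\<exists>i\<le>\<omega> v. (v, i) \<notin> {f}"
    by (intro exI[of _ "if f = (v, 0) then 1 else 0"]) auto
qed (use assms in auto)

text \<open>In the affine coordinates given by the facets through a vertex \<open>c\<close> the set
  becomes a coordinate subspace of codimension \<open>card S\<close>. These coordinates separate
  points, since the omitted barycentric coordinates are determined by the block sums.\<close>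

lemma aff_dim_zero_set:
  assumes S: "face_set S"
  shows "aff_dim {x. \<forall>f\<in>S. bary f x = 0} = int CARD('n) - int (card S)"
proof -
  obtain c where c: "vertex c" "\<And>v. (v, c v) \<notin> S"
    using face_set_vertex[OF S] by blast
  have SF: "S \<subseteq> facets"
    using S by (simp add: face_set_def)
  define L :: "real^'n \<Rightarrow> real^'n" where "L x = (\<chi> j. bary (Fv c j) x)" for x
  define l where "l x = L x - L 0" for x
  define J where "J = {j. Fv c j \<in> S}"
  have SJ: "S = Fv c ` J"
    using subset_range_Fv[OF c(1) SF c(2)] by (auto simp: J_def)
  have L_eq: "L x = L y \<Longrightarrow> x = y" for x y
  proof (rule bary_eqI)
    fix f assume L: "L x = L y" and f: "f \<in> facets"
    have *: "bary (v, i) x = bary (v, i) y" if "v \<in> {1..m}" "i \<le> \<omega> v" "i \<noteq> c v" for v i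
    proof -
      have "(v, i) \<in> range (Fv c)"
        using that by (simp add: range_Fv[OF c(1)])
      then show ?thesis
        using L by (auto simp: L_def vec_eq_iff)
    qed
    obtain v i where vi: "f = (v, i)" "v \<in> {1..m}" "i \<le> \<omega> v"
      using f by (cases f) auto
    show "bary f x = bary f y"
    proof (cases "i = c v")
      case True
      have "(\<Sum>i\<in>{..\<omega> v} - {c v}. bary (v, i) x) = (\<Sum>i\<in>{..\<omega> v} - {c v}. bary (v, i) y)"
        using * vi by (intro sum.cong) auto
      moreover have "c v \<in> {..\<omega> v}"
        using True vi by simp
      ultimately show ?thesis
        using bary_sum[OF vi(2), of x] bary_sum[OF vi(2), of y] True vi
        by (simp add: sum.remove[of "{..\<omega> v}" "c v"])
    qed (use * vi in auto)
  qed
  have lin: "linear l"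
  proof (rule linearI)
    show "l (x + y) = l x + l y" for x y
      by (simp add: l_def L_def vec_eq_iff bary_def sum.distrib)
    show "l (r *\<^sub>R x) = r *\<^sub>R l x" for r x
      by (simp add: l_def L_def vec_eq_iff bary_def algebra_simps flip: sum_distrib_left)
  qed
  have inj: "inj l"
    using L_eq by (auto simp: inj_def l_def)
  have surj: "surj l"
    using lin inj by (simp add: linear_injective_imp_surjective)
  let ?V = "{y :: real^'n. \<forall>j\<in>J. y $ j = 0}"
  have "l ` {x. \<forall>f\<in>S. bary f x = 0} = (+) (- L 0) ` ?V"
  proof (intro equalityI subsetI)
    fix y assume "y \<in> l ` {x. \<forall>f\<in>S. bary f x = 0}"
    then obtain x where "\<forall>f\<in>S. bary f x = 0" "y = l x"
      by auto
    then have "L x \<in> ?V" "y = - L 0 + L x"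
      by (auto simp: L_def SJ l_def)
    then show "y \<in> (+) (- L 0) ` ?V"
      by blast
  next
    fix y assume "y \<in> (+) (- L 0) ` ?V"
    then obtain z where z: "z \<in> ?V" "y = z - L 0"
      by auto
    obtain x where x: "y = l x"
      using surj by (metis surjD)
    then have "L x = z"
      using z by (simp add: l_def)
    then have "\<forall>f\<in>S. bary f x = 0"
      using z by (auto simp: SJ L_def)
    then show "y \<in> l ` {x. \<forall>f\<in>S. bary f x = 0}"
      using x by auto
  qed
  then have "aff_dim {x. \<forall>f\<in>S. bary f x = 0} = aff_dim ?V"
    using aff_dim_injective_linear_image[OF lin inj, of "{x. \<forall>f\<in>S. bary f x = 0}"]
      aff_dim_translation_eq[of "- L 0" ?V] by (simp only:)
  also have "\<dots> = int (dim ?V)"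
    by (intro aff_dim_subspace) (auto simp: subspace_def)
  also have "dim ?V = card (- J)"
    using dim_substandard_cart[of "- J", where 'a = real] by (simp add: dim_vec_eq Ball_def)
  also have "int (card (- J)) = int CARD('n) - int (card J)"
    by (simp add: Compl_eq_Diff_UNIV card_Diff_subset of_nat_diff card_mono)
  also have "card J = card S"
    using card_image[of "Fv c" J] inj_Fv[OF c(1)] SJ by (simp add: inj_on_subset)
  finally show ?thesis .
qed

text \<open>The smallest face through \<open>p\<close>. It translates the codimension in
  \<open>orbit_space_is\<close> into the number of facets containing \<open>p\<close>.\<close>

lemma face_at_point:
  assumes p: "p \<in> polytope"
  defines "F \<equiv> {x \<in> polytope. \<forall>f\<in>zero_facets p. bary f x = 0}"
  shows "F face_of polytope" "p \<in> rel_interior F" "aff_dim F = int CARD('n) - int (card (zero_facets p))"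
proof -
  let ?A = "{x. \<forall>f\<in>zero_facets p. bary f x = 0}"
  show "F face_of polytope"
    unfolding face_of_def
  proof (intro conjI ballI impI)
    show "convex F"
      unfolding convex_alt F_def by (auto simp: polytope_def bary_affine)
    fix a b x assume ab: "a \<in> polytope" "b \<in> polytope" and x: "x \<in> F" "x \<in> open_segment a b"
    then obtain t where "0 < t" "t < 1" "x = (1 - t) *\<^sub>R a + t *\<^sub>R b"
      by (auto simp: in_segment)
    then have "zero_facets x = zero_facets a \<inter> zero_facets b"
      using zero_facets_segment ab by simp
    moreover have "zero_facets p \<subseteq> zero_facets x"
      using x by (auto simp: F_def zero_facets_def)
    ultimately have "zero_facets p \<subseteq> zero_facets a" "zero_facets p \<subseteq> zero_facets b"
      by auto
    then have "\<forall>f\<in>zero_facets p. bary f a = 0" "\<forall>f\<in>zero_facets p. bary f b = 0"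
      unfolding zero_facets_def by blast+
    then show "a \<in> F" "b \<in> F"
      using ab by (auto simp only: F_def)
  qed (auto simp: F_def)
  have A: "affine ?A"
    unfolding affine_alt by (auto simp: bary_affine)
  \<comment> \<open>Near \<open>p\<close> the coordinates that are nonzero at \<open>p\<close> stay
    positive, so \<open>F\<close> fills a neighbourhood of \<open>p\<close> in its affine
    hull.\<close>
  define U where "U = {x. \<forall>f\<in>facets - zero_facets p. 0 < bary f x}"
  have "U = (\<Inter>f\<in>facets - zero_facets p. {x. 0 < bary f x})"
    by (auto simp: U_def)
  then have U: "open U"
    by (auto intro!: open_INT open_Collect_less continuous_intros)
  have pU: "p \<in> U" "p \<in> ?A"
    using p by (auto simp: U_def zero_facets_def less_le bary_nonneg)
  have OA: "U \<inter> ?A \<subseteq> F"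
    by (auto simp: F_def U_def polytope_def less_le)
  have FA: "F \<subseteq> ?A"
    by (auto simp: F_def)
  then have hull: "affine hull F \<subseteq> ?A"
    using A by (simp add: hull_minimal)
  have "p \<in> F"
    using p by (auto simp: F_def zero_facets_def)
  then show "p \<in> rel_interior F"
    unfolding mem_rel_interior using U pU OA hull by blast
  have "openin (top_of_set ?A) (U \<inter> ?A)"
    using openin_open_Int[OF U, of ?A] by (simp add: Int_commute)
  then have "aff_dim (U \<inter> ?A) = aff_dim ?A"
    using A pU by (intro aff_dim_openin) auto
  then have "aff_dim F = aff_dim ?A"
    using aff_dim_subset[OF OA] aff_dim_subset[OF FA] by simp
  then show "aff_dim F = int CARD('n) - int (card (zero_facets p))"
    using aff_dim_zero_set[OF face_set_zero_facets[OF p]] by simp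
qed

text \<open>The affine map that permutes the barycentric coordinates by \<open>\<tau>\<close>. The
  zeroth coordinate of a block gets the right value because \<open>\<tau>\<close> respects blocks
  and each block sums to one.\<close>

lemma facet_aut_affine:
  assumes \<tau>: "facet_aut \<tau>"
  obtains A where "continuous_on polytope A" "A ` polytope = polytope" "inj_on A polytope"
    "\<And>x. x \<in> polytope \<Longrightarrow> zero_facets (A x) = \<tau> ` zero_facets x"
proof -
  let ?A = "\<lambda>\<tau> x. \<chi> j :: 'n. bary (inv_into facets \<tau> (blk j, idx j)) x"
  have bA: "bary f (?A \<tau> x) = bary (inv_into facets \<tau> f) x" if \<tau>: "facet_aut \<tau>" and f: "f \<in> facets" for \<tau> f x
  proof -
    obtain v i where vi: "f = (v, i)" "v \<in> {1..m}" "i \<le> \<omega> v"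
      using f by (cases f) auto
    obtain \<mu> \<rho> where \<mu>: "\<mu> permutes {1..m}" and \<omega>\<mu>: "\<And>v. v \<in> {1..m} \<Longrightarrow> \<omega> (\<mu> v) = \<omega> v"
      and \<rho>: "\<And>v. v \<in> {1..m} \<Longrightarrow> \<rho> v permutes {0..\<omega> v}"
      and eq: "\<And>v i. (v, i) \<in> facets \<Longrightarrow> inv_into facets \<tau> (v, i) = (\<mu> v, \<rho> v i)"
      using facet_aut_cases[OF facet_aut_inv[OF \<tau>]] by blast
    show ?thesis
    proof (cases "i = 0")
      case False
      then show ?thesis
        using vi by (simp add: bary_def)
    next
      case True
      have "\<mu> v \<in> {1..m}"
        using permutes_in_image[OF \<mu>] vi by blast
      then have "1 = (\<Sum>i=0..\<omega> v. bary (\<mu> v, i) x)"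
        using bary_sum[of "\<mu> v" x] \<omega>\<mu>[OF vi(2)] by (simp add: atMost_atLeast0)
      also have "\<dots> = (\<Sum>i=0..\<omega> v. bary (\<mu> v, \<rho> v i) x)"
        using sum.permute[OF \<rho>[OF vi(2)], of "\<lambda>i. bary (\<mu> v, i) x"] by (simp add: comp_def)
      also have "\<dots> = bary (\<mu> v, \<rho> v 0) x + (\<Sum>i=1..\<omega> v. bary (\<mu> v, \<rho> v i) x)"
        by (simp add: sum.atLeast_Suc_atMost)
      also have "(\<Sum>i=1..\<omega> v. bary (\<mu> v, \<rho> v i) x) = (\<Sum>i=1..\<omega> v. ?A \<tau> x $ E (v, i))"
        using vi eq by (intro sum.cong) auto
      finally show ?thesis
        using True vi eq by (simp add: bary_def[of "(v, 0)"])
    qed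
  qed
  have polytope: "?A \<tau> x \<in> polytope" if "facet_aut \<tau>" "x \<in> polytope" for \<tau> x
    unfolding polytope_def
    by (intro CollectI ballI) (simp only: bA[OF that(1)] bary_nonneg[OF that(2)] facet_aut_in[OF facet_aut_inv[OF that(1)]])
  note inv = facet_aut_inv[OF \<tau>]
  have b: "bij_betw \<tau> facets facets"
    using \<tau> by (simp add: facet_aut_def)
  have gg2: "inv_into facets \<tau> (\<tau> f) = f" and gg3: "\<tau> (inv_into facets \<tau> f) = f" if "f \<in> facets" for f
    by (rule bij_betw_inv_into_left[OF b that] bij_betw_inv_into_right[OF b that])+
  have gg1: "inv_into facets (inv_into facets \<tau>) f = \<tau> f" if "f \<in> facets" for f
    by (rule inv_into_f_eq[OF facet_aut_inj[OF inv] facet_aut_in[OF \<tau> that] gg2[OF that]])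
  have AA1: "?A \<tau> (?A (inv_into facets \<tau>) x) = x" for x
  proof (rule bary_eqI)
    fix f assume f: "f \<in> facets"
    show "bary f (?A \<tau> (?A (inv_into facets \<tau>) x)) = bary f x"
      by (simp only: bA[OF \<tau> f] bA[OF inv facet_aut_in[OF inv f]] gg1[OF facet_aut_in[OF inv f]] gg3[OF f])
  qed
  have AA2: "?A (inv_into facets \<tau>) (?A \<tau> x) = x" for x
  proof (rule bary_eqI)
    fix f assume f: "f \<in> facets"
    show "bary f (?A (inv_into facets \<tau>) (?A \<tau> x)) = bary f x"
      by (simp only: bA[OF inv f] bA[OF \<tau> facet_aut_in[OF \<tau> f]] gg1[OF f] gg2[OF f])
  qed
  show ?thesis
  proof (rule that[of "?A \<tau>"])
    show "continuous_on polytope (?A \<tau>)"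
      by (intro continuous_on_vec_lambda continuous_intros)
    show "?A \<tau> ` polytope = polytope"
    proof (intro equalityI subsetI)
      fix y assume y: "y \<in> polytope"
      show "y \<in> ?A \<tau> ` polytope"
        by (rule image_eqI[where x = "?A (inv_into facets \<tau>) y"]) (simp only: AA1, rule polytope[OF inv y])
    next
      fix y assume "y \<in> ?A \<tau> ` polytope"
      then show "y \<in> polytope"
        using polytope[OF \<tau>] by (elim imageE) (simp only:)
    qed
    show "inj_on (?A \<tau>) polytope"
      by (rule inj_on_inverseI[where g = "?A (inv_into facets \<tau>)"]) (rule AA2)
    show "zero_facets (?A \<tau> x) = \<tau> ` zero_facets x" for x
    proof (intro equalityI subsetI)
      fix f assume "f \<in> zero_facets (?A \<tau> x)"
      then have f: "f \<in> facets" "bary f (?A \<tau> x) = 0"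
        unfolding zero_facets_def by blast+
      then have "inv_into facets \<tau> f \<in> zero_facets x"
        using facet_aut_in[OF inv f(1)] bA[OF \<tau> f(1), of x] unfolding zero_facets_def by simp
      then show "f \<in> \<tau> ` zero_facets x"
        using gg3[OF f(1)] by (metis image_eqI)
    next
      fix f assume "f \<in> \<tau> ` zero_facets x"
      then obtain g where g: "g \<in> facets" "bary g x = 0" "f = \<tau> g"
        unfolding zero_facets_def by blast
      then have "bary f (?A \<tau> x) = 0"
        using bA[OF \<tau> facet_aut_in[OF \<tau> g(1)], of x] gg2[OF g(1)] by (simp only:)
      then show "f \<in> zero_facets (?A \<tau> x)"
        using facet_aut_in[OF \<tau> g(1)] g(3) unfolding zero_facets_def by blast
    qed
  qed
qed

end

section \<open>The characteristic function of a small cover\<close>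

lemma axis_ne_0: "axis i 1 \<noteq> (0 :: 'a::zero_neq_one^'n)"
  by (metis axis_nth zero_index zero_neq_one)

text \<open>With finitely many values the complement of one fibre is a finite union of closed
  fibres, so a connected set cannot be divided. This is used for isotropy groups, for differences of
  sections and for the images of facets.\<close>

lemma connected_closed_fibres_constant:
  assumes S: "connected S" and fin: "finite (F ` S)"
    and cl: "\<And>a. closedin (top_of_set S) {x \<in> S. F x = a}"
    and xy: "x \<in> S" "y \<in> S"
  shows "F x = F y"
proof (rule ccontr)
  assume ne: "F x \<noteq> F y"
  let ?A = "{z \<in> S. F z = F x}" and ?B = "\<Union>a\<in>F ` S - {F x}. {z \<in> S. F z = a}"
  have B: "closedin (top_of_set S) ?B"
    using fin cl by (intro closedin_Union) auto
  have "\<exists>E1 E2. closedin (top_of_set S) E1 \<and> closedin (top_of_set S) E2 \<and>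
      S \<subseteq> E1 \<union> E2 \<and> E1 \<inter> E2 = {} \<and> E1 \<noteq> {} \<and> E2 \<noteq> {}"
  proof (intro exI conjI)
    show "S \<subseteq> ?A \<union> ?B" "?A \<inter> ?B = {}" "?A \<noteq> {}" "?B \<noteq> {}"
      using xy ne by auto
  qed (fact cl B)+
  with S[unfolded connected_closedin] show False
    by (rule notE)
qed

lemma sign_change_eq_iff: "sign_change g x = x \<longleftrightarrow> (\<forall>i. x $ i \<noteq> 0 \<longrightarrow> g $ i = 0)"
  by (auto simp: sign_change_def vec_eq_iff)

text \<open>The retraction of the space onto the closed positive orthant, a fundamental domain for
  the sign changes.\<close>

definition abs_vec :: "real^'n \<Rightarrow> real^'n"
  where "abs_vec x = (\<chi> i. \<bar>x $ i\<bar>)"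

lemma abs_vec_sign_change [simp]: "abs_vec (sign_change g x) = abs_vec x"
  by (simp add: abs_vec_def sign_change_def vec_eq_iff)

lemma abs_vec_eq_sign_change: "\<exists>g. abs_vec x = sign_change g x"
  by (rule exI[of _ "\<chi> i. if x $ i < 0 then 1 else 0"]) (simp add: abs_vec_def sign_change_def vec_eq_iff)

lemma continuous_on_abs_vec: "continuous_on S abs_vec"
  unfolding abs_vec_def by (intro continuous_on_vec_lambda continuous_intros)

text \<open>Everything is relative to one chosen orbit map \<open>\<pi>\<close>; the face condition
  of \<open>orbit_space_is\<close> is restated as a count of the facets containing
  \<open>\<pi> x\<close>.\<close>

locale orbit_map = simplices m \<omega> E for m \<omega> and E :: "nat \<times> nat \<Rightarrow> 'n::finite" +
  fixes M :: "('a, 'n) Z2_manifold" and \<pi> :: "'a \<Rightarrow> real^'n"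
  assumes small: "small_cover polytope M"
    and quot: "quotient_map (mtop M) (top_of_set polytope) \<pi>"
    and fibre: "x \<in> topspace (mtop M) \<Longrightarrow> y \<in> topspace (mtop M) \<Longrightarrow> \<pi> x = \<pi> y \<longleftrightarrow> (\<exists>g. y = act M g x)"
    and card_stab: "x \<in> topspace (mtop M) \<Longrightarrow> card {g. act M g x = x} = 2 ^ card (zero_facets (\<pi> x))"

lemma (in simplices) orbit_map_exists:
  assumes M: "small_cover polytope M"
  obtains \<pi> where "orbit_map m \<omega> E M \<pi>"
proof -
  obtain \<pi> where quot: "quotient_map (mtop M) (top_of_set polytope) \<pi>"
    and fibre: "\<forall>x\<in>topspace (mtop M). \<forall>y\<in>topspace (mtop M). \<pi> x = \<pi> y \<longleftrightarrow> (\<exists>g. y = act M g x)"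
    and iso: "\<forall>x\<in>topspace (mtop M). \<forall>F. F face_of polytope \<and> \<pi> x \<in> rel_interior F \<longrightarrow>
        card {g. act M g x = x} = 2 ^ nat (aff_dim polytope - aff_dim F)"
    using M unfolding small_cover_def orbit_space_is_def by blast
  have "card {g. act M g x = x} = 2 ^ card (zero_facets (\<pi> x))" if x: "x \<in> topspace (mtop M)" for x
  proof -
    have p: "\<pi> x \<in> polytope"
      using quotient_imp_surjective_map[OF quot] x by auto
    show ?thesis
      using iso x face_at_point[OF p] aff_dim_polytope by auto
  qed
  then have "orbit_map m \<omega> E M \<pi>"
    using M quot fibre by unfold_locales auto
  then show ?thesis
    by (rule that)
qed

context orbit_map
begin

abbreviation X :: "'a set"
  where "X \<equiv> topspace (mtop M)"

definition stab :: "'a \<Rightarrow> (bit^'n) set"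
  where "stab x = {g. act M g x = x}"

lemma Hausdorff: "Hausdorff_space (mtop M)" and compact: "compact_space (mtop M)"
  using small by (auto simp: small_cover_def smooth_closed_manifold_def)

lemma act_0: "x \<in> X \<Longrightarrow> act M 0 x = x"
  and act_add: "x \<in> X \<Longrightarrow> act M (g + h) x = act M g (act M h x)"
  and continuous_act: "continuous_map (mtop M) (mtop M) (act M g)"
  using small by (auto simp: small_cover_def smooth_Z2_action_def)

lemma act_in: "x \<in> X \<Longrightarrow> act M g x \<in> X"
  using continuous_map_image_subset_topspace[OF continuous_act[of g]] by blast

lemma act_act [simp]: "x \<in> X \<Longrightarrow> act M g (act M g x) = x"
  using act_add[of x g g] act_0 by simp

lemma act_commute: "x \<in> X \<Longrightarrow> act M g (act M h x) = act M h (act M g x)"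
  by (metis act_add add.commute)

lemma act_eq_iff: "x \<in> X \<Longrightarrow> act M g x = act M h x \<longleftrightarrow> g + h \<in> stab x"
  unfolding stab_def using act_add[of x h g] act_act[of x h] act_act[of "act M g x" h] act_in[of x]
  by (simp add: add.commute) (metis act_act)

lemma act_inj: "x \<in> X \<Longrightarrow> y \<in> X \<Longrightarrow> act M g x = act M g y \<longleftrightarrow> x = y"
  by (metis act_act)

lemma stab_act:
  assumes x: "x \<in> X"
  shows "stab (act M g x) = stab x"
proof -
  have "act M h (act M g x) = act M g x \<longleftrightarrow> act M h x = x" for h
    unfolding act_commute[OF x, of h g] using act_inj act_in x by blast
  then show ?thesis
    by (simp add: stab_def)
qed

lemma stab_cong: "x \<in> X \<Longrightarrow> y \<in> X \<Longrightarrow> \<pi> x = \<pi> y \<Longrightarrow> stab x = stab y"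
  using fibre stab_act by metis

lemma zero_in_stab: "x \<in> X \<Longrightarrow> 0 \<in> stab x"
  by (simp add: stab_def act_0)

lemma add_in_stab: "x \<in> X \<Longrightarrow> g \<in> stab x \<Longrightarrow> h \<in> stab x \<Longrightarrow> g + h \<in> stab x"
  by (simp add: stab_def act_add)

lemma card_stab': "x \<in> X \<Longrightarrow> card (stab x) = 2 ^ card (zero_facets (\<pi> x))"
  using card_stab by (simp add: stab_def)

lemma \<pi>_in: "x \<in> X \<Longrightarrow> \<pi> x \<in> polytope"
  using quotient_imp_surjective_map[OF quot] by auto

lemma \<pi>_surj: "p \<in> polytope \<Longrightarrow> \<exists>x\<in>X. \<pi> x = p"
  using quotient_imp_surjective_map[OF quot] by (metis image_iff topspace_euclidean_subtopology)

lemma \<pi>_act [simp]: "x \<in> X \<Longrightarrow> \<pi> (act M g x) = \<pi> x"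
  using fibre act_in by metis

lemma continuous_\<pi>: "continuous_map (mtop M) (top_of_set polytope) \<pi>"
  by (rule quotient_imp_continuous_map[OF quot])

lemma closed_\<pi>: "closed_map (mtop M) (top_of_set polytope) \<pi>"
  by (intro T1_Spaces.continuous_imp_closed_map continuous_\<pi> compact Hausdorff_space_subtopology)
    simp

text \<open>The saturation of an open set is the union of its translates and therefore open.\<close>

lemma open_\<pi>: "openin (mtop M) W \<Longrightarrow> openin (top_of_set polytope) (\<pi> ` W)"
proof -
  assume W: "openin (mtop M) W"
  then have WX: "W \<subseteq> X"
    by (rule openin_subset)
  have "{x \<in> X. \<pi> x \<in> \<pi> ` W} = (\<Union>g. {x \<in> X. act M g x \<in> W})"
  proof (intro equalityI subsetI)
    fix x assume "x \<in> {x \<in> X. \<pi> x \<in> \<pi> ` W}"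
    then obtain y where "x \<in> X" "y \<in> W" "\<pi> x = \<pi> y"
      by auto
    then show "x \<in> (\<Union>g. {x \<in> X. act M g x \<in> W})"
      using fibre[of x y] WX by auto
  next
    fix x assume "x \<in> (\<Union>g. {x \<in> X. act M g x \<in> W})"
    then obtain g where g: "x \<in> X" "act M g x \<in> W"
      by auto
    then have "\<pi> x \<in> \<pi> ` W"
      using \<pi>_act[of x g] by (metis image_eqI)
    then show "x \<in> {x \<in> X. \<pi> x \<in> \<pi> ` W}"
      using g by simp
  qed
  moreover have "openin (mtop M) (\<Union>g. {x \<in> X. act M g x \<in> W})"
    using openin_continuous_map_preimage[OF continuous_act W] by (intro openin_Union) auto
  moreover have "\<pi> ` W \<subseteq> topspace (top_of_set polytope)"
    using WX \<pi>_in by auto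
  ultimately show ?thesis
    using quot unfolding quotient_map_def by auto
qed

text \<open>Isotropy as a function on the polytope. The chosen point of the orbit does not matter
  because the group is abelian.\<close>

definition iso :: "real^'n \<Rightarrow> (bit^'n) set"
  where "iso p = stab (SOME x. x \<in> X \<and> \<pi> x = p)"

lemma iso_\<pi>: "x \<in> X \<Longrightarrow> iso (\<pi> x) = stab x"
proof -
  assume x: "x \<in> X"
  then have "(SOME y. y \<in> X \<and> \<pi> y = \<pi> x) \<in> X \<and> \<pi> (SOME y. y \<in> X \<and> \<pi> y = \<pi> x) = \<pi> x"
    by (intro someI[of "\<lambda>y. y \<in> X \<and> \<pi> y = \<pi> x"]) simp
  then show ?thesis
    unfolding iso_def using stab_cong x by blast
qed

lemma card_iso: "p \<in> polytope \<Longrightarrow> card (iso p) = 2 ^ card (zero_facets p)"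
  using \<pi>_surj card_stab' iso_\<pi> by metis

lemma zero_in_iso: "p \<in> polytope \<Longrightarrow> 0 \<in> iso p"
  using \<pi>_surj zero_in_stab iso_\<pi> by metis

lemma add_in_iso: "p \<in> polytope \<Longrightarrow> g \<in> iso p \<Longrightarrow> h \<in> iso p \<Longrightarrow> g + h \<in> iso p"
  using \<pi>_surj add_in_stab iso_\<pi> by metis

text \<open>Fixed-point sets are closed in a Hausdorff space, and \<open>\<pi>\<close> is a closed
  map since the manifold is compact.\<close>

lemma closed_iso: "closed {p \<in> polytope. g \<in> iso p}"
proof -
  have "closedin (mtop M) {x \<in> X. act M g x = x}"
    using closedin_continuous_maps_eq[OF Hausdorff continuous_act continuous_map_id[of "mtop M", unfolded id_def]] .
  then have "closedin (top_of_set polytope) (\<pi> ` {x \<in> X. act M g x = x})"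
    using closed_\<pi> by (simp add: closed_map_def)
  moreover have "\<pi> ` {x \<in> X. act M g x = x} = {p \<in> polytope. g \<in> iso p}"
  proof (intro equalityI subsetI)
    fix p assume "p \<in> {p \<in> polytope. g \<in> iso p}"
    then obtain x where "x \<in> X" "\<pi> x = p" "g \<in> iso (\<pi> x)"
      using \<pi>_surj by blast
    then show "p \<in> \<pi> ` {x \<in> X. act M g x = x}"
      using iso_\<pi> by (auto simp: stab_def)
  qed (auto simp: iso_\<pi> \<pi>_in stab_def)
  ultimately show ?thesis
    using closed_polytope closedin_closed_trans by metis
qed

text \<open>On a stratum all isotropy groups have the same order, so containing a given one of them
  means being equal to it. By \<open>closed_iso\<close> this is a closed condition, and the stratum
  is connected.\<close>

lemma iso_eq:
  assumes p: "p \<in> polytope" "q \<in> polytope" "zero_facets p = zero_facets q"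
  shows "iso p = iso q"
proof -
  define S where "S = {x \<in> polytope. zero_facets x = zero_facets p}"
  have "connected S"
    unfolding S_def by (rule connected_stratum)
  moreover have "finite (iso ` S)"
    by (rule finite_subset[of _ UNIV]) auto
  moreover have "closedin (top_of_set S) {x \<in> S. iso x = H}" for H
  proof (cases "\<exists>x\<in>S. iso x = H")
    case True
    then have cH: "card H = 2 ^ card (zero_facets p)"
      using card_iso by (auto simp: S_def)
    have "{x \<in> S. iso x = H} = S \<inter> (\<Inter>g\<in>H. {p \<in> polytope. g \<in> iso p})"
    proof (intro equalityI subsetI)
      fix x assume x: "x \<in> S \<inter> (\<Inter>g\<in>H. {p \<in> polytope. g \<in> iso p})"
      then have "H \<subseteq> iso x"
        by blast
      moreover have "card (iso x) = card H"
        using x card_iso[of x] cH by (simp add: S_def)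
      ultimately show "x \<in> {x \<in> S. iso x = H}"
        using x card_subset_eq[of "iso x" H] by auto
    qed (auto simp: S_def)
    moreover have "closed (\<Inter>g\<in>H. {p \<in> polytope. g \<in> iso p})"
      by (intro closed_INT ballI closed_iso)
    ultimately show ?thesis
      by (simp add: closedin_closed_Int)
  next
    case False
    then have "{x \<in> S. iso x = H} = {}"
      by auto
    then show ?thesis
      by (simp only: closedin_empty)
  qed
  ultimately show ?thesis
    using p by (intro connected_closed_fibres_constant[of S iso p q]) (auto simp: S_def)
qed

text \<open>The open segment between \<open>p\<close> and \<open>q\<close> lies in the stratum of
  \<open>q\<close>, and an isotropy element survives in the limit at \<open>p\<close>.\<close>

lemma iso_mono:
  assumes p: "p \<in> polytope" "q \<in> polytope" "zero_facets q \<subseteq> zero_facets p"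
  shows "iso q \<subseteq> iso p"
proof
  fix g assume g: "g \<in> iso q"
  let ?\<gamma> = "\<lambda>t. (1 - t) *\<^sub>R p + t *\<^sub>R q"
  have "(?\<gamma> \<longlongrightarrow> ?\<gamma> 0) (at_right 0)"
    by (intro tendsto_intros)
  moreover have "\<forall>\<^sub>F t in at_right 0. ?\<gamma> t \<in> {p \<in> polytope. g \<in> iso p}"
  proof -
    have "?\<gamma> t \<in> {p \<in> polytope. g \<in> iso p}" if t: "0 < t" "t < 1" for t
    proof -
      have in_polytope: "?\<gamma> t \<in> polytope"
        using convex_polytope p t unfolding convex_alt by simp
      have "zero_facets (?\<gamma> t) = zero_facets q"
        using zero_facets_segment[OF p(1,2) t] p(3) by auto
      then show ?thesis
        using iso_eq[OF in_polytope p(2)] g in_polytope by simp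
    qed
    then show ?thesis
      by (intro eventually_at_rightI[of 0 1]) auto
  qed
  ultimately have "?\<gamma> 0 \<in> {p \<in> polytope. g \<in> iso p}"
    by (intro Lim_in_closed_set[OF closed_iso]) auto
  then show "g \<in> iso p"
    by simp
qed

lemma chart_at:
  assumes x: "x \<in> X"
  obtains U \<phi> \<psi> \<theta> where "x \<in> U" "openin (mtop M) U" "open (\<phi> ` U)"
    "homeomorphic_maps (subtopology (mtop M) U) (top_of_set (\<phi> ` U)) \<phi> \<psi>"
    "Z2_automorphism \<theta>" "\<And>g y. y \<in> U \<Longrightarrow> act M g y \<in> U"
    "\<And>g y. y \<in> U \<Longrightarrow> \<phi> (act M g y) = sign_change (\<theta> g) (\<phi> y)"
    "\<And>y. y \<in> U \<Longrightarrow> \<psi> (\<phi> y) = y"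
proof -
  obtain U \<phi> \<theta> where U: "x \<in> U" "smooth_atlas (mtop M) (insert (U, \<phi>) (atlas M))" "Z2_automorphism \<theta>"
    "\<forall>g. \<forall>y\<in>U. act M g y \<in> U \<and> \<phi> (act M g y) = sign_change (\<theta> g) (\<phi> y)"
    using small x unfolding small_cover_def locally_standard_def by blast
  then have "is_chart (mtop M) (U, \<phi>)"
    by (simp add: smooth_atlas_def)
  then have c: "openin (mtop M) U" "open (\<phi> ` U)"
    and h: "homeomorphic_map (subtopology (mtop M) U) (top_of_set (\<phi> ` U)) \<phi>"
    by (auto simp: is_chart_def)
  obtain \<psi> where \<psi>: "homeomorphic_maps (subtopology (mtop M) U) (top_of_set (\<phi> ` U)) \<phi> \<psi>"
    using h homeomorphic_map_maps by blast
  have "\<psi> (\<phi> y) = y" if "y \<in> U" for y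
  proof -
    have "y \<in> topspace (subtopology (mtop M) U)"
      using openin_subset[OF c(1)] that by auto
    then show ?thesis
      using \<psi> unfolding homeomorphic_maps_def by blast
  qed
  then show ?thesis
    using that[OF U(1) c \<psi> U(3)] U(4) by blast
qed

text \<open>A point over the vertex is fixed by the whole group, so a locally standard chart puts it
  at the origin. Nearby points at which only the coordinate \<open>i\<close> vanishes have an
  isotropy group of order two, generated by the element that \<open>\<theta>\<close> sends to the
  unit vector of \<open>i\<close>, and they lie over an open facet through the vertex. Hence every
  unit vector is \<open>\<theta>\<close> of some \<open>\<kappa> (Fv c j)\<close>.\<close>

lemma characteristic_basis:
  assumes c: "vertex c"
    and \<kappa>: "\<And>f q. f \<in> facets \<Longrightarrow> q \<in> polytope \<Longrightarrow> zero_facets q = {f} \<Longrightarrow> iso q = {0, \<kappa> f}"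
  shows "bij (comb (\<lambda>j. \<kappa> (Fv c j)))"
proof -
  have "face_set (range (Fv c))"
    unfolding face_set_def
  proof (intro conjI ballI)
    show "range (Fv c) \<subseteq> facets"
      using Fv_in_facets[OF c] by auto
    show "\<exists>i\<le>\<omega> v. (v, i) \<notin> range (Fv c)" if "v \<in> {1..m}" for v
      using c that Fv_neq[OF c, of v] by (intro exI[of _ "c v"]) (auto simp: vertex_def)
  qed
  then obtain p where p: "p \<in> polytope" "zero_facets p = range (Fv c)"
    by (rule face_set_point)
  then obtain x where x: "x \<in> X" "\<pi> x = p"
    using \<pi>_surj by blast
  have "card (stab x) = card (UNIV :: (bit^'n) set)"
    using card_stab'[OF x(1)] x p inj_Fv[OF c] card_supported[where 'n = 'n, of UNIV]
    by (simp add: card_image)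
  then have stab: "stab x = UNIV"
    by (intro card_subset_eq) auto
  obtain U \<phi> \<psi> \<theta> where U: "x \<in> U" "openin (mtop M) U" "open (\<phi> ` U)"
    and h: "homeomorphic_maps (subtopology (mtop M) U) (top_of_set (\<phi> ` U)) \<phi> \<psi>"
    and \<theta>: "Z2_automorphism \<theta>" and actU: "\<And>g y. y \<in> U \<Longrightarrow> act M g y \<in> U"
    and eqv: "\<And>g y. y \<in> U \<Longrightarrow> \<phi> (act M g y) = sign_change (\<theta> g) (\<phi> y)"
    and \<psi>\<phi>: "\<And>y. y \<in> U \<Longrightarrow> \<psi> (\<phi> y) = y"
    using chart_at[OF x(1)] by blast
  have UX: "U \<subseteq> X"
    using openin_subset[OF U(2)] .
  have \<theta>surj: "\<exists>g. \<theta> g = k" for k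
    using \<theta> unfolding Z2_automorphism_def bij_def by (metis surjD)
  have "sign_change k (\<phi> x) = \<phi> x" for k
  proof -
    obtain g where "\<theta> g = k"
      using \<theta>surj by blast
    moreover have "act M g x = x"
      using stab by (auto simp: stab_def)
    ultimately show ?thesis
      using eqv[OF U(1), of g] by simp
  qed
  \<comment> \<open>Here \<open>1\<close> is the vector of all ones, whose sign change negates every
    coordinate.\<close>
  from this[of 1] have \<phi>x: "\<phi> x = 0"
    unfolding sign_change_eq_iff by (simp add: vec_eq_iff)
  \<comment> \<open>Over \<open>N\<close> no facet other than those through the vertex can contain a
    point.\<close>
  define N where "N = {q \<in> polytope. \<forall>f\<in>facets - range (Fv c). 0 < bary f q}"
  define U' where "U' = {y \<in> U. \<pi> y \<in> N}"
  have "N = polytope \<inter> (\<Inter>f\<in>facets - range (Fv c). {q. 0 < bary f q})"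
    by (auto simp: N_def)
  moreover have "open (\<Inter>f\<in>facets - range (Fv c). {q. 0 < bary f q})"
    by (intro open_INT ballI open_Collect_less continuous_intros) auto
  ultimately have "openin (top_of_set polytope) N"
    by (simp add: openin_open_Int)
  then have "openin (mtop M) {y \<in> X. \<pi> y \<in> N}"
    by (rule openin_continuous_map_preimage[OF continuous_\<pi>])
  moreover have "U' = U \<inter> {y \<in> X. \<pi> y \<in> N}"
    using UX by (auto simp: U'_def)
  ultimately have "openin (subtopology (mtop M) U) U'"
    by (simp add: openin_subtopology_Int2)
  moreover have "homeomorphic_map (subtopology (mtop M) U) (top_of_set (\<phi> ` U)) \<phi>"
    using h homeomorphic_map_maps by blast
  ultimately have "openin (top_of_set (\<phi> ` U)) (\<phi> ` U')"
    using homeomorphic_map_openness_eq by blast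
  then have "open (\<phi> ` U')"
    using U(3) openin_open_trans by blast
  moreover have "x \<in> U'"
  proof -
    have "0 < bary f p" if "f \<in> facets - range (Fv c)" for f
    proof -
      have "f \<notin> zero_facets p"
        using that p by blast
      then have "bary f p \<noteq> 0"
        using that by (auto simp: zero_facets_def)
      then show ?thesis
        using bary_nonneg[OF p(1), of f] that by simp
    qed
    then show ?thesis
      using U x p by (simp add: U'_def N_def)
  qed
  then have "0 \<in> \<phi> ` U'"
    using \<phi>x by (metis image_eqI)
  ultimately obtain e where e: "e > 0" "cball 0 e \<subseteq> \<phi> ` U'"
    by (metis open_contains_cball)
  have \<kappa>ex: "\<exists>j. \<theta> (\<kappa> (Fv c j)) = axis i 1" for i
  proof -
    \<comment> \<open>With this \<open>r\<close> the sum of the absolute coordinates of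
      \<open>z\<close>, and so its norm, is at most \<open>e\<close>.\<close>
    define r where "r = e / (real CARD('n) + 1)"
    have r: "r > 0"
      using e by (simp add: r_def)
    define z :: "real^'n" where "z = (\<chi> j. if j = i then 0 else r)"
    have "norm z \<le> (\<Sum>j\<in>UNIV. \<bar>z $ j\<bar>)"
      by (rule norm_le_l1_cart)
    also have "\<dots> \<le> (\<Sum>j\<in>(UNIV :: 'n set). r)"
      using r by (intro sum_mono) (auto simp: z_def)
    also have "\<dots> \<le> e"
      using e by (simp add: r_def field_simps)
    finally have "z \<in> \<phi> ` U'"
      using e by auto
    then obtain y where y: "y \<in> U'" "\<phi> y = z"
      by auto
    then have yU: "y \<in> U" "y \<in> X" "\<pi> y \<in> N"
      using UX by (auto simp: U'_def)
    have stab_y: "g \<in> stab y \<longleftrightarrow> \<theta> g = 0 \<or> \<theta> g = axis i 1" for g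
    proof -
      have "g \<in> stab y \<longleftrightarrow> \<phi> (act M g y) = \<phi> y"
        unfolding stab_def mem_Collect_eq using \<psi>\<phi>[OF actU[OF yU(1), of g]] \<psi>\<phi>[OF yU(1)] by metis
      also have "\<dots> \<longleftrightarrow> sign_change (\<theta> g) z = z"
        using eqv yU y by simp
      also have "\<dots> \<longleftrightarrow> (\<forall>j. j \<noteq> i \<longrightarrow> \<theta> g $ j = 0)"
        using r by (auto simp: sign_change_eq_iff z_def)
      also have "\<dots> \<longleftrightarrow> \<theta> g = 0 \<or> \<theta> g = axis i 1"
        by (cases "\<theta> g $ i") (auto simp: vec_eq_iff axis_def)
      finally show ?thesis .
    qed
    have inv: "inv \<theta> (\<theta> g) = g" "\<theta> (inv \<theta> g) = g" for g
      using \<theta> by (simp_all add: Z2_automorphism_def bij_def surj_f_inv_f)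
    have "stab y = {inv \<theta> 0, inv \<theta> (axis i 1)}"
    proof (intro equalityI subsetI)
      fix g assume "g \<in> stab y"
      then have "\<theta> g = 0 \<or> \<theta> g = axis i 1"
        by (simp only: stab_y)
      then show "g \<in> {inv \<theta> 0, inv \<theta> (axis i 1)}"
        using inv(1)[of g] by force
    qed (auto simp: stab_y inv)
    moreover have "inv \<theta> 0 \<noteq> inv \<theta> (axis i 1)"
    proof
      assume "inv \<theta> 0 = inv \<theta> (axis i 1)"
      then have "(0 :: bit^'n) = axis i 1"
        using inv(2) by metis
      then show False
        using axis_ne_0[of i] by simp
    qed
    ultimately have "card (stab y) = 2"
      by simp
    then have "2 ^ card (zero_facets (\<pi> y)) = (2 ^ 1 :: nat)"
      using card_stab'[OF yU(2)] by simp
    then have "card (zero_facets (\<pi> y)) = 1"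
      by (simp only: power_inject_exp)
    then obtain f where f: "zero_facets (\<pi> y) = {f}"
      using card_1_singletonE by blast
    then have fF: "f \<in> facets"
      by (auto simp: zero_facets_def)
    have iso_y: "stab y = {0, \<kappa> f}"
      using \<kappa>[OF fF \<pi>_in f] iso_\<pi> yU by simp
    have "f \<in> range (Fv c)"
    proof (rule ccontr)
      assume "f \<notin> range (Fv c)"
      then have "0 < bary f (\<pi> y)"
        using yU(3) fF by (auto simp: N_def)
      moreover have "f \<in> zero_facets (\<pi> y)"
        using f by simp
      ultimately show False
        by (auto simp: zero_facets_def)
    qed
    then obtain j where j: "f = Fv c j"
      by auto
    have "inv \<theta> (axis i 1) \<in> {0, \<kappa> f}"
      using stab_y inv iso_y by blast
    moreover have "\<theta> 0 = 0"
      using \<theta> by (simp add: Z2_automorphism_iff additive_0)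
    ultimately have "\<kappa> f = inv \<theta> (axis i 1)"
      using inv(2)[of "axis i 1"] axis_ne_0[of i] by auto
    then show ?thesis
      using inv j by metis
  qed
  have add: "add_hom (\<lambda>x. \<theta> (comb (\<lambda>j. \<kappa> (Fv c j)) x))"
    using \<theta> by (simp add: Z2_automorphism_iff add_hom_def comb_add)
  have "bij (\<lambda>x. \<theta> (comb (\<lambda>j. \<kappa> (Fv c j)) x))"
  proof (rule additive_surjI[OF add])
    fix i
    obtain j where "\<theta> (\<kappa> (Fv c j)) = axis i 1"
      using \<kappa>ex by blast
    then have "axis i 1 = \<theta> (comb (\<lambda>j. \<kappa> (Fv c j)) (axis j 1))"
      by simp
    then show "axis i 1 \<in> range (\<lambda>x. \<theta> (comb (\<lambda>j. \<kappa> (Fv c j)) x))"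
      by blast
  qed
  then have "inj (comb (\<lambda>j. \<kappa> (Fv c j)))"
    by (auto simp: bij_def inj_def)
  then show ?thesis
    by (metis UNIV_I bij_def finite_UNIV_inj_surj finite_class.finite_UNIV)
qed

text \<open>\<open>\<kappa> f\<close> is the nonzero isotropy element over the open facet
  \<open>f\<close>. By \<open>iso_mono\<close> the values at the facets through a point generate a
  subgroup of its isotropy group, and both have the same order.\<close>

lemma characteristic_function:
  obtains \<kappa> where "nonsing \<kappa>" "\<And>x. x \<in> X \<Longrightarrow> {g. act M g x = x} = subset_sums \<kappa> (zero_facets (\<pi> x))"
proof -
  have ex: "\<exists>g. \<forall>q\<in>polytope. zero_facets q = {f} \<longrightarrow> iso q = {0, g}" if f: "f \<in> facets" for f
  proof -
    obtain q0 where q0: "q0 \<in> polytope" "zero_facets q0 = {f}"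
      using face_set_singleton[OF f] by (rule face_set_point)
    then have "card (iso q0) = 2"
      using card_iso by simp
    then obtain g where "iso q0 = {0, g}"
      using zero_in_iso[OF q0(1)] unfolding card_2_iff by (metis empty_iff insert_commute insert_iff)
    then show ?thesis
      using iso_eq q0 by metis
  qed
  define \<kappa> where "\<kappa> f = (SOME g. \<forall>q\<in>polytope. zero_facets q = {f} \<longrightarrow> iso q = {0, g})" for f
  have \<kappa>: "iso q = {0, \<kappa> f}" if "f \<in> facets" "q \<in> polytope" "zero_facets q = {f}" for f q
    using someI_ex[OF ex[OF that(1)]] that unfolding \<kappa>_def by blast
  have ns: "nonsing \<kappa>"
    unfolding nonsing_def using characteristic_basis[of _ \<kappa>] \<kappa> by blast
  have "{g. act M g x = x} = subset_sums \<kappa> (zero_facets (\<pi> x))" if x: "x \<in> X" for x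
  proof -
    let ?p = "\<pi> x"
    have p: "?p \<in> polytope"
      using \<pi>_in[OF x] .
    have \<kappa>in: "\<kappa> f \<in> iso ?p" if f: "f \<in> zero_facets ?p" for f
    proof -
      have fF: "f \<in> facets"
        using f by (auto simp: zero_facets_def)
      obtain q where q: "q \<in> polytope" "zero_facets q = {f}"
        using face_set_singleton[OF fF] by (rule face_set_point)
      then show ?thesis
        using iso_mono[OF p q(1)] \<kappa>[OF fF q] f by auto
    qed
    have "sum \<kappa> A \<in> iso ?p" if "A \<subseteq> zero_facets ?p" for A
      using finite_subset[OF that finite_zero_facets] that
    proof (induction A rule: finite_induct)
      case empty
      then show ?case
        using zero_in_iso[OF p] by simp
    next
      case (insert f A)
      then show ?case
        using add_in_iso[OF p] \<kappa>in by simp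
    qed
    then have sub: "subset_sums \<kappa> (zero_facets ?p) \<subseteq> iso ?p"
      by (auto simp: subset_sums_def)
    obtain c where c: "vertex c" "\<And>v. (v, c v) \<notin> zero_facets ?p"
      using face_set_vertex[OF face_set_zero_facets[OF p]] by blast
    have "card (subset_sums \<kappa> (zero_facets ?p)) = card (iso ?p)"
      using card_subset_sums[OF ns c(1) _ c(2)] card_iso[OF p] by (simp add: zero_facets_def)
    then have "subset_sums \<kappa> (zero_facets ?p) = iso ?p"
      using sub by (intro card_subset_eq) auto
    then show ?thesis
      using iso_\<pi>[OF x] by (simp add: stab_def)
  qed
  then show ?thesis
    using that ns by blast
qed

section \<open>Sections of the orbit map\<close>

definition section_on :: "(real^'n) set \<Rightarrow> (real^'n \<Rightarrow> 'a) \<Rightarrow> bool"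
  where "section_on Q s \<longleftrightarrow> continuous_map (top_of_set Q) (mtop M) s \<and> (\<forall>q\<in>Q. \<pi> (s q) = q)"

lemma section_on_in: "section_on Q s \<Longrightarrow> q \<in> Q \<Longrightarrow> s q \<in> X"
  using continuous_map_image_subset_topspace[of "top_of_set Q" "mtop M" s] by (auto simp: section_on_def)

lemma section_on_subset: "section_on Q s \<Longrightarrow> R \<subseteq> Q \<Longrightarrow> section_on R s"
  unfolding section_on_def using continuous_map_from_subtopology_mono by blast

lemma section_on_act:
  assumes s: "section_on Q s"
  shows "section_on Q (\<lambda>q. act M g (s q))"
proof -
  have "continuous_map (top_of_set Q) (mtop M) (act M g \<circ> s)"
    using s continuous_act by (auto simp: section_on_def intro: continuous_map_compose)
  then show ?thesis
    using s section_on_in[OF s] by (simp add: section_on_def comp_def)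
qed

text \<open>Folding a locally standard chart onto the positive orthant picks one point of each
  orbit, depending only on the orbit. So it descends along \<open>\<pi>\<close>, which restricts to
  a quotient map on the saturated open set \<open>U\<close>.\<close>

lemma local_section:
  assumes p: "p \<in> polytope"
  obtains V s where "open V" "p \<in> V" "section_on (polytope \<inter> V) s"
proof -
  obtain x where x: "x \<in> X" "\<pi> x = p"
    using \<pi>_surj p by blast
  obtain U \<phi> \<psi> \<theta> where U: "x \<in> U" "openin (mtop M) U" "open (\<phi> ` U)"
    and h: "homeomorphic_maps (subtopology (mtop M) U) (top_of_set (\<phi> ` U)) \<phi> \<psi>"
    and \<theta>: "Z2_automorphism \<theta>" and actU: "\<And>g y. y \<in> U \<Longrightarrow> act M g y \<in> U"
    and eqv: "\<And>g y. y \<in> U \<Longrightarrow> \<phi> (act M g y) = sign_change (\<theta> g) (\<phi> y)"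
    and \<psi>\<phi>: "\<And>y. y \<in> U \<Longrightarrow> \<psi> (\<phi> y) = y"
    using chart_at[OF x(1)] by blast
  have UX: "U \<subseteq> X"
    using openin_subset[OF U(2)] .
  have topU: "topspace (subtopology (mtop M) U) = U"
    using UX by auto
  have \<theta>surj: "\<exists>g. \<theta> g = k" for k
    using \<theta> unfolding Z2_automorphism_def bij_def by (metis surjD)
  have "openin (top_of_set polytope) (\<pi> ` U)"
    using open_\<pi>[OF U(2)] .
  then obtain V where V: "open V" "\<pi> ` U = polytope \<inter> V"
    by (metis openin_open)
  have sat: "{y \<in> X. \<pi> y \<in> polytope \<inter> V} = U"
  proof (intro equalityI subsetI)
    fix y assume "y \<in> {y \<in> X. \<pi> y \<in> polytope \<inter> V}"
    then have "y \<in> X" "\<pi> y \<in> \<pi> ` U"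
      using V by auto
    then obtain z where "y \<in> X" "z \<in> U" "\<pi> z = \<pi> y"
      by auto
    then show "y \<in> U"
      using fibre[of z y] UX actU by auto
  next
    fix y assume "y \<in> U"
    then show "y \<in> {y \<in> X. \<pi> y \<in> polytope \<inter> V}"
      using UX V by blast
  qed
  have qU: "quotient_map (subtopology (mtop M) U) (top_of_set (polytope \<inter> V)) \<pi>"
    using quotient_map_restriction[OF quot sat] V(1)
    by (simp add: openin_open_Int subtopology_subtopology Int_absorb1 flip: Int_assoc)
  define r where "r y = \<psi> (abs_vec (\<phi> y))" for y
  have r_act: "\<exists>g. abs_vec (\<phi> y) = \<phi> (act M g y) \<and> r y = act M g y" if y: "y \<in> U" for y
  proof -
    obtain k where k: "abs_vec (\<phi> y) = sign_change k (\<phi> y)"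
      using abs_vec_eq_sign_change by blast
    obtain g where "\<theta> g = k"
      using \<theta>surj by blast
    then have "abs_vec (\<phi> y) = \<phi> (act M g y)"
      using eqv[OF y] k by simp
    then show ?thesis
      unfolding r_def using \<psi>\<phi>[OF actU[OF y, of g]] by auto
  qed
  have c\<phi>: "continuous_map (subtopology (mtop M) U) (top_of_set (\<phi> ` U)) \<phi>"
    and c\<psi>: "continuous_map (top_of_set (\<phi> ` U)) (subtopology (mtop M) U) \<psi>"
    using h by (auto simp: homeomorphic_maps_def)
  have "continuous_map (top_of_set (\<phi> ` U)) (top_of_set (\<phi> ` U)) abs_vec"
  proof -
    have "abs_vec (\<phi> y) \<in> \<phi> ` U" if "y \<in> U" for y
      using r_act[OF that] actU[OF that] by auto
    then show ?thesis
      by (auto intro: continuous_on_abs_vec)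
  qed
  then have "continuous_map (subtopology (mtop M) U) (subtopology (mtop M) U) (\<psi> \<circ> (abs_vec \<circ> \<phi>))"
    by (intro continuous_map_compose[OF continuous_map_compose[OF c\<phi>] c\<psi>])
  then have cr: "continuous_map (subtopology (mtop M) U) (mtop M) r"
    unfolding r_def[abs_def] comp_def by (rule continuous_map_into_fulltopology)
  have "r y = r z" if y: "y \<in> U" and z: "z \<in> U" and yz: "\<pi> y = \<pi> z" for y z
  proof -
    obtain g where "z = act M g y"
      using fibre[of y z] y z yz UX by blast
    then show ?thesis
      using eqv[OF y] by (simp add: r_def)
  qed
  then obtain s where s: "continuous_map (top_of_set (polytope \<inter> V)) (mtop M) s"
    "\<And>y. y \<in> U \<Longrightarrow> s (\<pi> y) = r y"
    using quotient_map_lift_exists[OF qU cr] topU by metis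
  have "\<pi> (s q) = q" if "q \<in> polytope \<inter> V" for q
  proof -
    have "q \<in> \<pi> ` U"
      using that V by simp
    then obtain y where y: "y \<in> U" "\<pi> y = q"
      by blast
    obtain g where "r y = act M g y"
      using r_act[OF y(1)] by blast
    then have "\<pi> (r y) = q"
      using y UX by auto
    then show ?thesis
      using s(2)[OF y(1)] y by simp
  qed
  then have "section_on (polytope \<inter> V) s"
    using s by (simp add: section_on_def)
  moreover have "p \<in> V"
    using V U x by blast
  ultimately show ?thesis
    using that V by blast
qed

text \<open>Over interior points of the polytope the action is free, so the element relating the two
  sections is unique there and constant by connectedness; density extends the relation to the rest
  of \<open>Q\<close>. Assuming density and not full dimension makes the lemma applicable to a
  hyperplane slice.\<close>

lemma sections_differ_by_const:
  assumes Q: "convex Q" "Q \<subseteq> polytope" "Q \<subseteq> closure (Q \<inter> interior polytope)"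
    and s: "section_on Q s" "section_on Q s'"
  obtains g where "\<And>q. q \<in> Q \<Longrightarrow> s' q = act M g (s q)"
proof -
  let ?Q = "Q \<inter> interior polytope"
  have eqcl: "closedin (top_of_set R) {q \<in> R. s' q = act M g (s q)}" if R: "R \<subseteq> Q" for R g
    using closedin_continuous_maps_eq[OF Hausdorff, of "top_of_set R" s' "\<lambda>q. act M g (s q)"]
      section_on_subset[OF s(2) R] section_on_subset[OF section_on_act[OF s(1)] R]
    by (simp add: section_on_def)
  have ex: "\<exists>g. s' q = act M g (s q)" if q: "q \<in> Q" for q
    using fibre[of "s q" "s' q"] section_on_in[OF s(1) q] section_on_in[OF s(2) q] s q
    by (simp add: section_on_def)
  define F where "F q = (SOME g. s' q = act M g (s q))" for q
  have F: "F q = g \<longleftrightarrow> s' q = act M g (s q)" if q: "q \<in> ?Q" for q g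
  proof -
    have sq: "s q \<in> X" "\<pi> (s q) = q"
      using section_on_in[OF s(1)] s(1) q by (auto simp: section_on_def)
    have "zero_facets q = {}"
      using mem_interior_polytope Q q by auto
    then have "card (stab (s q)) = 1"
      using card_stab'[OF sq(1)] sq by simp
    then have st: "stab (s q) = {0}"
      using zero_in_stab[OF sq(1)] by (metis card_1_singletonE singletonD)
    have "s' q = act M (F q) (s q)"
      unfolding F_def using someI_ex[OF ex] q by blast
    then show ?thesis
      using act_eq_iff[OF sq(1), of "F q" g] st by (auto simp: bit_vec_add_eq_0_iff)
  qed
  have "convex ?Q"
    using Q convex_polytope by (intro convex_Int convex_interior)
  then have con: "connected ?Q"
    by (rule convex_connected)
  have "closedin (top_of_set ?Q) {q \<in> ?Q. F q = g}" for g
  proof -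
    have "{q \<in> ?Q. F q = g} = {q \<in> ?Q. s' q = act M g (s q)}"
      using F by blast
    then show ?thesis
      using eqcl[of ?Q g] by simp
  qed
  then have const: "F q = F q'" if "q \<in> ?Q" "q' \<in> ?Q" for q q'
    using that by (intro connected_closed_fibres_constant[OF con, of F]) (auto intro: finite_subset[of _ UNIV])
  show ?thesis
  proof (cases "?Q = {}")
    case True
    then show ?thesis
      using Q that by auto
  next
    case False
    then obtain q0 where q0: "q0 \<in> ?Q"
      by blast
    have "s' q = act M (F q0) (s q)" if q: "q \<in> Q" for q
    proof -
      let ?C = "{q \<in> Q. s' q = act M (F q0) (s q)}"
      have "?Q \<subseteq> ?C"
      proof
        fix q assume q: "q \<in> ?Q"
        then show "q \<in> ?C"
          using F[OF q, of "F q0"] const[OF q q0] by simp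
      qed
      moreover obtain T where T: "closed T" "?C = Q \<inter> T"
        using eqcl[of Q "F q0"] by (auto simp: closedin_closed)
      ultimately have "closure ?Q \<subseteq> T"
        by (intro closure_minimal) auto
      then have "q \<in> ?C"
        using T Q q by blast
      then show ?thesis
        by simp
    qed
    then show ?thesis
      by (rule that)
  qed
qed

definition sectionable :: "(real^'n) set \<Rightarrow> bool"
  where "sectionable Q \<longleftrightarrow> (\<exists>s. section_on Q s)"

lemma sectionable_subset: "sectionable Q \<Longrightarrow> R \<subseteq> Q \<Longrightarrow> sectionable R"
  unfolding sectionable_def using section_on_subset by blast

text \<open>On the slice the two sections differ by a fixed group element, and translating one of
  them by it makes them agree. The interior point \<open>y\<close> ensures that every point of the
  slice is a limit of points of the slice interior to the polytope.\<close>

lemma sectionable_glue: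
  assumes Q: "convex Q" "closed Q" "Q \<subseteq> polytope"
    and y: "y \<in> interior Q" "y \<bullet> k = c"
    and s: "sectionable (Q \<inter> {x. x \<bullet> k \<le> c})" "sectionable (Q \<inter> {x. c \<le> x \<bullet> k})"
  shows "sectionable Q"
proof -
  obtain s1 s2 where s1: "section_on (Q \<inter> {x. x \<bullet> k \<le> c}) s1" and s2: "section_on (Q \<inter> {x. c \<le> x \<bullet> k}) s2"
    using s by (auto simp: sectionable_def)
  let ?H = "Q \<inter> {x. x \<bullet> k = c}"
  have cH: "convex ?H"
    using Q convex_hyperplane[of k c] by (intro convex_Int) (auto simp: inner_commute)
  have dense: "?H \<subseteq> closure (?H \<inter> interior polytope)"
  proof
    fix q assume q: "q \<in> ?H"
    have yH: "y \<in> ?H \<inter> interior polytope"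
      using subsetD[OF interior_subset y(1)] subsetD[OF interior_mono[OF Q(3)] y(1)] y(2) by simp
    show "q \<in> closure (?H \<inter> interior polytope)"
    proof (cases "q = y")
      case True
      then show ?thesis
        using subsetD[OF closure_subset yH] by simp
    next
      case False
      have "q \<in> closure Q"
        using q closure_subset[of Q] by blast
      then have "open_segment y q \<subseteq> interior Q"
        by (rule in_interior_closure_convex_segment[OF Q(1) y(1)])
      moreover have "open_segment y q \<subseteq> ?H"
        using convex_contains_open_segment[THEN iffD1, OF cH, THEN bspec, THEN bspec, of y q] yH q by simp
      ultimately have "open_segment y q \<subseteq> ?H \<inter> interior polytope"
        using interior_mono[OF Q(3)] by blast
      then have "closure (open_segment y q) \<subseteq> closure (?H \<inter> interior polytope)"
        by (rule closure_mono)
      moreover have "q \<in> closure (open_segment y q)"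
        using False by simp
      ultimately show ?thesis
        by blast
    qed
  qed
  have "?H \<subseteq> polytope"
    using Q(3) by blast
  moreover have "section_on ?H s1"
    by (rule section_on_subset[OF s1]) auto
  moreover have "section_on ?H s2"
    by (rule section_on_subset[OF s2]) auto
  ultimately obtain g where g: "\<And>q. q \<in> ?H \<Longrightarrow> s2 q = act M g (s1 q)"
    using sections_differ_by_const[OF cH _ dense] by metis
  have s1': "section_on (Q \<inter> {x. x \<bullet> k \<le> c}) (\<lambda>q. act M g (s1 q))"
    using s1 by (rule section_on_act)
  define s where "s q = (if q \<bullet> k \<le> c then act M g (s1 q) else s2 q)" for q
  have "continuous_map (top_of_set Q) (mtop M) s"
    unfolding s_def
  proof (rule continuous_map_cases_le)
    show "continuous_map (top_of_set Q) euclideanreal (\<lambda>q. q \<bullet> k)" "continuous_map (top_of_set Q) euclideanreal (\<lambda>q. c)"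
      by (auto intro!: continuous_intros)
    have e: "subtopology (top_of_set Q) {x \<in> topspace (top_of_set Q). x \<bullet> k \<le> c} = top_of_set (Q \<inter> {x. x \<bullet> k \<le> c})"
      "subtopology (top_of_set Q) {x \<in> topspace (top_of_set Q). c \<le> x \<bullet> k} = top_of_set (Q \<inter> {x. c \<le> x \<bullet> k})"
      by (auto simp: subtopology_subtopology intro!: arg_cong[of _ _ top_of_set])
    show "continuous_map (subtopology (top_of_set Q) {x \<in> topspace (top_of_set Q). x \<bullet> k \<le> c}) (mtop M) (\<lambda>q. act M g (s1 q))"
      unfolding e using s1' by (simp add: section_on_def)
    show "continuous_map (subtopology (top_of_set Q) {x \<in> topspace (top_of_set Q). c \<le> x \<bullet> k}) (mtop M) s2"
      unfolding e using s2 by (simp add: section_on_def)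
  qed (use g in auto)
  moreover have "\<pi> (s q) = q" if "q \<in> Q" for q
    using s1' s2 that by (auto simp: s_def section_on_def)
  ultimately show ?thesis
    unfolding sectionable_def section_on_def by blast
qed

text \<open>If the hyperplane misses the interior of \<open>Q\<close>, connectedness makes one of
  the two halves all of \<open>Q\<close>; otherwise both halves have interior points, so both carry
  sections, and these are glued.\<close>

lemma sectionable_split:
  assumes Q: "convex Q" "closed Q" "Q \<subseteq> polytope" and k: "k \<in> Basis"
    and s1: "interior (Q \<inter> {x. x \<bullet> k \<le> c}) = {} \<or> sectionable (Q \<inter> {x. x \<bullet> k \<le> c})"
    and s2: "interior (Q \<inter> {x. c \<le> x \<bullet> k}) = {} \<or> sectionable (Q \<inter> {x. c \<le> x \<bullet> k})"
  shows "interior Q = {} \<or> sectionable Q"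
proof (cases "interior Q = {}")
  case ne: False
  have k0: "k \<noteq> 0"
    using k by auto
  have clQ: "closure (interior Q) = Q"
    using convex_closure_interior[OF Q(1) ne] Q(2) by simp
  have int: "interior {x. x \<bullet> k \<le> c} = {x. x \<bullet> k < c}" "interior {x. c \<le> x \<bullet> k} = {x. c < x \<bullet> k}"
    using interior_halfspace_le[OF k0, of c] interior_halfspace_ge[OF k0, of c] by (simp_all add: inner_commute)
  have closed: "closed {x. x \<bullet> k \<le> c}" "closed {x. c \<le> x \<bullet> k}"
    using closed_halfspace_le[of k c] closed_halfspace_ge[of c k] by (simp_all add: inner_commute)
  show ?thesis
  proof (cases "\<exists>y\<in>interior Q. y \<bullet> k = c")
    case True
    then obtain y where y: "y \<in> interior Q" "y \<bullet> k = c"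
      by blast
    have "interior (Q \<inter> {x. x \<bullet> k \<le> c}) \<noteq> {}"
    proof
      assume "interior (Q \<inter> {x. x \<bullet> k \<le> c}) = {}"
      then have "interior Q \<subseteq> {x. c \<le> x \<bullet> k}"
        by (auto simp: interior_Int int)
      then have "interior Q \<subseteq> {x. c < x \<bullet> k}"
        using interior_maximal[OF _ open_interior] int(2) by blast
      then show False
        using y by auto
    qed
    moreover have "interior (Q \<inter> {x. c \<le> x \<bullet> k}) \<noteq> {}"
    proof
      assume "interior (Q \<inter> {x. c \<le> x \<bullet> k}) = {}"
      then have "interior Q \<subseteq> {x. x \<bullet> k \<le> c}"
        by (auto simp: interior_Int int)
      then have "interior Q \<subseteq> {x. x \<bullet> k < c}"
        using interior_maximal[OF _ open_interior] int(1) by blast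
      then show False
        using y by auto
    qed
    ultimately show ?thesis
      using sectionable_glue[OF Q y] s1 s2 by blast
  next
    case False
    have "connected (interior Q)"
      using Q(1) by (simp add: convex_connected convex_interior)
    then have "interior Q \<subseteq> {x. x \<bullet> k \<le> c} \<or> interior Q \<subseteq> {x. c \<le> x \<bullet> k}"
      using False connected_ivt_hyperplane[of "interior Q" _ _ k c]
      by (auto simp: inner_commute) (meson le_cases)
    then have "Q \<subseteq> {x. x \<bullet> k \<le> c} \<or> Q \<subseteq> {x. c \<le> x \<bullet> k}"
      using closed closure_minimal clQ by metis
    then have "Q \<inter> {x. x \<bullet> k \<le> c} = Q \<or> Q \<inter> {x. c \<le> x \<bullet> k} = Q"
      by blast
    then show ?thesis
      using s1 s2 by metis
  qed
qed simp

text \<open>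
  By the gluing lemma the existence of a section is an operative predicate on boxes, so it passes from
  the pieces of a fine tagged division, which carry local sections, to the whole polytope.
\<close>

lemma global_section:
  obtains s where "section_on polytope s"
proof -
  \<comment> \<open>An operative predicate has to hold on degenerate boxes, hence the first
    alternative.\<close>
  define g where "g K \<longleftrightarrow> interior (K \<inter> polytope) = {} \<or> sectionable (K \<inter> polytope)" for K
  interpret operative "(\<and>)" True g
  proof (rule operative.intro[OF comm_monoid_set_and], unfold_locales)
    fix a b :: "real^'n"
    assume "box a b = {}"
    then show "g (cbox a b) = True"
      by (simp add: g_def)
  next
    fix a b k :: "real^'n" and c
    assume k: "k \<in> Basis"
    let ?Q = "cbox a b \<inter> polytope"
    have e: "cbox a b \<inter> H \<inter> polytope = ?Q \<inter> H" for H
      by auto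
    have "g (cbox a b)" if "g (cbox a b \<inter> {x. x \<bullet> k \<le> c})" "g (cbox a b \<inter> {x. c \<le> x \<bullet> k})"
      using sectionable_split[OF convex_Int[OF convex_box(1) convex_polytope] closed_Int[OF closed_cbox closed_polytope] _ k, of a b c]
        that unfolding g_def e by blast
    moreover have "g (cbox a b \<inter> H)" if "g (cbox a b)" for H
      using that sectionable_subset[of ?Q "?Q \<inter> H"] interior_mono[of "?Q \<inter> H" ?Q]
      unfolding g_def e by blast
    ultimately show "g (cbox a b) = (g (cbox a b \<inter> {x. x \<bullet> k \<le> c}) \<and> g (cbox a b \<inter> {x. c \<le> x \<bullet> k}))"
      by blast
  qed
  have "\<exists>V. open V \<and> p \<in> V \<and> sectionable (V \<inter> polytope)" for p
  proof (cases "p \<in> polytope")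
    case True
    then obtain V s where "open V" "p \<in> V" "section_on (polytope \<inter> V) s"
      by (rule local_section)
    then show ?thesis
      unfolding sectionable_def by (metis Int_commute)
  next
    case False
    have "section_on {} s" for s
      by (simp add: section_on_def)
    then have "sectionable (- polytope \<inter> polytope)"
      by (simp add: sectionable_def)
    then show ?thesis
      using False closed_polytope by (intro exI[of _ "- polytope"]) auto
  qed
  then obtain V where V: "\<And>p. open (V p)" "\<And>p. p \<in> V p" "\<And>p. sectionable (V p \<inter> polytope)"
    by metis
  then have "gauge V"
    by (simp add: gauge_def)
  then obtain d where d: "d tagged_division_of (cbox 0 1)" "V fine d"
    by (rule fine_division_exists)
  have "g K" if "(x, K) \<in> d" for x K
    using V(3)[of x] sectionable_subset[of "V x \<inter> polytope" "K \<inter> polytope"] fineD[OF d(2) that]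
    by (auto simp: g_def)
  then have "F (\<lambda>(_, l). g l) d = True"
    by (intro neutral) auto
  then have "g (cbox 0 1)"
    using tagged_division[OF d(1)] by simp
  moreover have "cbox 0 1 \<inter> polytope = polytope"
    using polytope_subset_cbox by blast
  ultimately have "sectionable polytope"
    using interior_polytope_nonempty by (simp add: g_def)
  then show ?thesis
    using that by (auto simp: sectionable_def)
qed

end

section \<open>Equivariant homeomorphisms\<close>

context simplices
begin

text \<open>A relation, because the orbit map is a choice. By \<open>homeomorphic_imp_sim\<close>
  with \<open>M' = M\<close>, any two characteristic functions of one manifold are similar.\<close>

definition has_char :: "('a, 'n) Z2_manifold \<Rightarrow> (nat \<times> nat \<Rightarrow> bit^'n) \<Rightarrow> bool"
  where "has_char M \<kappa> \<longleftrightarrow> nonsing \<kappa> \<and> (\<exists>\<pi>. orbit_map m \<omega> E M \<pi> \<and>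
    (\<forall>x\<in>topspace (mtop M). {g. act M g x = x} = subset_sums \<kappa> (zero_facets (\<pi> x))))"

lemma has_char_exists:
  assumes "small_cover polytope M"
  obtains \<kappa> where "has_char M \<kappa>"
proof -
  obtain \<pi> where \<pi>: "orbit_map m \<omega> E M \<pi>"
    using assms by (rule orbit_map_exists)
  then interpret orbit_map m \<omega> E M \<pi> .
  obtain \<kappa> where "nonsing \<kappa>" "\<And>x. x \<in> X \<Longrightarrow> {g. act M g x = x} = subset_sums \<kappa> (zero_facets (\<pi> x))"
    by (rule characteristic_function) blast
  then have "has_char M \<kappa>"
    using \<pi> unfolding has_char_def by blast
  then show ?thesis
    by (rule that)
qed

lemma has_char_imp_small_cover: "has_char M \<kappa> \<Longrightarrow> small_cover polytope M"
  by (auto simp: has_char_def orbit_map_def orbit_map_axioms_def)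

text \<open>Sections over the polytope write every point as \<open>act M g (s p)\<close>, and the
  map sends it to \<open>act M' (\<theta> g) (s' (H p))\<close>, where \<open>H\<close> is the
  affine map realizing \<open>\<tau>\<close>. Matching isotropy groups make this well defined and
  injective, and a continuous bijection from a compact to a Hausdorff space is a
  homeomorphism.\<close>

lemma sim_imp_homeomorphic:
  fixes M M' :: "('a, 'n) Z2_manifold"
  assumes M: "has_char M \<kappa>" and M': "has_char M' \<kappa>'" and sim: "sim \<kappa> \<kappa>'"
  shows "weakly_equivariantly_homeomorphic M M'"
proof -
  obtain \<pi> where \<pi>: "orbit_map m \<omega> E M \<pi>"
    and iso: "\<And>x. x \<in> topspace (mtop M) \<Longrightarrow> {g. act M g x = x} = subset_sums \<kappa> (zero_facets (\<pi> x))"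
    using M unfolding has_char_def by blast
  obtain \<pi>' where \<pi>': "orbit_map m \<omega> E M' \<pi>'"
    and iso': "\<And>x. x \<in> topspace (mtop M') \<Longrightarrow> {g. act M' g x = x} = subset_sums \<kappa>' (zero_facets (\<pi>' x))"
    using M' unfolding has_char_def by blast
  interpret A: orbit_map m \<omega> E M \<pi>
    by (rule \<pi>)
  interpret B: orbit_map m \<omega> E M' \<pi>'
    by (rule \<pi>')
  obtain \<tau> \<theta> where \<tau>: "facet_aut \<tau>" and \<theta>: "Z2_automorphism \<theta>" and eq: "\<And>f. f \<in> facets \<Longrightarrow> \<kappa>' (\<tau> f) = \<theta> (\<kappa> f)"
    using sim unfolding sim_def by blast
  have \<theta>inv: "inv \<theta> (\<theta> g) = g" "\<theta> (inv \<theta> g) = g" for g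
    using \<theta> by (simp_all add: Z2_automorphism_def bij_def surj_f_inv_f)
  have \<theta>add: "\<theta> (g + h) = \<theta> g + \<theta> h" for g h
    using \<theta> by (simp add: Z2_automorphism_def)
  obtain H where H: "continuous_on polytope H" "H ` polytope = polytope" "inj_on H polytope"
    "\<And>x. x \<in> polytope \<Longrightarrow> zero_facets (H x) = \<tau> ` zero_facets x"
    using facet_aut_affine[OF \<tau>] by blast
  obtain s where s: "A.section_on polytope s"
    by (rule A.global_section)
  obtain s' where s': "B.section_on polytope s'"
    by (rule B.global_section)
  have s_in: "s p \<in> A.X" "\<pi> (s p) = p" if "p \<in> polytope" for p
    using A.section_on_in[OF s that] s that by (simp_all add: A.section_on_def)
  have s'_in: "s' p \<in> B.X" "\<pi>' (s' p) = p" if "p \<in> polytope" for p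
    using B.section_on_in[OF s' that] s' that by (simp_all add: B.section_on_def)
  have H_in: "H p \<in> polytope" if "p \<in> polytope" for p
    using H(2) that by blast
  have stab: "g \<in> A.stab (s p) \<longleftrightarrow> \<theta> g \<in> B.stab (s' (H p))" if p: "p \<in> polytope" for p g
  proof -
    have "B.stab (s' (H p)) = subset_sums \<kappa>' (\<tau> ` zero_facets p)"
      using iso'[OF s'_in(1)[OF H_in[OF p]]] s'_in(2)[OF H_in[OF p]] H(4)[OF p] by (simp add: B.stab_def)
    also have "\<dots> = subset_sums (\<lambda>f. \<kappa>' (\<tau> f)) (zero_facets p)"
      by (rule subset_sums_reindex) (rule inj_on_subset[OF facet_aut_inj[OF \<tau>]], auto simp: zero_facets_def)
    also have "\<dots> = subset_sums (\<lambda>f. \<theta> (\<kappa> f)) (zero_facets p)"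
      by (rule subset_sums_cong) (auto simp: eq zero_facets_def)
    also have "\<dots> = \<theta> ` subset_sums \<kappa> (zero_facets p)"
      using \<theta> by (simp add: Z2_automorphism_iff additive_subset_sums)
    also have "subset_sums \<kappa> (zero_facets p) = A.stab (s p)"
      using iso[OF s_in(1)[OF p]] s_in(2)[OF p] by (simp add: A.stab_def)
    finally have "B.stab (s' (H p)) = \<theta> ` A.stab (s p)" .
    then show ?thesis
      using \<theta>inv(1) by (metis image_iff)
  qed
  \<comment> \<open>The translates of the section are finitely many closed sets covering the
    manifold, so the map may be pasted from its restrictions to them.\<close>
  define T where "T g = (\<lambda>p. act M g (s p)) ` polytope" for g
  define F where "F g x = act M' (\<theta> g) (s' (H (\<pi> x)))" for g x
  have cs: "continuous_map (top_of_set polytope) (mtop M) (\<lambda>p. act M g (s p))" for g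
    using A.section_on_act[OF s] by (simp add: A.section_on_def)
  have F: "F g (act M g' (s p)) = act M' (\<theta> g) (s' (H p))" if "p \<in> polytope" for g g' p
    using s_in[OF that] by (simp add: F_def)
  have rep: "\<exists>p\<in>polytope. \<exists>g. x = act M g (s p)" if x: "x \<in> A.X" for x
  proof -
    have p: "\<pi> x \<in> polytope"
      using A.\<pi>_in[OF x] .
    then show ?thesis
      using A.fibre[OF s_in(1)[OF p] x] s_in(2)[OF p] by metis
  qed
  obtain f where f: "continuous_map (mtop M) (mtop M') f" "\<And>x g. x \<in> A.X \<inter> T g \<Longrightarrow> f x = F g x"
  proof (rule pasting_lemma_exists_closed[of "UNIV :: (bit^'n) set" "mtop M" T "mtop M'" F])
    show "A.X \<subseteq> \<Union> (range T)"
      using rep by (fastforce simp: T_def)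
    show "closedin (mtop M) (T g)" for g
    proof -
      have "compactin (mtop M) (T g)"
        unfolding T_def by (rule image_compactin[OF _ cs]) (simp add: compact_polytope)
      then show ?thesis
        using A.Hausdorff compactin_imp_closedin by blast
    qed
    show "continuous_map (subtopology (mtop M) (T g)) (mtop M') (F g)" for g
    proof (rule continuous_map_from_subtopology)
      have cH: "continuous_map (top_of_set polytope) (top_of_set polytope) H"
        using H(1) H_in by auto
      have "continuous_map (top_of_set polytope) (mtop M') s'"
        using s' by (simp add: B.section_on_def)
      then have "continuous_map (mtop M) (mtop M') (act M' (\<theta> g) \<circ> (s' \<circ> (H \<circ> \<pi>)))"
        by (intro continuous_map_compose[OF _ B.continuous_act]
            continuous_map_compose[OF continuous_map_compose[OF A.continuous_\<pi> cH]])
      then show "continuous_map (mtop M) (mtop M') (F g)"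
        by (simp add: F_def[abs_def] comp_def)
    qed
    show "F g x = F g' x" if x: "x \<in> A.X \<inter> T g \<inter> T g'" for g g' x
    proof -
      obtain p q where p: "p \<in> polytope" "x = act M g (s p)" and q: "q \<in> polytope" "x = act M g' (s q)"
        using x unfolding T_def by blast
      have "p = q"
        using p q A.\<pi>_act[OF s_in(1)[OF p(1)], of g] A.\<pi>_act[OF s_in(1)[OF q(1)], of g'] s_in(2) by metis
      then have "g + g' \<in> A.stab (s p)"
        using p q A.act_eq_iff[OF s_in(1)[OF p(1)], of g g'] by simp
      then have "\<theta> g + \<theta> g' \<in> B.stab (s' (H p))"
        using stab[OF p(1)] \<theta>add by metis
      then have "act M' (\<theta> g) (s' (H p)) = act M' (\<theta> g') (s' (H p))"
        using B.act_eq_iff[OF s'_in(1)[OF H_in[OF p(1)]]] by simp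
      then show ?thesis
        using p s_in[OF p(1)] by (simp add: F_def)
    qed
  qed auto
  have f_act: "f (act M g (s p)) = act M' (\<theta> g) (s' (H p))" if p: "p \<in> polytope" for g p
    using f(2)[of "act M g (s p)" g] A.act_in[OF s_in(1)[OF p]] p F[OF p] by (auto simp: T_def)
  have "f ` A.X = B.X"
  proof (intro equalityI subsetI)
    fix y assume "y \<in> f ` A.X"
    then show "y \<in> B.X"
      using continuous_map_image_subset_topspace[OF f(1)] by blast
  next
    fix y assume y: "y \<in> B.X"
    have "\<pi>' y \<in> H ` polytope"
      using B.\<pi>_in[OF y] H(2) by simp
    then obtain p where p: "p \<in> polytope" "\<pi>' y = H p"
      by blast
    then obtain h where "y = act M' h (s' (H p))"
      using B.fibre[OF s'_in(1)[OF H_in[OF p(1)]] y] s'_in(2)[OF H_in[OF p(1)]] by auto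
    then have "y = f (act M (inv \<theta> h) (s p))"
      using f_act[OF p(1)] \<theta>inv(2) by simp
    then show "y \<in> f ` A.X"
      using A.act_in[OF s_in(1)[OF p(1)]] by blast
  qed
  moreover have "inj_on f A.X"
  proof (rule inj_onI)
    fix x y assume x: "x \<in> A.X" and y: "y \<in> A.X" and fxy: "f x = f y"
    obtain p g where p: "p \<in> polytope" "x = act M g (s p)"
      using rep[OF x] by blast
    obtain q h where q: "q \<in> polytope" "y = act M h (s q)"
      using rep[OF y] by blast
    have e: "act M' (\<theta> g) (s' (H p)) = act M' (\<theta> h) (s' (H q))"
      using fxy p q f_act by simp
    then have "H p = H q"
      using B.\<pi>_act[OF s'_in(1)[OF H_in[OF p(1)]], of "\<theta> g"] B.\<pi>_act[OF s'_in(1)[OF H_in[OF q(1)]], of "\<theta> h"]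
        s'_in(2)[OF H_in[OF p(1)]] s'_in(2)[OF H_in[OF q(1)]] by metis
    then have pq: "p = q"
      using H(3) p q by (auto dest: inj_onD)
    then have "\<theta> (g + h) \<in> B.stab (s' (H p))"
      using e B.act_eq_iff[OF s'_in(1)[OF H_in[OF p(1)]]] \<theta>add by simp
    then have "g + h \<in> A.stab (s p)"
      using stab[OF p(1)] by simp
    then show "x = y"
      using A.act_eq_iff[OF s_in(1)[OF p(1)]] p q pq by simp
  qed
  ultimately have "homeomorphic_map (mtop M) (mtop M') f"
    using continuous_imp_homeomorphic_map[OF f(1) A.compact B.Hausdorff] by blast
  moreover have "f (act M k x) = act M' (\<theta> k) (f x)" if x: "x \<in> A.X" for k x
  proof -
    obtain p g where p: "p \<in> polytope" "x = act M g (s p)"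
      using rep[OF x] by blast
    have "f (act M k x) = f (act M (k + g) (s p))"
      using p A.act_add[OF s_in(1)[OF p(1)]] by simp
    also have "\<dots> = act M' (\<theta> k) (act M' (\<theta> g) (s' (H p)))"
      using f_act[OF p(1)] \<theta>add B.act_add[OF s'_in(1)[OF H_in[OF p(1)]]] by simp
    also have "\<dots> = act M' (\<theta> k) (f x)"
      using f_act[OF p(1)] p by simp
    finally show ?thesis .
  qed
  ultimately show ?thesis
    unfolding weakly_equivariantly_homeomorphic_def using \<theta> by blast
qed

text \<open>The blocks are the minimal sets of facets without a common point, so a permutation
  preserving face sets in both directions permutes the blocks.\<close>

lemma facet_autI_face_sets:
  assumes \<tau>: "\<And>f. f \<in> facets \<Longrightarrow> \<tau> f \<in> facets" "\<And>f. f \<in> facets \<Longrightarrow> \<tau>' (\<tau> f) = f"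
    and \<tau>': "\<And>f. f \<in> facets \<Longrightarrow> \<tau>' f \<in> facets" "\<And>f. f \<in> facets \<Longrightarrow> \<tau> (\<tau>' f) = f"
    and face: "\<And>S. face_set S \<Longrightarrow> face_set (\<tau> ` S)" "\<And>S. face_set S \<Longrightarrow> face_set (\<tau>' ` S)"
  shows "facet_aut \<tau>"
proof -
  have bij: "bij_betw \<tau> facets facets"
    using \<tau> \<tau>' by (intro bij_betw_byWitness[where f' = \<tau>']) auto
  let ?N = "\<lambda>v. {v} \<times> {0..\<omega> v}"
  have NF: "?N v \<subseteq> facets" if "v \<in> {1..m}" for v
    using that by auto
  \<comment> \<open>The image of a block is not a face set, since the block itself would then be
    one; so it contains a whole block. Using this for both maps yields equality.\<close>
  have contains: "\<exists>u\<in>{1..m}. ?N u \<subseteq> \<rho> ` ?N v"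
    if v: "v \<in> {1..m}" and \<rho>: "\<And>f. f \<in> facets \<Longrightarrow> \<rho> f \<in> facets" "\<And>f. f \<in> facets \<Longrightarrow> \<rho>' (\<rho> f) = f"
      and \<rho>face: "\<And>S. face_set S \<Longrightarrow> face_set (\<rho>' ` S)" for \<rho> \<rho>' v
  proof (rule ccontr)
    assume no: "\<not> ?thesis"
    have "face_set (\<rho> ` ?N v)"
      unfolding face_set_def
    proof (intro conjI ballI)
      show "\<rho> ` ?N v \<subseteq> facets"
        using NF[OF v] \<rho>(1) by blast
      show "\<exists>i\<le>\<omega> u. (u, i) \<notin> \<rho> ` ?N v" if "u \<in> {1..m}" for u
      proof -
        have "\<not> ?N u \<subseteq> \<rho> ` ?N v"
          using no that by blast
        then show ?thesis
          by auto
      qed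
    qed
    then have "face_set (\<rho>' ` \<rho> ` ?N v)"
      by (rule \<rho>face)
    moreover have "\<rho>' ` \<rho> ` ?N v = ?N v"
      using NF[OF v] \<rho>(2) by (force simp: image_image)
    ultimately have "face_set (?N v)"
      by simp
    then show False
      using v unfolding face_set_def by fastforce
  qed
  have ex: "\<exists>u\<in>{1..m}. \<tau> ` ?N v = ?N u" if v: "v \<in> {1..m}" for v
  proof -
    obtain u where u: "u \<in> {1..m}" "?N u \<subseteq> \<tau> ` ?N v"
      using contains[OF v, of \<tau> \<tau>'] \<tau> face by blast
    obtain w where w: "w \<in> {1..m}" "?N w \<subseteq> \<tau>' ` ?N u"
      using contains[OF u(1), of \<tau>' \<tau>] \<tau>' face by blast
    have sub: "\<tau>' ` ?N u \<subseteq> ?N v"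
    proof
      fix f assume "f \<in> \<tau>' ` ?N u"
      then obtain g where g: "g \<in> ?N u" "f = \<tau>' g"
        by blast
      then obtain h where h: "h \<in> ?N v" "g = \<tau> h"
        using u by blast
      then have "h \<in> facets"
        using NF[OF v] by blast
      then show "f \<in> ?N v"
        using g h \<tau>(2) by simp
    qed
    moreover have "(w, 0) \<in> ?N w"
      by simp
    ultimately have "(w, 0) \<in> ?N v"
      using w by blast
    then have "w = v"
      by simp
    then have "?N v = \<tau>' ` ?N u"
      using w sub by blast
    then have "\<tau> ` ?N v = \<tau> ` \<tau>' ` ?N u"
      by simp
    also have "\<dots> = ?N u"
      using NF[OF u(1)] \<tau>'(2) by (force simp: image_image)
    finally show ?thesis
      using u by blast
  qed
  have "fst (\<tau> f) = fst (\<tau> g) \<longleftrightarrow> fst f = fst g" if f: "f \<in> facets" and g: "g \<in> facets" for f g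
  proof -
    obtain v i where vi: "f = (v, i)" "v \<in> {1..m}" "i \<le> \<omega> v"
      using f by (cases f) auto
    obtain w j where wj: "g = (w, j)" "w \<in> {1..m}" "j \<le> \<omega> w"
      using g by (cases g) auto
    obtain u where u: "\<tau> ` ?N v = ?N u"
      using ex[OF vi(2)] by blast
    obtain x where x: "\<tau> ` ?N w = ?N x"
      using ex[OF wj(2)] by blast
    have "\<tau> f \<in> ?N u" "\<tau> g \<in> ?N x"
      using vi wj by (auto simp flip: u x)
    then have fst: "fst (\<tau> f) = u" "fst (\<tau> g) = x"
      by auto
    have "v = w" if "u = x"
    proof -
      have "\<tau> ` ?N v = \<tau> ` ?N w"
        using u x that by simp
      then have N: "?N v = ?N w"
        using inj_on_image_eq_iff[of \<tau> facets "?N v" "?N w"] bij NF[OF vi(2)] NF[OF wj(2)] by (simp add: bij_betw_def)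
      have "(v, 0) \<in> ?N v"
        by simp
      then have "(v, 0) \<in> ?N w"
        by (simp only: N)
      then show ?thesis
        by simp
    qed
    moreover have "u = x" if "v = w"
      using u x that by auto
    ultimately show ?thesis
      using fst vi wj by auto
  qed
  then show ?thesis
    using bij by (simp add: facet_aut_def)
qed

text \<open>The map \<open>H\<close> between orbit spaces preserves the orders of isotropy groups,
  hence the number of facets through a point. An open facet is therefore sent into the union of the
  open facets, and by connectedness into one of them, which defines \<open>\<tau>\<close>. Letting
  points of an open facet tend to \<open>p\<close> gives the inclusion at \<open>p\<close>; equality
  will come from the inverse homeomorphism.\<close>

lemma induced_facet_map:
  fixes M M' :: "('a, 'n) Z2_manifold"
  assumes \<pi>: "orbit_map m \<omega> E M \<pi>" and \<pi>': "orbit_map m \<omega> E M' \<pi>'"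
    and f: "continuous_map (mtop M) (mtop M') f" and inj: "inj_on f (topspace (mtop M))"
    and \<theta>: "Z2_automorphism \<theta>"
    and eqv: "\<And>g x. x \<in> topspace (mtop M) \<Longrightarrow> f (act M g x) = act M' (\<theta> g) (f x)"
  obtains H \<tau> where "\<And>x. x \<in> topspace (mtop M) \<Longrightarrow> H (\<pi> x) = \<pi>' (f x)" "\<And>p. p \<in> polytope \<Longrightarrow> H p \<in> polytope"
    "\<And>f. f \<in> facets \<Longrightarrow> \<tau> f \<in> facets" "\<And>f p. f \<in> facets \<Longrightarrow> p \<in> polytope \<Longrightarrow> zero_facets p = {f} \<Longrightarrow> zero_facets (H p) = {\<tau> f}"
    "\<And>p. p \<in> polytope \<Longrightarrow> \<tau> ` zero_facets p \<subseteq> zero_facets (H p)"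
proof -
  interpret A: orbit_map m \<omega> E M \<pi>
    by (rule \<pi>)
  interpret B: orbit_map m \<omega> E M' \<pi>'
    by (rule \<pi>')
  have f_in: "f x \<in> B.X" if "x \<in> A.X" for x
    using continuous_map_image_subset_topspace[OF f] that by blast
  have "continuous_map (mtop M) (top_of_set polytope) (\<pi>' \<circ> f)"
    by (rule continuous_map_compose[OF f B.continuous_\<pi>])
  moreover have "(\<pi>' \<circ> f) x = (\<pi>' \<circ> f) y" if xy: "x \<in> A.X" "y \<in> A.X" "\<pi> x = \<pi> y" for x y
  proof -
    obtain g where "y = act M g x"
      using A.fibre[OF xy(1,2)] xy(3) by blast
    then show ?thesis
      using eqv[OF xy(1), of g] B.\<pi>_act[OF f_in[OF xy(1)], of "\<theta> g"] by simp
  qed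
  ultimately obtain H where H: "continuous_map (top_of_set polytope) (top_of_set polytope) H"
    "\<And>x. x \<in> A.X \<Longrightarrow> H (\<pi> x) = (\<pi>' \<circ> f) x"
    using quotient_map_lift_exists[OF A.quot] by metis
  have cH: "continuous_on polytope H" and H_in: "\<And>p. p \<in> polytope \<Longrightarrow> H p \<in> polytope"
    using H(1) by auto
  have card: "card (zero_facets (H p)) = card (zero_facets p)" if p: "p \<in> polytope" for p
  proof -
    obtain x where x: "x \<in> A.X" "\<pi> x = p"
      using A.\<pi>_surj[OF p] by blast
    have "B.stab (f x) = \<theta> ` A.stab x"
    proof (intro equalityI subsetI)
      fix k assume k: "k \<in> B.stab (f x)"
      have inv: "\<theta> (inv \<theta> k) = k"
        using \<theta> by (simp add: Z2_automorphism_def bij_def surj_f_inv_f)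
      have "f (act M (inv \<theta> k) x) = f x"
        using eqv[OF x(1), of "inv \<theta> k"] k inv by (simp add: B.stab_def)
      then have "inv \<theta> k \<in> A.stab x"
        using inj_onD[OF inj] A.act_in x(1) by (simp add: A.stab_def)
      then show "k \<in> \<theta> ` A.stab x"
        using inv by (metis image_eqI)
    next
      fix k assume "k \<in> \<theta> ` A.stab x"
      then obtain g where "act M g x = x" "k = \<theta> g"
        by (auto simp: A.stab_def)
      then show "k \<in> B.stab (f x)"
        using eqv[OF x(1), of g] by (simp add: B.stab_def)
    qed
    then have "card (B.stab (f x)) = card (A.stab x)"
      using \<theta> card_image[of \<theta> "A.stab x"] inj_on_subset[of \<theta> UNIV "A.stab x"]
      by (simp add: Z2_automorphism_def bij_def)
    then have "(2::nat) ^ card (zero_facets (\<pi>' (f x))) = 2 ^ card (zero_facets (\<pi> x))"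
      using A.card_stab'[OF x(1)] B.card_stab'[OF f_in[OF x(1)]] by simp
    then show ?thesis
      using H(2)[OF x(1)] x by simp
  qed
  define S where "S f = {p \<in> polytope. zero_facets p = {f}}" for f
  define \<tau> where "\<tau> f = (SOME g. \<exists>p\<in>S f. zero_facets (H p) = {g})" for f
  have ex1: "\<exists>g. zero_facets (H p) = {g}" if p: "p \<in> polytope" "zero_facets p = {f}" for p f
    using card[OF p(1)] p(2) by (simp add: card_1_singleton_iff)
  have S_ne: "\<exists>q. q \<in> S f" if fF: "f \<in> facets" for f
  proof -
    obtain q where "q \<in> polytope" "zero_facets q = {f}"
      using face_set_singleton[OF fF] by (rule face_set_point)
    then show ?thesis
      by (auto simp: S_def)
  qed
  have const: "zero_facets (H p) = zero_facets (H q)" if pq: "p \<in> S f" "q \<in> S f" for f p q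
  proof -
    have con: "connected (S f)"
      unfolding S_def by (rule connected_stratum)
    have fin: "finite ((\<lambda>p. zero_facets (H p)) ` S f)"
      by (rule finite_subset[of _ "Pow facets"]) (auto simp: zero_facets_def)
    have "closedin (top_of_set (S f)) {p \<in> S f. zero_facets (H p) = a}" for a
    proof (cases "\<exists>g. g \<in> facets \<and> a = {g}")
      case True
      then obtain g where g: "g \<in> facets" "a = {g}"
        by blast
      \<comment> \<open>On \<open>S f\<close> exactly one barycentric coordinate vanishes after
        \<open>H\<close>, so a single equation decides which one.\<close>
      have "{p \<in> S f. zero_facets (H p) = a} = S f \<inter> (\<lambda>p. bary g (H p)) -` {0}"
      proof (intro equalityI subsetI)
        fix p assume "p \<in> {p \<in> S f. zero_facets (H p) = a}"
        then have "p \<in> S f" "g \<in> zero_facets (H p)"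
          using g by auto
        then show "p \<in> S f \<inter> (\<lambda>p. bary g (H p)) -` {0}"
          by (simp add: zero_facets_def)
      next
        fix p assume p: "p \<in> S f \<inter> (\<lambda>p. bary g (H p)) -` {0}"
        then have "g \<in> zero_facets (H p)"
          using g by (simp add: zero_facets_def)
        moreover obtain g' where "zero_facets (H p) = {g'}"
          using ex1[of p f] p by (auto simp: S_def)
        ultimately show "p \<in> {p \<in> S f. zero_facets (H p) = a}"
          using p g by simp
      qed
      moreover have "continuous_on (S f) (\<lambda>p. bary g (H p))"
        by (intro continuous_intros continuous_on_subset[OF cH]) (auto simp: S_def)
      ultimately show ?thesis
        by (simp add: continuous_closedin_preimage)
    next
      case False
      have "{p \<in> S f. zero_facets (H p) = a} = {}"
      proof (rule ccontr)
        assume "{p \<in> S f. zero_facets (H p) = a} \<noteq> {}"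
        then obtain p where p: "p \<in> S f" "zero_facets (H p) = a"
          by blast
        then obtain g where g: "zero_facets (H p) = {g}"
          using ex1[of p f] by (auto simp: S_def)
        then have "g \<in> zero_facets (H p)"
          by simp
        then have "g \<in> facets"
          by (simp add: zero_facets_def)
        then show False
          using False p g by blast
      qed
      then show ?thesis
        by (simp only: closedin_empty)
    qed
    then show ?thesis
      using pq by (intro connected_closed_fibres_constant[OF con fin])
  qed
  have \<tau>: "zero_facets (H p) = {\<tau> f}" if p: "p \<in> polytope" "zero_facets p = {f}" for f p
  proof -
    have pS: "p \<in> S f"
      using p by (simp add: S_def)
    then have "\<exists>g. \<exists>p\<in>S f. zero_facets (H p) = {g}"
      using ex1[OF p] by blast
    then have "\<exists>p\<in>S f. zero_facets (H p) = {\<tau> f}"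
      unfolding \<tau>_def by (rule someI_ex)
    then show ?thesis
      using const[OF pS] by metis
  qed
  have \<tau>facets: "\<tau> f \<in> facets" if f: "f \<in> facets" for f
  proof -
    obtain q where "q \<in> S f"
      using S_ne[OF f] by blast
    then have "\<tau> f \<in> zero_facets (H q)"
      using \<tau>[of q f] by (simp add: S_def)
    then show ?thesis
      by (simp add: zero_facets_def)
  qed
  have "\<tau> f \<in> zero_facets (H p)" if p: "p \<in> polytope" and f: "f \<in> zero_facets p" for f p
  proof -
    have fF: "f \<in> facets"
      using f by (simp add: zero_facets_def)
    obtain q where q: "q \<in> polytope" "zero_facets q = {f}"
      using S_ne[OF fF] by (auto simp: S_def)
    let ?\<gamma> = "\<lambda>t. (1 - t) *\<^sub>R p + t *\<^sub>R q"
    let ?C = "{p \<in> polytope. bary (\<tau> f) (H p) = 0}"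
    have "closed ?C"
      using continuous_closed_preimage_constant[of polytope "\<lambda>p. bary (\<tau> f) (H p)" 0] closed_polytope cH
      by (simp add: continuous_on_bary)
    moreover have "(?\<gamma> \<longlongrightarrow> ?\<gamma> 0) (at_right 0)"
      by (intro tendsto_intros)
    moreover have "\<forall>\<^sub>F t in at_right 0. ?\<gamma> t \<in> ?C"
    proof -
      have "?\<gamma> t \<in> ?C" if t: "0 < t" "t < 1" for t
      proof -
        have in_polytope: "?\<gamma> t \<in> polytope"
          using convex_polytope p q t unfolding convex_alt by simp
        have "zero_facets (?\<gamma> t) = {f}"
          using zero_facets_segment[OF p q(1) t] q(2) f by auto
        then have "\<tau> f \<in> zero_facets (H (?\<gamma> t))"
          using \<tau>[OF in_polytope] by simp
        then show ?thesis
          using in_polytope by (simp add: zero_facets_def)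
      qed
      then show ?thesis
        by (intro eventually_at_rightI[of 0 1]) auto
    qed
    ultimately have "?\<gamma> 0 \<in> ?C"
      by (intro Lim_in_closed_set[where F = "at_right 0" and f = ?\<gamma>]) auto
    then show ?thesis
      using \<tau>facets[OF fF] by (simp add: zero_facets_def)
  qed
  then have "\<tau> ` zero_facets p \<subseteq> zero_facets (H p)" if "p \<in> polytope" for p
    using that by blast
  then show ?thesis
    using that[of H \<tau>] H(2) H_in \<tau>facets \<tau> by simp
qed

text \<open>The facet maps induced by the homeomorphism and its inverse are mutually inverse and
  respect face sets. Over an open facet \<open>f0\<close> the isotropy group has a single nonzero
  element on either side, so \<open>\<theta>\<close> takes \<open>\<kappa> f0\<close> to
  \<open>\<kappa>' (\<tau> f0)\<close>.\<close>

lemma homeomorphic_imp_sim: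
  fixes M M' :: "('a, 'n) Z2_manifold"
  assumes M: "has_char M \<kappa>" and M': "has_char M' \<kappa>'"
    and hom: "weakly_equivariantly_homeomorphic M M'"
  shows "sim \<kappa> \<kappa>'"
proof -
  obtain \<pi> where \<pi>: "orbit_map m \<omega> E M \<pi>" and ns: "nonsing \<kappa>"
    and iso: "\<And>x. x \<in> topspace (mtop M) \<Longrightarrow> {g. act M g x = x} = subset_sums \<kappa> (zero_facets (\<pi> x))"
    using M unfolding has_char_def by blast
  obtain \<pi>' where \<pi>': "orbit_map m \<omega> E M' \<pi>'"
    and iso': "\<And>x. x \<in> topspace (mtop M') \<Longrightarrow> {g. act M' g x = x} = subset_sums \<kappa>' (zero_facets (\<pi>' x))"
    using M' unfolding has_char_def by blast
  interpret A: orbit_map m \<omega> E M \<pi>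
    by (rule \<pi>)
  interpret B: orbit_map m \<omega> E M' \<pi>'
    by (rule \<pi>')
  obtain f \<theta> where f: "homeomorphic_map (mtop M) (mtop M') f" and \<theta>: "Z2_automorphism \<theta>"
    and eqv: "\<And>g x. x \<in> A.X \<Longrightarrow> f (act M g x) = act M' (\<theta> g) (f x)"
    using hom unfolding weakly_equivariantly_homeomorphic_def by blast
  obtain f' where ff': "homeomorphic_maps (mtop M) (mtop M') f f'"
    using f homeomorphic_map_maps by blast
  have inj: "inj_on f A.X" and cf: "continuous_map (mtop M) (mtop M') f"
    using f by (auto simp: homeomorphic_eq_everything_map)
  have f': "homeomorphic_map (mtop M') (mtop M) f'"
    using ff' homeomorphic_map_maps homeomorphic_maps_sym by blast
  then have inj': "inj_on f' B.X" and cf': "continuous_map (mtop M') (mtop M) f'"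
    by (auto simp: homeomorphic_eq_everything_map)
  have f'f: "f' (f x) = x" if "x \<in> A.X" for x
    using ff' that by (simp add: homeomorphic_maps_def)
  have ff'_id: "f (f' y) = y" if "y \<in> B.X" for y
    using ff' that by (simp add: homeomorphic_maps_def)
  have f'_in: "f' y \<in> A.X" if "y \<in> B.X" for y
    using continuous_map_image_subset_topspace[OF cf'] that by blast
  have f_in: "f x \<in> B.X" if "x \<in> A.X" for x
    using continuous_map_image_subset_topspace[OF cf] that by blast
  have inv: "\<theta> (inv \<theta> k) = k" for k
    using \<theta> by (simp add: Z2_automorphism_def bij_def surj_f_inv_f)
  have eqv': "f' (act M' k y) = act M (inv \<theta> k) (f' y)" if y: "y \<in> B.X" for k y
  proof -
    have "f (act M (inv \<theta> k) (f' y)) = act M' k y"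
      using eqv[OF f'_in[OF y], of "inv \<theta> k"] inv ff'_id[OF y] by simp
    then show ?thesis
      using f'f[OF A.act_in[OF f'_in[OF y]]] by metis
  qed
  obtain H \<tau> where H: "\<And>x. x \<in> A.X \<Longrightarrow> H (\<pi> x) = \<pi>' (f x)" "\<And>p. p \<in> polytope \<Longrightarrow> H p \<in> polytope"
    and \<tau>: "\<And>f. f \<in> facets \<Longrightarrow> \<tau> f \<in> facets" "\<And>f p. f \<in> facets \<Longrightarrow> p \<in> polytope \<Longrightarrow> zero_facets p = {f} \<Longrightarrow> zero_facets (H p) = {\<tau> f}"
      "\<And>p. p \<in> polytope \<Longrightarrow> \<tau> ` zero_facets p \<subseteq> zero_facets (H p)"
    using induced_facet_map[OF \<pi> \<pi>' cf inj \<theta> eqv] by blast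
  obtain H' \<tau>' where H': "\<And>y. y \<in> B.X \<Longrightarrow> H' (\<pi>' y) = \<pi> (f' y)" "\<And>p. p \<in> polytope \<Longrightarrow> H' p \<in> polytope"
    and \<tau>': "\<And>f. f \<in> facets \<Longrightarrow> \<tau>' f \<in> facets" "\<And>f p. f \<in> facets \<Longrightarrow> p \<in> polytope \<Longrightarrow> zero_facets p = {f} \<Longrightarrow> zero_facets (H' p) = {\<tau>' f}"
      "\<And>p. p \<in> polytope \<Longrightarrow> \<tau>' ` zero_facets p \<subseteq> zero_facets (H' p)"
    using induced_facet_map[OF \<pi>' \<pi> cf' inj' Z2_automorphism_inv[OF \<theta>] eqv'] by blast
  have H'H: "H' (H p) = p" if "p \<in> polytope" for p
  proof -
    obtain x where x: "x \<in> A.X" "\<pi> x = p"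
      using A.\<pi>_surj[OF \<open>p \<in> polytope\<close>] by blast
    then show ?thesis
      using H(1)[OF x(1)] H'(1)[OF f_in[OF x(1)]] f'f[OF x(1)] by simp
  qed
  have HH': "H (H' p) = p" if "p \<in> polytope" for p
  proof -
    obtain y where y: "y \<in> B.X" "\<pi>' y = p"
      using B.\<pi>_surj[OF \<open>p \<in> polytope\<close>] by blast
    then show ?thesis
      using H'(1)[OF y(1)] H(1)[OF f'_in[OF y(1)]] ff'_id[OF y(1)] by simp
  qed
  have facet_point: "\<exists>q\<in>polytope. zero_facets q = {f}" if fF: "f \<in> facets" for f
  proof -
    show ?thesis
      using face_set_singleton[OF fF] by (rule face_set_point) blast
  qed
  have \<tau>'\<tau>: "\<tau>' (\<tau> f) = f" if f: "f \<in> facets" for f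
  proof -
    obtain q where q: "q \<in> polytope" "zero_facets q = {f}"
      using facet_point[OF f] by blast
    have "zero_facets (H' (H q)) = {\<tau>' (\<tau> f)}"
      by (rule \<tau>'(2)[OF \<tau>(1)[OF f] H(2)[OF q(1)] \<tau>(2)[OF f q]])
    then show ?thesis
      using H'H[OF q(1)] q by simp
  qed
  have \<tau>\<tau>': "\<tau> (\<tau>' f) = f" if f: "f \<in> facets" for f
  proof -
    obtain q where q: "q \<in> polytope" "zero_facets q = {f}"
      using facet_point[OF f] by blast
    have "zero_facets (H (H' q)) = {\<tau> (\<tau>' f)}"
      by (rule \<tau>(2)[OF \<tau>'(1)[OF f] H'(2)[OF q(1)] \<tau>'(2)[OF f q]])
    then show ?thesis
      using HH'[OF q(1)] q by simp
  qed
  have ZH: "zero_facets (H p) = \<tau> ` zero_facets p" if p: "p \<in> polytope" for p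
  proof
    show "zero_facets (H p) \<subseteq> \<tau> ` zero_facets p"
    proof
      fix f assume f: "f \<in> zero_facets (H p)"
      then have "\<tau>' f \<in> zero_facets p"
        using \<tau>'(3)[OF H(2)[OF p]] H'H[OF p] by auto
      moreover have "f = \<tau> (\<tau>' f)"
        using \<tau>\<tau>' f by (simp add: zero_facets_def)
      ultimately show "f \<in> \<tau> ` zero_facets p"
        by blast
    qed
  qed (rule \<tau>(3)[OF p])
  have ZH': "zero_facets (H' p) = \<tau>' ` zero_facets p" if p: "p \<in> polytope" for p
  proof
    show "zero_facets (H' p) \<subseteq> \<tau>' ` zero_facets p"
    proof
      fix f assume f: "f \<in> zero_facets (H' p)"
      then have "\<tau> f \<in> zero_facets p"
        using \<tau>(3)[OF H'(2)[OF p]] HH'[OF p] by auto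
      moreover have "f = \<tau>' (\<tau> f)"
        using \<tau>'\<tau> f by (simp add: zero_facets_def)
      ultimately show "f \<in> \<tau>' ` zero_facets p"
        by blast
    qed
  qed (rule \<tau>'(3)[OF p])
  have "facet_aut \<tau>"
  proof (rule facet_autI_face_sets[of \<tau> \<tau>'])
    fix S assume "face_set S"
    then obtain p where p: "p \<in> polytope" "zero_facets p = S"
      by (rule face_set_point)
    show "face_set (\<tau> ` S)"
      using face_set_zero_facets[OF H(2)[OF p(1)]] ZH[OF p(1)] p by simp
    show "face_set (\<tau>' ` S)"
      using face_set_zero_facets[OF H'(2)[OF p(1)]] ZH'[OF p(1)] p by simp
  qed (use \<tau> \<tau>' \<tau>'\<tau> \<tau>\<tau>' in auto)
  moreover have "\<kappa>' (\<tau> f0) = \<theta> (\<kappa> f0)" if f0: "f0 \<in> facets" for f0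
  proof -
    obtain q where q: "q \<in> polytope" "zero_facets q = {f0}"
      using facet_point[OF f0] by blast
    obtain x where x: "x \<in> A.X" "\<pi> x = q"
      using A.\<pi>_surj[OF q(1)] by blast
    have ss: "subset_sums \<rho> {g} = {0, \<rho> g}" for \<rho> :: "nat \<times> nat \<Rightarrow> bit^'n" and g
      by (auto simp: subset_sums_def subset_singleton_iff intro: exI[of _ "{}"] exI[of _ "{g}"])
    \<comment> \<open>A zero value would give a one-element face set with sum zero.\<close>
    have "\<kappa> f0 \<noteq> 0"
    proof
      assume "\<kappa> f0 = 0"
      then have "{f0} = {}"
        using ns face_set_zero_facets[OF q(1)] q(2) unfolding nonsing_iff by (metis sum.empty sum.insert finite.emptyI empty_iff add_0)
      then show False
        by simp
    qed
    then have "\<theta> (\<kappa> f0) \<noteq> 0"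
      using \<theta> additive_bij_iff[of \<theta>] by (auto simp: Z2_automorphism_iff)
    moreover have "act M (\<kappa> f0) x = x"
      using iso[OF x(1)] x q ss by auto
    then have "act M' (\<theta> (\<kappa> f0)) (f x) = f x"
      using eqv[OF x(1), of "\<kappa> f0"] by simp
    then have "\<theta> (\<kappa> f0) \<in> subset_sums \<kappa>' (zero_facets (\<pi>' (f x)))"
      using iso'[OF f_in[OF x(1)]] by blast
    then have "\<theta> (\<kappa> f0) \<in> {0, \<kappa>' (\<tau> f0)}"
      using H(1)[OF x(1)] x \<tau>(2)[OF f0 q] ss by simp
    ultimately show ?thesis
      by simp
  qed
  ultimately show ?thesis
    unfolding sim_def using \<theta> by blast
qed

end

section \<open>Smooth functions\<close>

lemma Ck_on_subset: "Ck_on k f S \<Longrightarrow> T \<subseteq> S \<Longrightarrow> Ck_on k f T"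
proof (induction k arbitrary: f)
  case 0
  then show ?case
    by (simp add: continuous_on_subset)
next
  case (Suc k)
  then obtain D where "\<forall>x\<in>S. (f has_derivative D x) (at x)" "\<forall>v. Ck_on k (\<lambda>x. D x v) S"
    by auto
  then show ?case
    using Suc by (auto intro!: exI[of _ D])
qed

lemma Ck_on_cong: "Ck_on k f S \<Longrightarrow> open S \<Longrightarrow> (\<And>x. x \<in> S \<Longrightarrow> f x = g x) \<Longrightarrow> Ck_on k g S"
proof (cases k)
  case 0
  then show "Ck_on k f S \<Longrightarrow> (\<And>x. x \<in> S \<Longrightarrow> f x = g x) \<Longrightarrow> Ck_on k g S"
    by (simp cong: continuous_on_cong_simp)
next
  case (Suc k')
  assume "Ck_on k f S" and S: "open S" and eq: "\<And>x. x \<in> S \<Longrightarrow> f x = g x"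
  then obtain D where D: "\<forall>x\<in>S. (f has_derivative D x) (at x)" "\<forall>v. Ck_on k' (\<lambda>x. D x v) S"
    using Suc by auto
  have "(g has_derivative D x) (at x)" if "x \<in> S" for x
    using has_derivative_transform_within_open[OF _ S that, of f "D x" UNIV g] D that eq by simp
  then show "Ck_on k g S"
    using Suc D by auto
qed

text \<open>The recursion at \<open>Suc k\<close> speaks only of derivatives, so the lower orders
  are recovered by induction; the product rule relies on them.\<close>

lemma Ck_on_Suc_imp: "Ck_on (Suc k) f S \<Longrightarrow> Ck_on k f S"
proof (induction k arbitrary: f)
  case 0
  then obtain D where "\<forall>x\<in>S. (f has_derivative D x) (at x)"
    by auto
  then have "\<forall>x\<in>S. continuous (at x) f"
    using has_derivative_continuous by blast
  then show ?case
    by (simp add: continuous_at_imp_continuous_on)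
next
  case (Suc k)
  then obtain D where "\<forall>x\<in>S. (f has_derivative D x) (at x)" "\<forall>v. Ck_on (Suc k) (\<lambda>x. D x v) S"
    by (auto simp del: Ck_on.simps simp: Ck_on.simps(2)[of "Suc k"])
  then show ?case
    using Suc.IH by (auto simp del: Ck_on.simps simp: Ck_on.simps(2)[of k])
qed

lemma Ck_on_const: "Ck_on k (\<lambda>x. c) S"
proof (induction k arbitrary: c)
  case (Suc k)
  then show ?case
    by (auto intro!: exI[of _ "\<lambda>x v. 0"])
qed simp

lemma Ck_on_vec: "(\<And>i. Ck_on k (\<lambda>x. f x $ i) S) \<Longrightarrow> Ck_on k f S"
  for f :: "'a::real_normed_vector \<Rightarrow> real^'n"
proof (induction k arbitrary: f)
  case 0
  then have "continuous_on S (\<lambda>x. \<chi> i. f x $ i)"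
    by (intro continuous_on_vec_lambda) simp
  then show ?case
    by simp
next
  case (Suc k)
  then have "\<forall>i. \<exists>D. (\<forall>x\<in>S. ((\<lambda>x. f x $ i) has_derivative D x) (at x)) \<and> (\<forall>v. Ck_on k (\<lambda>x. D x v) S)"
    by simp
  then obtain D where D: "\<And>i x. x \<in> S \<Longrightarrow> ((\<lambda>x. f x $ i) has_derivative D i x) (at x)"
    "\<And>i v. Ck_on k (\<lambda>x. D i x v) S"
    by metis
  have "(f has_derivative (\<lambda>v. \<chi> i. D i x v)) (at x)" if "x \<in> S" for x
    unfolding has_derivative_componentwise_within[of f]
  proof
    fix b :: "real^'n" assume "b \<in> Basis"
    then obtain i where "b = axis i 1"
      by (auto simp: Basis_vec_def)
    then show "((\<lambda>x. f x \<bullet> b) has_derivative (\<lambda>v. (\<chi> i. D i x v) \<bullet> b)) (at x)"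
      using D(1)[OF that, of i] by (simp add: inner_axis)
  qed
  moreover have "Ck_on k (\<lambda>x. \<chi> i. D i x v) S" for v
    by (rule Suc.IH) (simp add: D(2))
  ultimately show ?case
    by (auto intro!: exI[of _ "\<lambda>x v. \<chi> i. D i x v"])
qed

lemma Ck_on_add: "Ck_on k f S \<Longrightarrow> Ck_on k g S \<Longrightarrow> Ck_on k (\<lambda>x. f x + g x) S"
proof (induction k arbitrary: f g)
  case 0
  then show ?case
    by (simp add: continuous_on_add)
next
  case (Suc k)
  obtain D where D: "\<forall>x\<in>S. (f has_derivative D x) (at x)" "\<forall>v. Ck_on k (\<lambda>x. D x v) S"
    using Suc.prems(1) by auto
  obtain D' where D': "\<forall>x\<in>S. (g has_derivative D' x) (at x)" "\<forall>v. Ck_on k (\<lambda>x. D' x v) S"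
    using Suc.prems(2) by auto
  have "\<forall>x\<in>S. ((\<lambda>x. f x + g x) has_derivative (\<lambda>v. D x v + D' x v)) (at x)"
    using D D' by (auto intro: has_derivative_add)
  moreover have "\<forall>v. Ck_on k (\<lambda>x. D x v + D' x v) S"
    using D D' Suc.IH by blast
  ultimately show ?case
    by (auto intro!: exI[of _ "\<lambda>x v. D x v + D' x v"])
qed

lemma Ck_on_mult: "Ck_on k f S \<Longrightarrow> Ck_on k g S \<Longrightarrow> Ck_on k (\<lambda>x. f x * g x) S"
  for f g :: "'a::real_normed_vector \<Rightarrow> real"
proof (induction k arbitrary: f g)
  case 0
  then show ?case
    by (simp add: continuous_on_mult)
next
  case (Suc k)
  obtain D where D: "\<forall>x\<in>S. (f has_derivative D x) (at x)" "\<forall>v. Ck_on k (\<lambda>x. D x v) S"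
    using Suc.prems(1) by auto
  obtain D' where D': "\<forall>x\<in>S. (g has_derivative D' x) (at x)" "\<forall>v. Ck_on k (\<lambda>x. D' x v) S"
    using Suc.prems(2) by auto
  have fg: "Ck_on k f S" "Ck_on k g S"
    using Suc.prems by (auto intro: Ck_on_Suc_imp simp del: Ck_on.simps)
  have "\<forall>x\<in>S. ((\<lambda>x. f x * g x) has_derivative (\<lambda>v. f x * D' x v + D x v * g x)) (at x)"
    using D D' by (auto intro: has_derivative_mult)
  moreover have "\<forall>v. Ck_on k (\<lambda>x. f x * D' x v + D x v * g x) S"
    using D D' Suc.IH fg by (intro allI Ck_on_add) auto
  ultimately show ?case
    by (auto intro!: exI[of _ "\<lambda>x v. f x * D' x v + D x v * g x"])
qed

lemma Ck_on_prod: "(\<And>a. a \<in> A \<Longrightarrow> Ck_on k (f a) S) \<Longrightarrow> Ck_on k (\<lambda>x. \<Prod>a\<in>A. f a x) S"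
  for f :: "'b \<Rightarrow> 'a::real_normed_vector \<Rightarrow> real"
  by (induction A rule: infinite_finite_induct) (auto intro: Ck_on_const Ck_on_mult)

lemma Ck_on_component: "Ck_on k (\<lambda>x :: real^'n. x $ i) S"
proof (cases k)
  case 0
  then show ?thesis
    by (auto intro!: continuous_intros)
next
  case (Suc k')
  have "((\<lambda>x :: real^'n. x $ i) has_derivative (\<lambda>v. v $ i)) (at x)" for x
    by (rule bounded_linear_imp_has_derivative[OF bounded_linear_vec_nth])
  then show ?thesis
    using Suc by (auto intro!: exI[of _ "\<lambda>x v. v $ i"] Ck_on_const)
qed

text \<open>The sign is locally constant off the hyperplane. Such signs occur in the transition maps
  of the model.\<close>

lemma Ck_on_sgn_component: "Ck_on k (\<lambda>x :: real^'n. sgn (x $ i)) {x. x $ i \<noteq> 0}"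
proof -
  have der: "((\<lambda>x :: real^'n. sgn (x $ i)) has_derivative (\<lambda>v. 0)) (at x)" if "x $ i \<noteq> 0" for x
  proof -
    let ?T = "{y :: real^'n. sgn (y $ i) = sgn (x $ i) \<and> y $ i \<noteq> 0}"
    have "?T = (if x $ i > 0 then {y. 0 < y $ i} else {y. y $ i < 0})"
      using that by (auto simp: sgn_if split: if_splits)
    then have "open ?T"
      by (auto intro!: open_Collect_less continuous_intros)
    then show ?thesis
      using that by (intro has_derivative_transform_within_open[OF has_derivative_const[of "sgn (x $ i)"]]) auto
  qed
  show ?thesis
  proof (cases k)
    case 0
    have "continuous (at x) (\<lambda>x :: real^'n. sgn (x $ i))" if "x $ i \<noteq> 0" for x
      using has_derivative_continuous[OF der[OF that]] .
    then show ?thesis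
      using 0 by (simp add: continuous_at_imp_continuous_on)
  next
    case (Suc k')
    then show ?thesis
      using der by (auto intro!: exI[of _ "\<lambda>x v. 0"] Ck_on_const)
  qed
qed

lemma Ck_on_inverse_component: "Ck_on k (\<lambda>x :: real^'n. inverse (x $ i)) {x. x $ i \<noteq> 0}"
proof (induction k)
  case 0
  then show ?case
    by (auto intro!: continuous_intros)
next
  case (Suc k)
  have "((\<lambda>x :: real^'n. inverse (x $ i)) has_derivative
      (\<lambda>v. - (inverse (x $ i) * v $ i * inverse (x $ i)))) (at x)" if "x $ i \<noteq> 0" for x
    using that by (intro Deriv.has_derivative_inverse bounded_linear_imp_has_derivative bounded_linear_vec_nth)
  moreover have "Ck_on k (\<lambda>x. (- (v $ i)) * (inverse (x $ i) * inverse (x $ i))) {x. x $ i \<noteq> 0}" for v :: "real^'n"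
    by (intro Ck_on_mult Ck_on_const Suc)
  then have "Ck_on k (\<lambda>x. - (inverse (x $ i) * v $ i * inverse (x $ i))) {x. x $ i \<noteq> 0}" for v :: "real^'n"
    by (simp add: algebra_simps)
  ultimately show ?case
    by (auto intro!: exI[of _ "\<lambda>x v. - (inverse (x $ i) * v $ i * inverse (x $ i))"])
qed

text \<open>A point is determined by the indices of the basic open sets containing it. This lets a
  model built in a Euclidean space be placed inside the given type.\<close>

lemma lepoll_real: "(UNIV :: 'b::{t2_space, second_countable_topology} set) \<lesssim> (UNIV :: real set)"
proof -
  obtain B :: "'b set set" where B: "countable B" "topological_basis B"
    using ex_countable_basis by blast
  define f where "f x = {n. x \<in> from_nat_into B n \<and> B \<noteq> {}}" for x
  have "x = y" if "f x = f y" for x y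
  proof (rule ccontr)
    assume "x \<noteq> y"
    then obtain U where U: "open U" "x \<in> U" "y \<notin> U"
      using t1_space by blast
    then obtain V where V: "V \<in> B" "x \<in> V" "V \<subseteq> U"
      using topological_basisE[OF B(2)] by metis
    then obtain n where "from_nat_into B n = V"
      using from_nat_into_surj[OF B(1)] by blast
    then have "n \<in> f x" "n \<notin> f y"
      using U V by (auto simp: f_def)
    then show False
      using that by simp
  qed
  then have "(UNIV :: 'b set) \<lesssim> (UNIV :: nat set set)"
    unfolding lepoll_def by (intro exI[of _ f]) (auto simp: inj_def)
  then show ?thesis
    using nat_sets_eqpoll_reals lepoll_trans2 by blast
qed

lemma second_countable_euclidean: "second_countable (euclidean :: 'b::second_countable_topology topology)"
proof -
  obtain B :: "'b set set" where B: "countable B" "topological_basis B"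
    using ex_countable_basis by blast
  have "\<exists>U\<in>B. x \<in> U \<and> U \<subseteq> V" if "open V" "x \<in> V" for V x
    using topological_basisE[OF B(2) that] by metis
  then show ?thesis
    unfolding second_countable_def using B topological_basis_open[OF B(2)]
    by (intro exI[of _ B]) simp
qed

section \<open>The model of a small cover\<close>

text \<open>The characters of the group, indexed by sets of coordinates; \<open>bsign\<close> turns
  their values into signs.\<close>

definition dot :: "'n set \<Rightarrow> bit^'n \<Rightarrow> bit"
  where "dot K h = (\<Sum>i\<in>K. h $ i)"

definition bsign :: "bit \<Rightarrow> real"
  where "bsign b = (if b = 1 then - 1 else 1)"

lemma dot_add: "dot K (g + h) = dot K g + dot K h"
  by (simp add: dot_def sum.distrib)

lemma dot_0 [simp]: "dot K 0 = 0"
  by (simp add: dot_def)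

lemma dot_sum: "dot K (sum f A) = (\<Sum>a\<in>A. dot K (f a))"
  by (induction A rule: infinite_finite_induct) (simp_all add: dot_add)

lemma bsign_add: "bsign (a + b) = bsign a * bsign b"
  by (cases a; cases b) (simp_all add: bsign_def)

lemma bsign_0 [simp]: "bsign 0 = 1"
  by (simp add: bsign_def)

lemma bsign_sum: "bsign (sum f A) = (\<Prod>a\<in>A. bsign (f a))"
  by (induction A rule: infinite_finite_induct) (simp_all add: bsign_add)

lemma bsign_neq_0 [simp]: "bsign b \<noteq> 0"
  by (simp add: bsign_def)

lemma bsign_eq_1_iff [simp]: "bsign b = 1 \<longleftrightarrow> b = 0"
  by (cases b) (simp_all add: bsign_def)

lemma abs_bsign [simp]: "\<bar>bsign b\<bar> = 1"
  by (simp add: bsign_def)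

lemma sign_change_eq_bsign: "sign_change g x = (\<chi> i. bsign (g $ i) * x $ i)"
  by (simp add: sign_change_def bsign_def vec_eq_iff)

lemma bsign_dot_comb: "bsign (dot K (comb B x)) = (\<Prod>j | dot K (B j) = 1. bsign (x $ j))"
proof -
  have "bsign (dot K (comb B x)) = (\<Prod>j | x $ j = 1. bsign (dot K (B j)))"
    by (simp add: comb_eq_sum dot_sum bsign_sum)
  also have "\<dots> = (\<Prod>j | x $ j = 1 \<and> dot K (B j) = 1. - 1)"
    by (intro prod.mono_neutral_cong_right) (auto simp: bsign_def)
  also have "\<dots> = (\<Prod>j | dot K (B j) = 1. bsign (x $ j))"
    by (intro prod.mono_neutral_cong_left) (auto simp: bsign_def)
  finally show ?thesis .
qed

text \<open>
  The small cover with characteristic function \<open>\<kappa>\<close> is realized as a compact subset of a Euclidean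
  space: the class of \<open>(p, g)\<close> is sent to \<open>p\<close> together with, for each character \<open>dot K\<close>, the
  product of \<open>bsign (dot K g)\<close> and the barycentric coordinates of \<open>p\<close> for the facets on which the
  character is nontrivial.  These products vanish exactly where the character is not well defined
  on the class.
\<close>

locale small_cover_model = simplices m \<omega> E for m \<omega> and E :: "nat \<times> nat \<Rightarrow> 'n::finite" +
  fixes \<kappa> :: "nat \<times> nat \<Rightarrow> bit^'n"
  assumes ns: "nonsing \<kappa>"
begin

definition odd_facets :: "'n set \<Rightarrow> (nat \<times> nat) set"
  where "odd_facets K = {f \<in> facets. dot K (\<kappa> f) = 1}"

definition point :: "real^'n \<Rightarrow> bit^'n \<Rightarrow> (real^'n) \<times> (real^('n set))"
  where "point p g = (p, \<chi> K. bsign (dot K g) * (\<Prod>f\<in>odd_facets K. bary f p))"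

definition carr :: "((real^'n) \<times> (real^('n set))) set"
  where "carr = {point p g | p g. p \<in> polytope}"

definition gact :: "bit^'n \<Rightarrow> (real^'n) \<times> (real^('n set)) \<Rightarrow> (real^'n) \<times> (real^('n set))"
  where "gact h z = (fst z, \<chi> K. bsign (dot K h) * snd z $ K)"

lemma finite_odd_facets [simp]: "finite (odd_facets K)"
  by (simp add: odd_facets_def)

lemma fst_point [simp]: "fst (point p g) = p"
  by (simp add: point_def)

lemma snd_point [simp]: "snd (point p g) $ K = bsign (dot K g) * (\<Prod>f\<in>odd_facets K. bary f p)"
  by (simp add: point_def)

lemma carrE:
  assumes "z \<in> carr"
  obtains p g where "z = point p g" "p \<in> polytope"
  using assms by (auto simp: carr_def)

lemma point_in_carr: "p \<in> polytope \<Longrightarrow> point p g \<in> carr"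
  by (auto simp: carr_def)

lemma gact_point: "gact h (point p g) = point p (h + g)"
  by (simp add: gact_def point_def vec_eq_iff dot_add bsign_add)

lemma gact_in: "z \<in> carr \<Longrightarrow> gact h z \<in> carr"
  by (elim carrE) (simp add: gact_point point_in_carr)

lemma gact_0: "gact 0 z = z"
  by (simp add: gact_def prod_eq_iff vec_eq_iff)

lemma gact_add: "gact (g + h) z = gact g (gact h z)"
  by (simp add: gact_def prod_eq_iff vec_eq_iff dot_add bsign_add)

lemma continuous_on_gact: "continuous_on S (gact h)"
  unfolding gact_def by (intro continuous_intros continuous_on_vec_lambda)

lemma compact_carr: "compact carr"
proof -
  have "carr = (\<Union>g. (\<lambda>p. point p g) ` polytope)"
    by (auto simp: carr_def)
  moreover have "continuous_on polytope (\<lambda>p. point p g)" for g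
    unfolding point_def by (intro continuous_intros continuous_on_vec_lambda)
  ultimately show ?thesis
    using compact_polytope by (auto intro!: compact_UN compact_continuous_image)
qed

section \<open>Charts of the model at the vertices\<close>

definition coords :: "(nat \<Rightarrow> nat) \<Rightarrow> bit^'n \<Rightarrow> bit^'n"
  where "coords c = inv (comb (\<lambda>j. \<kappa> (Fv c j)))"

text \<open>The character that reads off the \<open>j\<close>-th coordinate in the basis at the
  vertex \<open>c\<close>, hence the dual basis; see \<open>dot_dual\<close>.\<close>

definition dual :: "(nat \<Rightarrow> nat) \<Rightarrow> 'n \<Rightarrow> 'n set"
  where "dual c j = {i. coords c (axis i 1) $ j = 1}"

lemma aut_comb: "vertex c \<Longrightarrow> Z2_automorphism (comb (\<lambda>j. \<kappa> (Fv c j)))"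
  using ns by (simp add: Z2_automorphism_comb nonsing_def)

lemma aut_coords: "vertex c \<Longrightarrow> Z2_automorphism (coords c)"
  unfolding coords_def by (rule Z2_automorphism_inv[OF aut_comb])

lemma comb_coords: "vertex c \<Longrightarrow> comb (\<lambda>j. \<kappa> (Fv c j)) (coords c h) = h"
  using aut_comb[of c] by (simp add: coords_def Z2_automorphism_def bij_def surj_f_inv_f)

lemma coords_comb: "vertex c \<Longrightarrow> coords c (comb (\<lambda>j. \<kappa> (Fv c j)) x) = x"
  using aut_comb[of c] by (simp add: coords_def Z2_automorphism_def bij_def)

lemma coords_Fv: "vertex c \<Longrightarrow> coords c (\<kappa> (Fv c j)) = axis j 1"
  using coords_comb[of c "axis j 1"] by simp

lemma dot_dual: "vertex c \<Longrightarrow> dot (dual c j) h = coords c h $ j"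
proof -
  assume c: "vertex c"
  have "coords c h = (\<Sum>i | h $ i = 1. coords c (axis i 1))"
    using aut_coords[OF c] by (subst vec_bit_eq_sum[of h]) (simp add: Z2_automorphism_iff additive_sum)
  then have "coords c h $ j = (\<Sum>i | h $ i = 1. coords c (axis i 1) $ j)"
    by (simp add: sum_component)
  also have "\<dots> = (\<Sum>i | h $ i = 1 \<and> i \<in> dual c j. 1)"
    by (intro sum.mono_neutral_cong_right) (auto simp: dual_def)
  also have "\<dots> = (\<Sum>i\<in>dual c j. h $ i)"
    by (intro sum.mono_neutral_cong_left) auto
  finally show ?thesis
    by (simp add: dot_def)
qed

lemma dot_dual_Fv: "vertex c \<Longrightarrow> dot (dual c j) (\<kappa> (Fv c i)) = (if i = j then 1 else 0)"
  by (auto simp: dot_dual coords_Fv axis_def)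

text \<open>An entry of \<open>point p g\<close> is nonzero exactly when its character is trivial on
  the values of \<open>\<kappa>\<close> at the facets through \<open>p\<close>. So \<open>h\<close>
  fixes the point iff every character killing these values kills \<open>h\<close>, and the dual
  basis at a vertex of the face shows that such \<open>h\<close> lie in their span.\<close>

lemma stabilizer_point:
  assumes p: "p \<in> polytope"
  shows "gact h (point p g) = point p g \<longleftrightarrow> h \<in> subset_sums \<kappa> (zero_facets p)"
proof -
  have "gact h (point p g) = point p g \<longleftrightarrow> (\<forall>K. (\<forall>f\<in>zero_facets p. dot K (\<kappa> f) = 0) \<longrightarrow> dot K h = 0)"
  proof -
    have "(\<Prod>f\<in>odd_facets K. bary f p) \<noteq> 0 \<longleftrightarrow> (\<forall>f\<in>zero_facets p. dot K (\<kappa> f) = 0)" for K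
      by (auto simp: odd_facets_def zero_facets_def simp del: bit_not_one_iff bit_not_zero_iff)
        (metis bit_not_one_iff)+
    moreover have "gact h (point p g) = point p g \<longleftrightarrow>
        (\<forall>K. dot K h = 0 \<or> (\<Prod>f\<in>odd_facets K. bary f p) = 0)"
      by (simp add: gact_def prod_eq_iff vec_eq_iff) blast
    ultimately show ?thesis
      by metis
  qed
  also have "\<dots> \<longleftrightarrow> h \<in> subset_sums \<kappa> (zero_facets p)"
  proof
    assume *: "\<forall>K. (\<forall>f\<in>zero_facets p. dot K (\<kappa> f) = 0) \<longrightarrow> dot K h = 0"
    obtain c where c: "vertex c" "\<And>v. (v, c v) \<notin> zero_facets p"
      using face_set_vertex[OF face_set_zero_facets[OF p]] by blast
    have ZF: "zero_facets p \<subseteq> facets"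
      by (auto simp: zero_facets_def)
    have "Fv c j \<in> zero_facets p" if j: "coords c h $ j = 1" for j
    proof (rule ccontr)
      assume notin: "Fv c j \<notin> zero_facets p"
      have "dot (dual c j) (\<kappa> f) = 0" if f: "f \<in> zero_facets p" for f
      proof -
        obtain i where "f = Fv c i"
          using subset_range_Fv[OF c(1) ZF c(2)] f by blast
        then show ?thesis
          using f notin dot_dual_Fv[OF c(1), of j i] by auto
      qed
      then have "dot (dual c j) h = 0"
        using * by blast
      then show False
        using j by (simp add: dot_dual[OF c(1)])
    qed
    then show "h \<in> subset_sums \<kappa> (zero_facets p)"
      unfolding subset_sums_eq_comb_image[OF c(1) ZF c(2)]
      using comb_coords[OF c(1), of h] by (intro image_eqI[of _ _ "coords c h"]) auto
  next
    assume "h \<in> subset_sums \<kappa> (zero_facets p)"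
    then obtain A where A: "A \<subseteq> zero_facets p" "h = sum \<kappa> A"
      by (auto simp: subset_sums_def)
    show "\<forall>K. (\<forall>f\<in>zero_facets p. dot K (\<kappa> f) = 0) \<longrightarrow> dot K h = 0"
      using A by (auto simp: dot_sum intro!: sum.neutral)
  qed
  finally show ?thesis .
qed

text \<open>The points over the union of the open faces whose closure contains the vertex
  \<open>c\<close>.\<close>

definition dom :: "(nat \<Rightarrow> nat) \<Rightarrow> ((real^'n) \<times> (real^('n set))) set"
  where "dom c = {z \<in> carr. \<forall>v\<in>{1..m}. 0 < bary (v, c v) (fst z)}"

definition den :: "(nat \<Rightarrow> nat) \<Rightarrow> 'n \<Rightarrow> (nat \<times> nat) set"
  where "den c j = odd_facets (dual c j) - {Fv c j}"

text \<open>Up to sign the \<open>j\<close>-th entry is the ratio of the barycentric coordinates of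
  \<open>Fv c j\<close> and of the facet of the same block missing the vertex, see
  \<open>chart_point\<close>. The other odd facets of \<open>dual c j\<close> all miss the vertex,
  so the product over \<open>den c j\<close> is positive on \<open>dom c\<close> and can be divided
  out.\<close>

definition chart :: "(nat \<Rightarrow> nat) \<Rightarrow> (real^'n) \<times> (real^('n set)) \<Rightarrow> real^'n"
  where "chart c z = (\<chi> j. snd z $ dual c j /
    ((\<Prod>f\<in>den c j. bary f (fst z)) * bary (blk j, c (blk j)) (fst z)))"

text \<open>
  Homogeneous coordinates: the facets \<open>(v, c v)\<close> missing the vertex \<open>c\<close> get the value \<open>1\<close>, the
  others get the signed coordinates \<open>y\<close>.
\<close>

definition hcoord :: "(nat \<Rightarrow> nat) \<Rightarrow> real^'n \<Rightarrow> nat \<times> nat \<Rightarrow> real"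
  where "hcoord c y f = (if snd f = c (fst f) then 1
    else y $ E (fst f, if snd f = 0 then c (fst f) else snd f))"

definition mass :: "(nat \<Rightarrow> nat) \<Rightarrow> real^'n \<Rightarrow> nat \<Rightarrow> real"
  where "mass c y v = (\<Sum>i\<le>\<omega> v. \<bar>hcoord c y (v, i)\<bar>)"

definition base :: "(nat \<Rightarrow> nat) \<Rightarrow> real^'n \<Rightarrow> real^'n"
  where "base c y = (\<chi> j. \<bar>hcoord c y (blk j, idx j)\<bar> / mass c y (blk j))"

text \<open>The inverse of \<open>chart c\<close>: normalized absolute values of the homogeneous
  coordinates give the point of the polytope, and the products keep the signs.\<close>

definition param :: "(nat \<Rightarrow> nat) \<Rightarrow> real^'n \<Rightarrow> (real^'n) \<times> (real^('n set))"
  where "param c y = (base c y, \<chi> K. \<Prod>f\<in>odd_facets K. hcoord c y f / mass c y (fst f))"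

lemma hcoord_vertex [simp]: "hcoord c y (v, c v) = 1"
  by (simp add: hcoord_def)

lemma hcoord_Fv: "vertex c \<Longrightarrow> hcoord c y (Fv c j) = y $ j"
  using blk_idx[of j] by (auto simp: hcoord_def Fv_def)

lemma facet_cases:
  assumes "vertex c" "f \<in> facets"
  obtains (vertex) v where "v \<in> {1..m}" "f = (v, c v)" | (coord) j where "f = Fv c j"
proof (cases "snd f = c (fst f)")
  case True
  then show ?thesis
    using assms vertex[of "fst f"] by (cases f) auto
next
  case False
  then have "f \<in> range (Fv c)"
    using assms range_Fv by auto
  then show ?thesis
    using coord by blast
qed

lemma mass_pos:
  assumes "vertex c" "v \<in> {1..m}"
  shows "0 < mass c y v"
proof -
  have "\<bar>hcoord c y (v, c v)\<bar> \<le> mass c y v"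
    unfolding mass_def using assms by (intro member_le_sum) (auto simp: vertex_def)
  then show ?thesis
    by simp
qed

lemma bary_base:
  assumes c: "vertex c" and f: "f \<in> facets"
  shows "bary f (base c y) = \<bar>hcoord c y f\<bar> / mass c y (fst f)"
proof -
  obtain v i where vi: "f = (v, i)" "v \<in> {1..m}" "i \<le> \<omega> v"
    using f by (cases f) auto
  have s: "0 < mass c y v"
    using mass_pos[OF c vi(2)] .
  show ?thesis
  proof (cases "i = 0")
    case True
    have "(\<Sum>t=1..\<omega> v. base c y $ E (v, t)) = (\<Sum>t=1..\<omega> v. \<bar>hcoord c y (v, t)\<bar>) / mass c y v"
      using vi by (simp add: base_def sum_divide_distrib)
    moreover have "mass c y v = \<bar>hcoord c y (v, 0)\<bar> + (\<Sum>t=1..\<omega> v. \<bar>hcoord c y (v, t)\<bar>)"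
      by (simp add: mass_def atMost_atLeast0 sum.atLeast_Suc_atMost)
    ultimately show ?thesis
      using s True by (simp add: vi bary_def field_simps)
  next
    case False
    then show ?thesis
      using vi by (simp add: bary_def base_def)
  qed
qed

lemma base_in_polytope: "vertex c \<Longrightarrow> base c y \<in> polytope"
  using mass_pos by (auto simp: polytope_def bary_base less_imp_le)

lemma prod_odd_facets:
  fixes F :: "nat \<times> nat \<Rightarrow> real"
  assumes c: "vertex c" and F: "\<And>v. v \<in> {1..m} \<Longrightarrow> F (v, c v) = 1"
  shows "(\<Prod>f\<in>odd_facets K. F f) = (\<Prod>j | dot K (\<kappa> (Fv c j)) = 1. F (Fv c j))"
proof -
  let ?J = "{j. dot K (\<kappa> (Fv c j)) = 1}"
  have "(\<Prod>f\<in>odd_facets K. F f) = (\<Prod>f\<in>Fv c ` ?J. F f)"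
  proof (rule prod.mono_neutral_right)
    show "Fv c ` ?J \<subseteq> odd_facets K"
      using Fv_in_facets[OF c] by (auto simp: odd_facets_def)
    show "\<forall>f\<in>odd_facets K - Fv c ` ?J. F f = 1"
    proof
      fix f assume f: "f \<in> odd_facets K - Fv c ` ?J"
      then have "f \<in> facets"
        by (simp add: odd_facets_def)
      with c show "F f = 1"
      proof (cases rule: facet_cases)
        case (vertex v)
        then show ?thesis
          using F by simp
      next
        case (coord j)
        then show ?thesis
          using f by (auto simp: odd_facets_def)
      qed
    qed
  qed simp
  also have "\<dots> = (\<Prod>j\<in>?J. F (Fv c j))"
    using inj_Fv[OF c] by (subst prod.reindex) (auto simp: inj_on_def)
  finally show ?thesis .
qed

text \<open>The group element records the signs of \<open>y\<close> in the basis at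
  \<open>c\<close>, which shows that the parametrization stays in the carrier.\<close>

lemma param_eq_point:
  assumes c: "vertex c"
  shows "param c y = point (base c y) (comb (\<lambda>j. \<kappa> (Fv c j)) (\<chi> j. if y $ j < 0 then 1 else 0))"
proof -
  let ?x = "(\<chi> j. if y $ j < 0 then 1 else 0) :: bit^'n"
  let ?e = "\<lambda>f. if hcoord c y f < 0 then - 1 else 1 :: real"
  have "bsign (dot K (comb (\<lambda>j. \<kappa> (Fv c j)) ?x)) = (\<Prod>f\<in>odd_facets K. ?e f)" for K
  proof -
    have "(\<Prod>f\<in>odd_facets K. ?e f) = (\<Prod>j | dot K (\<kappa> (Fv c j)) = 1. ?e (Fv c j))"
      by (rule prod_odd_facets[OF c]) simp
    moreover have "bsign (if b then 1 else 0) = (if b then - 1 else 1)" for b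
      by (simp add: bsign_def)
    ultimately show ?thesis
      by (simp add: bsign_dot_comb hcoord_Fv[OF c])
  qed
  moreover have "(\<Prod>f\<in>odd_facets K. hcoord c y f / mass c y (fst f)) =
      (\<Prod>f\<in>odd_facets K. ?e f) * (\<Prod>f\<in>odd_facets K. bary f (base c y))" for K
    unfolding prod.distrib[symmetric]
    by (intro prod.cong) (auto simp: odd_facets_def bary_base[OF c])
  ultimately show ?thesis
    by (simp add: param_def point_def vec_eq_iff)
qed

lemma fst_param [simp]: "fst (param c y) = base c y"
  by (simp add: param_def)

lemma snd_param [simp]: "snd (param c y) $ K = (\<Prod>f\<in>odd_facets K. hcoord c y f / mass c y (fst f))"
  by (simp add: param_def)

lemma vertex_facet: "vertex c \<Longrightarrow> v \<in> {1..m} \<Longrightarrow> (v, c v) \<in> facets"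
  by (simp add: vertex_def)

lemma param_in_dom: "vertex c \<Longrightarrow> param c y \<in> dom c"
  using point_in_carr[OF base_in_polytope] mass_pos
  by (auto simp: dom_def bary_base vertex_def) (simp add: param_eq_point vertex_def)

lemma odd_facets_dual: "vertex c \<Longrightarrow> odd_facets (dual c j) = insert (Fv c j) (den c j)"
  using Fv_in_facets[of c j] by (auto simp: den_def odd_facets_def dot_dual_Fv)

lemma finite_den [simp]: "finite (den c j)"
  by (simp add: den_def)

lemma Fv_notin_den [simp]: "Fv c j \<notin> den c j"
  by (simp add: den_def)

lemma den_vertex:
  assumes c: "vertex c" and f: "f \<in> den c j"
  obtains v where "v \<in> {1..m}" "f = (v, c v)"
proof -
  have "f \<in> facets" "dot (dual c j) (\<kappa> f) = 1" "f \<noteq> Fv c j"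
    using f by (auto simp: den_def odd_facets_def)
  with c show ?thesis
    using that by (cases rule: facet_cases) (auto simp: dot_dual_Fv[OF c] split: if_splits)
qed

lemma prod_dual: "vertex c \<Longrightarrow> (\<Prod>f\<in>odd_facets (dual c j). F f) = F (Fv c j) * (\<Prod>f\<in>den c j. F f)"
  for F :: "nat \<times> nat \<Rightarrow> real"
  by (simp add: odd_facets_dual)

lemma prod_den_pos:
  assumes c: "vertex c" and z: "z \<in> dom c"
  shows "0 < (\<Prod>f\<in>den c j. bary f (fst z))"
proof (rule prod_pos)
  fix f assume "f \<in> den c j"
  then obtain v where "v \<in> {1..m}" "f = (v, c v)"
    by (rule den_vertex[OF c])
  then show "0 < bary f (fst z)"
    using z by (simp add: dom_def)
qed

lemma chart_point:
  assumes c: "vertex c" and z: "point p g \<in> dom c"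
  shows "chart c (point p g) $ j = bsign (coords c g $ j) * bary (Fv c j) p / bary (blk j, c (blk j)) p"
  using prod_den_pos[OF c z, of j] by (simp add: chart_def prod_dual[OF c] dot_dual[OF c] del: prod_zero_iff)

lemma chart_param:
  assumes c: "vertex c"
  shows "chart c (param c y) = y"
proof -
  have "chart c (param c y) $ j = y $ j" for j
  proof -
    have "(\<Prod>f\<in>den c j. hcoord c y f / mass c y (fst f)) = (\<Prod>f\<in>den c j. bary f (base c y))"
    proof (rule prod.cong[OF refl])
      fix f assume "f \<in> den c j"
      then obtain v where "v \<in> {1..m}" "f = (v, c v)"
        by (rule den_vertex[OF c])
      then show "hcoord c y f / mass c y (fst f) = bary f (base c y)"
        using bary_base[OF c vertex_facet[OF c]] by simp
    qed
    moreover have "bary (blk j, c (blk j)) (base c y) = 1 / mass c y (blk j)"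
      using bary_base[OF c vertex_facet[OF c blk_idx(1)]] by simp
    moreover have "0 < mass c y (blk j)"
      using mass_pos[OF c blk_idx(1)] .
    ultimately show ?thesis
      using prod_den_pos[OF c param_in_dom[OF c], of y j]
      by (simp add: chart_def prod_dual[OF c] hcoord_Fv[OF c] del: prod_zero_iff)
  qed
  then show ?thesis
    by (simp add: vec_eq_iff)
qed

text \<open>The homogeneous coordinates of a chart value are, up to signs \<open>\<epsilon>\<close>,
  barycentric coordinates divided by that of the facet missing the vertex. Their mass in a block is
  the reciprocal of this divisor, since barycentric coordinates sum to one. So normalizing returns
  the barycentric coordinates, and the product of the signs returns the character of
  \<open>g\<close>.\<close>

lemma param_chart:
  assumes c: "vertex c" and z: "z \<in> dom c"
  shows "param c (chart c z) = z"
proof -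
  obtain p g where pg: "z = point p g" "p \<in> polytope"
    using z by (auto simp: dom_def elim: carrE)
  define y where "y = chart c z"
  have pos: "0 < bary (v, c v) p" if "v \<in> {1..m}" for v
    using z that by (simp add: dom_def pg)
  define \<epsilon> where "\<epsilon> f = (if snd f = c (fst f) then 1 else bsign (coords c g $ E (fst f, if snd f = 0 then c (fst f) else snd f)))"
    for f :: "nat \<times> nat"
  have \<epsilon>_Fv: "\<epsilon> (Fv c j) = bsign (coords c g $ j)" for j
    using blk_idx[of j] by (auto simp: \<epsilon>_def Fv_def)
  have hcoord: "hcoord c y f = \<epsilon> f * bary f p / bary (fst f, c (fst f)) p" if f: "f \<in> facets" for f
    using c f
  proof (cases rule: facet_cases)
    case (vertex v)
    then show ?thesis
      using pos[of v] by (simp add: \<epsilon>_def)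
  next
    case (coord j)
    then show ?thesis
      using chart_point[OF c z[unfolded pg(1)], of j] by (simp add: hcoord_Fv[OF c] \<epsilon>_Fv y_def pg)
  qed
  have abs_\<epsilon>: "\<bar>\<epsilon> f\<bar> = 1" for f
    by (simp add: \<epsilon>_def)
  have mass: "mass c y v = 1 / bary (v, c v) p" if v: "v \<in> {1..m}" for v
  proof -
    have "mass c y v = (\<Sum>i\<le>\<omega> v. bary (v, i) p / bary (v, c v) p)"
      unfolding mass_def
    proof (rule sum.cong[OF refl])
      fix i assume "i \<in> {..\<omega> v}"
      then have f: "(v, i) \<in> facets"
        using v by simp
      show "\<bar>hcoord c y (v, i)\<bar> = bary (v, i) p / bary (v, c v) p"
        using bary_nonneg[OF pg(2) f] pos[OF v] by (simp add: hcoord[OF f] abs_mult abs_\<epsilon>)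
    qed
    then show ?thesis
      using bary_sum[OF v, of p] by (simp flip: sum_divide_distrib)
  qed
  have hcoord_mass: "hcoord c y f / mass c y (fst f) = \<epsilon> f * bary f p" if f: "f \<in> facets" for f
  proof -
    have v: "fst f \<in> {1..m}"
      using f by (cases f) auto
    show ?thesis
      using pos[OF v] by (simp add: hcoord[OF f] mass[OF v])
  qed
  have "base c y = p"
  proof (rule bary_eqI)
    fix f assume f: "f \<in> facets"
    then have v: "fst f \<in> {1..m}"
      by (cases f) auto
    have "bary f (base c y) = \<bar>hcoord c y f / mass c y (fst f)\<bar>"
      using bary_base[OF c f] mass_pos[OF c v, of y] by (simp add: abs_divide)
    then show "bary f (base c y) = bary f p"
      using hcoord_mass[OF f] bary_nonneg[OF pg(2) f] by (simp add: abs_mult abs_\<epsilon>)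
  qed
  moreover have "(\<Prod>f\<in>odd_facets K. hcoord c y f / mass c y (fst f)) =
      bsign (dot K g) * (\<Prod>f\<in>odd_facets K. bary f p)" for K
  proof -
    have "(\<Prod>f\<in>odd_facets K. hcoord c y f / mass c y (fst f)) = (\<Prod>f\<in>odd_facets K. \<epsilon> f * bary f p)"
      by (intro prod.cong refl hcoord_mass) (simp add: odd_facets_def)
    also have "\<dots> = (\<Prod>f\<in>odd_facets K. \<epsilon> f) * (\<Prod>f\<in>odd_facets K. bary f p)"
      by (rule prod.distrib)
    also have "(\<Prod>f\<in>odd_facets K. \<epsilon> f) = (\<Prod>j | dot K (\<kappa> (Fv c j)) = 1. \<epsilon> (Fv c j))"
      by (rule prod_odd_facets[OF c]) (simp add: \<epsilon>_def)
    also have "\<dots> = bsign (dot K g)"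
      using bsign_dot_comb[of K "\<lambda>j. \<kappa> (Fv c j)" "coords c g"] by (simp add: \<epsilon>_Fv comb_coords[OF c])
    finally show ?thesis .
  qed
  ultimately have "param c y = z"
    by (simp add: prod_eq_iff vec_eq_iff pg)
  then show ?thesis
    by (simp add: y_def)
qed

lemma continuous_on_chart:
  assumes c: "vertex c"
  shows "continuous_on (dom c) (chart c)"
  unfolding chart_def
proof (rule continuous_on_vec_lambda)
  fix j
  have "(\<Prod>f\<in>den c j. bary f (fst z)) * bary (blk j, c (blk j)) (fst z) \<noteq> 0" if z: "z \<in> dom c" for z
  proof -
    have "0 < bary (blk j, c (blk j)) (fst z)"
      using z blk_idx(1)[of j] by (simp add: dom_def)
    then show ?thesis
      using prod_den_pos[OF c z, of j] by (metis less_irrefl mult_pos_pos)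
  qed
  then show "continuous_on (dom c) (\<lambda>z. snd z $ dual c j /
      ((\<Prod>f\<in>den c j. bary f (fst z)) * bary (blk j, c (blk j)) (fst z)))"
    by (intro continuous_intros) auto
qed

lemma continuous_on_hcoord: "continuous_on S (\<lambda>y. hcoord c y f)"
  unfolding hcoord_def by (cases "snd f = c (fst f)") (auto intro!: continuous_intros)

lemma continuous_on_mass: "continuous_on S (\<lambda>y. mass c y v)"
  unfolding mass_def by (intro continuous_intros continuous_on_hcoord)

lemma continuous_on_param:
  assumes c: "vertex c"
  shows "continuous_on S (param c)"
proof -
  have base: "continuous_on S (base c)"
    unfolding base_def
  proof (rule continuous_on_vec_lambda)
    fix j
    have "mass c y (blk j) \<noteq> 0" for y
      using mass_pos[OF c blk_idx(1), of y j] by simp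
    then show "continuous_on S (\<lambda>y. \<bar>hcoord c y (blk j, idx j)\<bar> / mass c y (blk j))"
      by (intro continuous_intros continuous_on_hcoord continuous_on_mass) auto
  qed
  have "continuous_on S (\<lambda>y. hcoord c y f / mass c y (fst f))" if f: "f \<in> odd_facets K" for f K
  proof -
    have v: "fst f \<in> {1..m}"
      using f by (cases f) (auto simp: odd_facets_def)
    have "mass c y (fst f) \<noteq> 0" for y
      using mass_pos[OF c v, of y] by simp
    then show ?thesis
      by (intro continuous_intros continuous_on_hcoord continuous_on_mass) auto
  qed
  then show ?thesis
    unfolding param_def by (intro continuous_on_Pair base continuous_on_vec_lambda continuous_on_prod)
qed

lemma carr_covered:
  assumes z: "z \<in> carr"
  shows "\<exists>c. vertex c \<and> z \<in> dom c"
proof -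
  obtain p g where pg: "z = point p g" "p \<in> polytope"
    using z by (rule carrE)
  obtain c where c: "vertex c" "\<And>v. (v, c v) \<notin> zero_facets p"
    using face_set_vertex[OF face_set_zero_facets[OF pg(2)]] by blast
  have "0 < bary (v, c v) p" if v: "v \<in> {1..m}" for v
    using bary_nonneg[OF pg(2) vertex_facet[OF c(1) v]] c(2)[of v] vertex_facet[OF c(1) v]
    unfolding zero_facets_def by simp
  then show ?thesis
    using z c(1) pg by (auto simp: dom_def)
qed

lemma homeomorphic_chart:
  assumes c: "vertex c"
  shows "chart c ` dom c = UNIV" "inj_on (chart c) (dom c)"
proof -
  show "chart c ` dom c = UNIV"
    using chart_param[OF c] param_in_dom[OF c] by (metis surjI subset_UNIV image_eqI subsetI subset_antisym)
  show "inj_on (chart c) (dom c)"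
    by (rule inj_on_inverseI[where g = "param c"]) (rule param_chart[OF c])
qed

definition overlap :: "(nat \<Rightarrow> nat) \<Rightarrow> (nat \<Rightarrow> nat) \<Rightarrow> (real^'n) set"
  where "overlap c c' = {y. \<forall>v\<in>{1..m}. hcoord c y (v, c' v) \<noteq> 0}"

lemma param_in_dom_iff:
  assumes c: "vertex c" "vertex c'"
  shows "gact h (param c y) \<in> dom c' \<longleftrightarrow> y \<in> overlap c c'"
proof -
  have "param c y \<in> carr"
    using param_in_dom[OF c(1)] by (simp add: dom_def)
  then have "gact h (param c y) \<in> carr"
    by (rule gact_in)
  moreover have "fst (gact h (param c y)) = base c y"
    by (simp add: gact_def)
  moreover have "0 < bary (v, c' v) (base c y) \<longleftrightarrow> hcoord c y (v, c' v) \<noteq> 0" if v: "v \<in> {1..m}" for v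
    using bary_base[OF c(1) vertex_facet[OF c(2) v], of y] mass_pos[OF c(1) v, of y]
    by (simp add: zero_less_divide_iff)
  ultimately show ?thesis
    by (simp add: dom_def overlap_def)
qed

text \<open>The masses cancel, and what remains is a quotient of homogeneous coordinates times signs
  that are locally constant on the overlap. The element \<open>h\<close> is included so that one
  formula serves both the transition maps and the smoothness of the action.\<close>

lemma chart_transition:
  assumes c: "vertex c" "vertex c'" and y: "y \<in> overlap c c'"
  shows "chart c' (gact h (param c y)) $ j = bsign (dot (dual c' j) h) * (hcoord c y (Fv c' j) *
    (sgn (hcoord c y (blk j, c' (blk j))) * inverse (hcoord c y (blk j, c' (blk j))) *
     (\<Prod>f\<in>den c' j. sgn (hcoord c y f))))"
proof -
  let ?a = "hcoord c y (blk j, c' (blk j))"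
  let ?P = "\<Prod>f\<in>den c' j. hcoord c y f / mass c y (fst f)"
  let ?Q = "\<Prod>f\<in>den c' j. bary f (base c y)"
  have s: "0 < mass c y (blk j)"
    by (rule mass_pos[OF c(1) blk_idx(1)])
  have a: "?a \<noteq> 0"
    using y blk_idx(1)[of j] by (simp add: overlap_def)
  have e1: "?P / ?Q = (\<Prod>f\<in>den c' j. sgn (hcoord c y f))"
    unfolding prod_dividef[symmetric]
  proof (rule prod.cong[OF refl])
    fix f assume "f \<in> den c' j"
    then obtain v where v: "v \<in> {1..m}" "f = (v, c' v)"
      by (rule den_vertex[OF c(2)])
    then have "hcoord c y f \<noteq> 0"
      using y by (simp add: overlap_def)
    then show "hcoord c y f / mass c y (fst f) / bary f (base c y) = sgn (hcoord c y f)"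
      using bary_base[OF c(1) vertex_facet[OF c(2) v(1)], of y] mass_pos[OF c(1) v(1), of y] v
      by (simp add: sgn_if)
  qed
  have e2: "bary (blk j, c' (blk j)) (base c y) = \<bar>?a\<bar> / mass c y (blk j)"
    using bary_base[OF c(1) vertex_facet[OF c(2) blk_idx(1)[of j]], of y] by simp
  have e3: "inverse \<bar>?a\<bar> = sgn ?a * inverse ?a"
    using a by (simp add: sgn_if)
  have e4: "chart c' (gact h (param c y)) $ j = bsign (dot (dual c' j) h) *
      (hcoord c y (Fv c' j) / mass c y (blk j) * ?P) / (?Q * bary (blk j, c' (blk j)) (base c y))"
    by (simp add: chart_def gact_def prod_dual[OF c(2)] del: prod_dividef)
  have e5: "b * (x / r * P) / (Q * (A / r)) = b * (x * (inverse A * (P / Q)))" if "r \<noteq> 0" for b x r P Q A :: real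
    using that by (simp add: divide_simps)
  have "mass c y (blk j) \<noteq> 0"
    using s by simp
  from e5[OF this] show ?thesis
    by (simp only: e1 e2 e3 e4)
qed

lemma Ck_on_hcoord: "Ck_on k (\<lambda>y. hcoord c y f) S"
  unfolding hcoord_def
  by (cases "snd f = c (fst f)") (auto intro: Ck_on_const Ck_on_component simp del: Ck_on.simps)

lemma Ck_on_sgn_hcoord:
  assumes "S \<subseteq> {y. hcoord c y f \<noteq> 0}"
  shows "Ck_on k (\<lambda>y. sgn (hcoord c y f)) S"
  using assms unfolding hcoord_def
  by (cases "snd f = c (fst f)")
    (auto intro: Ck_on_const Ck_on_subset[OF Ck_on_sgn_component] simp del: Ck_on.simps)

lemma Ck_on_inverse_hcoord:
  assumes "S \<subseteq> {y. hcoord c y f \<noteq> 0}"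
  shows "Ck_on k (\<lambda>y. inverse (hcoord c y f)) S"
  using assms unfolding hcoord_def
  by (cases "snd f = c (fst f)")
    (auto intro: Ck_on_const Ck_on_subset[OF Ck_on_inverse_component] simp del: Ck_on.simps)

lemma open_overlap: "open (overlap c c')"
proof -
  have "overlap c c' = (\<Inter>v\<in>{1..m}. {y. hcoord c y (v, c' v) \<noteq> 0})"
    by (auto simp: overlap_def)
  then show ?thesis
    by (auto intro!: open_INT open_Collect_neq continuous_on_hcoord continuous_intros)
qed

lemma smooth_on_transition:
  assumes c: "vertex c" "vertex c'"
  shows "smooth_on (\<lambda>y. chart c' (gact h (param c y))) (overlap c c')"
  unfolding smooth_on_def
proof
  fix k
  have sub: "overlap c c' \<subseteq> {y. hcoord c y (v, c' v) \<noteq> 0}" if "v \<in> {1..m}" for v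
    using that by (auto simp: overlap_def)
  have "Ck_on k (\<lambda>y. chart c' (gact h (param c y)) $ j) (overlap c c')" for j
  proof (rule Ck_on_cong[OF _ open_overlap])
    show "Ck_on k (\<lambda>y. bsign (dot (dual c' j) h) * (hcoord c y (Fv c' j) *
      (sgn (hcoord c y (blk j, c' (blk j))) * inverse (hcoord c y (blk j, c' (blk j))) *
       (\<Prod>f\<in>den c' j. sgn (hcoord c y f))))) (overlap c c')"
    proof (intro Ck_on_mult Ck_on_const Ck_on_hcoord Ck_on_prod Ck_on_sgn_hcoord Ck_on_inverse_hcoord sub blk_idx(1))
      fix f assume "f \<in> den c' j"
      then obtain v where "v \<in> {1..m}" "f = (v, c' v)"
        by (rule den_vertex[OF c(2)])
      then show "overlap c c' \<subseteq> {y. hcoord c y f \<noteq> 0}"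
        using sub by simp
    qed
  qed (simp add: chart_transition[OF c])
  then show "Ck_on k (\<lambda>y. chart c' (gact h (param c y))) (overlap c c')"
    by (rule Ck_on_vec)
qed

text \<open>The carrier is moved along a map \<open>J\<close> into the type of the manifold,
  injective in all uses below. Each vertex contributes one chart, and it is onto the whole Euclidean
  space.\<close>

definition model :: "((real^'n) \<times> (real^('n set)) \<Rightarrow> 'a) \<Rightarrow> ('a, 'n) Z2_manifold"
  where "model J = \<lparr>mtop = pullback_topology (J ` carr) (inv J) euclidean,
    atlas = {(J ` dom c, chart c \<circ> inv J) | c. vertex c},
    act = \<lambda>g a. J (gact g (inv J a))\<rparr>"

context
  fixes J :: "(real^'n) \<times> (real^('n set)) \<Rightarrow> 'a"
  assumes J: "inj J"
begin

lemma inv_J [simp]: "inv J (J z) = z"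
  using J by simp

lemma topspace_model: "topspace (mtop (model J)) = J ` carr"
  by (simp add: model_def topspace_pullback_topology)

lemma act_model: "act (model J) g (J z) = J (gact g z)"
  by (simp add: model_def)

lemma homeomorphic_maps_model: "homeomorphic_maps (mtop (model J)) (top_of_set carr) (inv J) J"
proof -
  have "continuous_map (mtop (model J)) euclidean (id \<circ> inv J)"
    unfolding model_def Z2_manifold.simps by (intro continuous_map_pullback) simp
  then have "continuous_map (mtop (model J)) (top_of_set carr) (inv J)"
    by (intro continuous_map_into_subtopology) (auto simp: topspace_model)
  moreover have "continuous_map (top_of_set carr) (mtop (model J)) J"
    unfolding model_def Z2_manifold.simps
    by (intro continuous_map_pullback') (auto simp: comp_def)
  ultimately show ?thesis
    by (auto simp: homeomorphic_maps_def topspace_model)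
qed

lemma homeomorphic_space_model: "top_of_set carr homeomorphic_space mtop (model J)"
  using homeomorphic_maps_model homeomorphic_maps_sym homeomorphic_space_def by blast

lemma is_chart_model:
  assumes c: "vertex c"
  shows "is_chart (mtop (model J)) (J ` dom c, chart c \<circ> inv J)"
proof -
  have "open (\<Inter>v\<in>{1..m}. {z :: (real^'n) \<times> (real^('n set)). 0 < bary (v, c v) (fst z)})"
    by (intro open_INT ballI open_Collect_less continuous_intros) auto
  moreover have "J ` dom c = inv J -` (\<Inter>v\<in>{1..m}. {z. 0 < bary (v, c v) (fst z)}) \<inter> J ` carr"
    by (auto simp: dom_def)
  ultimately have op: "openin (mtop (model J)) (J ` dom c)"
    unfolding model_def Z2_manifold.simps openin_pullback_topology by auto
  have img: "(chart c \<circ> inv J) ` J ` dom c = UNIV"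
    using homeomorphic_chart(1)[OF c] by (simp add: image_image)
  have ci: "continuous_map (mtop (model J)) (top_of_set carr) (inv J)" and cJ: "continuous_map (top_of_set carr) (mtop (model J)) J"
    using homeomorphic_maps_model by (auto simp: homeomorphic_maps_def)
  have dc: "dom c \<subseteq> carr"
    by (auto simp: dom_def)
  have top: "topspace (subtopology (mtop (model J)) (J ` dom c)) = J ` dom c"
    using dc by (auto simp: topspace_model)
  have "continuous_map (subtopology (mtop (model J)) (J ` dom c)) (top_of_set (dom c)) (inv J)"
  proof -
    have "continuous_map (subtopology (mtop (model J)) (J ` dom c)) euclidean (inv J)"
      using continuous_map_from_subtopology[OF continuous_map_into_fulltopology[OF ci]] .
    then show ?thesis
      by (rule continuous_map_into_subtopology) (auto simp: topspace_model)
  qed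
  then have c1: "continuous_map (subtopology (mtop (model J)) (J ` dom c)) euclidean (chart c \<circ> inv J)"
    by (rule continuous_map_compose) (simp add: continuous_on_chart[OF c])
  have "continuous_map euclidean (top_of_set carr) (param c)"
    using param_in_dom[OF c] dc continuous_on_param[OF c]
    by (intro continuous_map_into_subtopology) auto
  then have "continuous_map euclidean (mtop (model J)) (J \<circ> param c)"
    by (rule continuous_map_compose[OF _ cJ])
  then have c2: "continuous_map euclidean (subtopology (mtop (model J)) (J ` dom c)) (J \<circ> param c)"
    by (rule continuous_map_into_subtopology) (use param_in_dom[OF c] in auto)
  have "homeomorphic_maps (subtopology (mtop (model J)) (J ` dom c)) euclidean (chart c \<circ> inv J) (J \<circ> param c)"
    unfolding homeomorphic_maps_def top using c1 c2 param_chart[OF c] chart_param[OF c] by auto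
  then have "homeomorphic_map (subtopology (mtop (model J)) (J ` dom c)) euclidean (chart c \<circ> inv J)"
    using homeomorphic_map_maps by blast
  then show ?thesis
    unfolding is_chart_def prod.case img using op by simp
qed

text \<open>Applied with \<open>h = 0\<close> to the identity, which gives the atlas, and with
  \<open>h = g\<close> to the action of \<open>g\<close>.\<close>

lemma smooth_in_charts_model:
  assumes f: "\<And>z. z \<in> carr \<Longrightarrow> f (J z) = J (gact h z)"
  shows "smooth_in_charts (atlas (model J)) (atlas (model J)) f"
proof -
  have "smooth_on (\<lambda>y. (chart c' \<circ> inv J) (f (inv_into (J ` dom c) (chart c \<circ> inv J) y)))
      ((chart c \<circ> inv J) ` {x \<in> J ` dom c. f x \<in> J ` dom c'})" if c: "vertex c" "vertex c'" for c c'
  proof -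
    have carr: "param c y \<in> carr" for y
      using param_in_dom[OF c(1)] by (simp add: dom_def)
    have "inj_on (chart c \<circ> inv J) (J ` dom c)"
      using homeomorphic_chart(2)[OF c(1)] by (auto simp: inj_on_def)
    then have inv: "inv_into (J ` dom c) (chart c \<circ> inv J) y = J (param c y)" for y
      using param_in_dom[OF c(1)] chart_param[OF c(1)] by (intro inv_into_f_eq) auto
    have "(chart c \<circ> inv J) ` {x \<in> J ` dom c. f x \<in> J ` dom c'} = overlap c c'"
    proof (intro equalityI subsetI)
      fix y assume "y \<in> (chart c \<circ> inv J) ` {x \<in> J ` dom c. f x \<in> J ` dom c'}"
      then obtain z where z: "z \<in> dom c" "f (J z) \<in> J ` dom c'" "y = chart c z"
        by auto
      then have "param c y = z"
        using param_chart[OF c(1)] by simp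
      moreover have "f (J z) = J (gact h z)"
        using z by (intro f) (simp add: dom_def)
      ultimately have "gact h (param c y) \<in> dom c'"
        using z(2) J by (simp add: inj_image_mem_iff)
      then show "y \<in> overlap c c'"
        using param_in_dom_iff[OF c] by simp
    next
      fix y assume "y \<in> overlap c c'"
      then have "f (J (param c y)) \<in> J ` dom c'"
        using param_in_dom_iff[OF c, of h y] f[OF carr] by simp
      then show "y \<in> (chart c \<circ> inv J) ` {x \<in> J ` dom c. f x \<in> J ` dom c'}"
        using param_in_dom[OF c(1), of y] chart_param[OF c(1), of y]
        by (intro image_eqI[of _ _ "J (param c y)"]) auto
    qed
    then show ?thesis
      using smooth_on_transition[OF c, of h] by (simp add: inv f[OF carr])
  qed
  then show ?thesis
    unfolding smooth_in_charts_def by (auto simp: model_def)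
qed

lemma smooth_atlas_model: "smooth_atlas (mtop (model J)) (atlas (model J))"
  unfolding smooth_atlas_def
proof (intro conjI ballI)
  fix ch assume "ch \<in> atlas (model J)"
  then show "is_chart (mtop (model J)) ch"
    using is_chart_model by (auto simp: model_def)
next
  have "(\<Union>c\<in>{c. vertex c}. dom c) = carr"
  proof (intro equalityI subsetI)
    fix z assume "z \<in> carr"
    then obtain c where "vertex c" "z \<in> dom c"
      using carr_covered by blast
    then show "z \<in> (\<Union>c\<in>{c. vertex c}. dom c)"
      by (intro UN_I) simp_all
  qed (auto simp: dom_def)
  then have "(\<Union>c\<in>{c. vertex c}. J ` dom c) = J ` carr"
    by (simp flip: image_UN)
  moreover have "(\<Union>(U, \<phi>)\<in>atlas (model J). U) = (\<Union>c\<in>{c. vertex c}. J ` dom c)"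
    by (auto simp: model_def)
  ultimately show "(\<Union>(U, \<phi>)\<in>atlas (model J). U) = topspace (mtop (model J))"
    by (simp add: topspace_model)
  show "smooth_in_charts (atlas (model J)) (atlas (model J)) (\<lambda>x. x)"
    by (rule smooth_in_charts_model[of _ 0]) (simp add: gact_0)
qed

lemma smooth_closed_manifold_model: "smooth_closed_manifold (mtop (model J)) (atlas (model J))"
  unfolding smooth_closed_manifold_def
proof (intro conjI smooth_atlas_model)
  show "Hausdorff_space (mtop (model J))"
    using homeomorphic_Hausdorff_space[OF homeomorphic_space_model]
    by (simp add: Hausdorff_space_subtopology)
  show "second_countable (mtop (model J))"
    using homeomorphic_space_second_countability[OF homeomorphic_space_model]
      second_countable_subtopology[OF second_countable_euclidean] by auto
  show "compact_space (mtop (model J))"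
    using homeomorphic_compact_space[OF homeomorphic_space_model] compact_carr
    by (simp add: compact_space_subtopology compactin_euclidean_iff)
qed

lemma smooth_Z2_action_model: "smooth_Z2_action (model J)"
  unfolding smooth_Z2_action_def
proof (intro conjI allI ballI)
  fix x assume "x \<in> topspace (mtop (model J))"
  then obtain z where z: "x = J z"
    by (auto simp: topspace_model)
  show "act (model J) 0 x = x"
    by (simp add: z act_model gact_0)
  show "act (model J) (g + h) x = act (model J) g (act (model J) h x)" for g h
    by (simp add: z act_model gact_add)
next
  fix g
  have ci: "continuous_map (mtop (model J)) (top_of_set carr) (inv J)" and cJ: "continuous_map (top_of_set carr) (mtop (model J)) J"
    using homeomorphic_maps_model by (auto simp: homeomorphic_maps_def)
  have "continuous_map (top_of_set carr) (top_of_set carr) (gact g)"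
    using gact_in continuous_on_gact by auto
  then have "continuous_map (mtop (model J)) (mtop (model J)) (J \<circ> (gact g \<circ> inv J))"
    by (rule continuous_map_compose[OF continuous_map_compose[OF ci] cJ])
  then show "continuous_map (mtop (model J)) (mtop (model J)) (act (model J) g)"
    by (simp add: model_def comp_def)
  show "smooth_in_charts (atlas (model J)) (atlas (model J)) (act (model J) g)"
    by (rule smooth_in_charts_model[of _ g]) (simp add: act_model)
qed

lemma chart_gact: "vertex c \<Longrightarrow> chart c (gact g z) = sign_change (coords c g) (chart c z)"
  by (simp add: chart_def gact_def sign_change_eq_bsign vec_eq_iff dot_dual)

lemma locally_standard_model: "locally_standard (model J)"
  unfolding locally_standard_def
proof
  fix x assume x: "x \<in> topspace (mtop (model J))"
  obtain c where c: "vertex c" "x \<in> J ` dom c"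
    using x carr_covered unfolding topspace_model by blast
  have "(J ` dom c, chart c \<circ> inv J) \<in> atlas (model J)"
    using c by (auto simp: model_def)
  then have at: "smooth_atlas (mtop (model J)) (insert (J ` dom c, chart c \<circ> inv J) (atlas (model J)))"
    using smooth_atlas_model by (simp add: insert_absorb)
  have "act (model J) g y \<in> J ` dom c \<and>
      (chart c \<circ> inv J) (act (model J) g y) = sign_change (coords c g) ((chart c \<circ> inv J) y)"
    if y: "y \<in> J ` dom c" for g y
  proof -
    obtain z where z: "y = J z" "z \<in> dom c"
      using y by auto
    have "gact g z \<in> dom c"
      using z gact_in by (auto simp: dom_def gact_def)
    then show ?thesis
      using z chart_gact[OF c(1)] by (simp add: act_model)
  qed
  then show "\<exists>U \<phi> \<theta>. x \<in> U \<and> smooth_atlas (mtop (model J)) (insert (U, \<phi>) (atlas (model J))) \<and>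
      Z2_automorphism \<theta> \<and>
      (\<forall>g. \<forall>y\<in>U. act (model J) g y \<in> U \<and> \<phi> (act (model J) g y) = sign_change (\<theta> g) (\<phi> y))"
    using c at aut_coords[OF c(1)] by blast
qed

lemma quotient_model: "quotient_map (mtop (model J)) (top_of_set polytope) (fst \<circ> inv J)"
proof (rule T1_Spaces.continuous_imp_quotient_map)
  have ci: "continuous_map (mtop (model J)) (top_of_set carr) (inv J)"
    using homeomorphic_maps_model by (auto simp: homeomorphic_maps_def)
  have "continuous_map (top_of_set carr) (top_of_set polytope) fst"
    by (auto intro!: continuous_intros elim!: carrE)
  then show "continuous_map (mtop (model J)) (top_of_set polytope) (fst \<circ> inv J)"
    by (rule continuous_map_compose[OF ci])
  show "compact_space (mtop (model J))"
    using smooth_closed_manifold_model by (simp add: smooth_closed_manifold_def)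
  show "Hausdorff_space (top_of_set polytope)"
    by (simp add: Hausdorff_space_subtopology)
  have "fst ` carr = polytope"
    by (force simp: carr_def)
  then show "(fst \<circ> inv J) ` topspace (mtop (model J)) = topspace (top_of_set polytope)"
    by (simp add: topspace_model image_image)
qed

lemma fibre_model:
  assumes "x \<in> topspace (mtop (model J))" "y \<in> topspace (mtop (model J))"
  shows "(fst \<circ> inv J) x = (fst \<circ> inv J) y \<longleftrightarrow> (\<exists>g. y = act (model J) g x)"
proof -
  obtain p g where x: "x = J (point p g)"
    using assms(1) by (auto simp: topspace_model elim: carrE)
  obtain q h where y: "y = J (point q h)"
    using assms(2) by (auto simp: topspace_model elim: carrE)
  have "p = q \<longleftrightarrow> (\<exists>k. J (point q h) = J (point p (k + g)))"
  proof
    assume "p = q"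
    then have "J (point q h) = J (point p ((h + g) + g))"
      by (simp add: add.assoc)
    then show "\<exists>k. J (point q h) = J (point p (k + g))"
      by blast
  next
    assume "\<exists>k. J (point q h) = J (point p (k + g))"
    then obtain k where "point q h = point p (k + g)"
      using J by (auto dest: injD)
    then show "p = q"
      by (metis fst_point)
  qed
  then show ?thesis
    by (simp add: x y act_model gact_point)
qed

lemma stabilizer_model:
  assumes "x \<in> topspace (mtop (model J))"
  shows "{g. act (model J) g x = x} = subset_sums \<kappa> (zero_facets ((fst \<circ> inv J) x))"
proof -
  obtain p g where x: "x = J (point p g)" "p \<in> polytope"
    using assms by (auto simp: topspace_model elim: carrE)
  have "act (model J) h x = x \<longleftrightarrow> gact h (point p g) = point p g" for h
    using J by (simp add: x act_model inj_eq)
  then show ?thesis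
    using stabilizer_point[OF x(2)] by (simp add: x)
qed

lemma card_stabilizer_model:
  assumes "x \<in> topspace (mtop (model J))"
  shows "card {g. act (model J) g x = x} = 2 ^ card (zero_facets ((fst \<circ> inv J) x))"
proof -
  have "(fst \<circ> inv J) x \<in> polytope"
    using quotient_imp_surjective_map[OF quotient_model] assms by auto
  then obtain c where "vertex c" "\<And>v. (v, c v) \<notin> zero_facets ((fst \<circ> inv J) x)"
    using face_set_vertex[OF face_set_zero_facets] by blast
  moreover have "zero_facets ((fst \<circ> inv J) x) \<subseteq> facets"
    by (auto simp: zero_facets_def)
  ultimately show ?thesis
    unfolding stabilizer_model[OF assms] using card_subset_sums[OF ns] by blast
qed

lemma small_cover_model: "small_cover polytope (model J)"
  unfolding small_cover_def orbit_space_is_def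
proof (intro conjI exI[of _ "fst \<circ> inv J"] ballI allI impI smooth_closed_manifold_model
    smooth_Z2_action_model locally_standard_model quotient_model)
  fix x assume x: "x \<in> topspace (mtop (model J))"
  show "(fst \<circ> inv J) x = (fst \<circ> inv J) y \<longleftrightarrow> (\<exists>g. y = act (model J) g x)"
    if "y \<in> topspace (mtop (model J))" for y
    by (rule fibre_model[OF x that])
  fix F assume F: "F face_of polytope \<and> (fst \<circ> inv J) x \<in> rel_interior F"
  let ?p = "(fst \<circ> inv J) x"
  have p: "?p \<in> polytope"
    using quotient_imp_surjective_map[OF quotient_model] x by auto
  \<comment> \<open>Two faces whose relative interiors share a point coincide.\<close>
  have "F = {x \<in> polytope. \<forall>f\<in>zero_facets ?p. bary f x = 0}"
    using F face_at_point(1,2)[OF p] by (intro face_of_eq[of F polytope]) auto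
  then have "aff_dim F = int CARD('n) - int (card (zero_facets ?p))"
    using face_at_point(3)[OF p] by simp
  then show "card {g. act (model J) g x = x} = 2 ^ nat (aff_dim polytope - aff_dim F)"
    using card_stabilizer_model[OF x] by (simp add: aff_dim_polytope)
qed

end

end

section \<open>The bijection of classes\<close>

context simplices
begin

lemma has_char_realized:
  assumes \<kappa>: "nonsing \<kappa>" and card: "(UNIV :: real set) \<lesssim> (UNIV :: 'a set)"
  obtains M :: "('a, 'n) Z2_manifold" where "has_char M \<kappa>"
proof -
  interpret small_cover_model m \<omega> E \<kappa>
    by unfold_locales (rule \<kappa>)
  have "(UNIV :: ((real^'n) \<times> (real^('n set))) set) \<lesssim> (UNIV :: 'a set)"
    using lepoll_real card by (rule lepoll_trans)
  then obtain J :: "(real^'n) \<times> (real^('n set)) \<Rightarrow> 'a" where J: "inj J"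
    by (auto simp: lepoll_def)
  have "orbit_map m \<omega> E (model J) (fst \<circ> inv J)"
    by unfold_locales (fact small_cover_model[OF J] quotient_model[OF J] fibre_model[OF J]
        card_stabilizer_model[OF J])+
  then have "has_char (model J) \<kappa>"
    unfolding has_char_def using \<kappa> stabilizer_model[OF J] by blast
  then show ?thesis
    by (rule that)
qed

end

text \<open>Equivalence is assumed of \<open>s\<close> and passes to \<open>r\<close> through
  \<open>h\<close>. For small covers this replaces a direct proof that weakly equivariant
  homeomorphism is an equivalence relation.\<close>

lemma bij_betw_quotients:
  assumes h: "\<And>a. a \<in> A \<Longrightarrow> h a \<in> B" and r: "r \<subseteq> A \<times> A"
    and rs: "\<And>a a'. a \<in> A \<Longrightarrow> a' \<in> A \<Longrightarrow> (a, a') \<in> r \<longleftrightarrow> (h a, h a') \<in> s"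
    and s: "equiv B s" and surj: "\<And>b. b \<in> B \<Longrightarrow> \<exists>a\<in>A. (h a, b) \<in> s"
  shows "\<exists>F. bij_betw F (A // r) (B // s)"
proof -
  have refl: "(b, b) \<in> s" if "b \<in> B" for b
    using s that by (simp add: equiv_def refl_on_def)
  have sym: "(b, a) \<in> s" if "(a, b) \<in> s" for a b
    using s that by (meson equivE symE)
  have trans: "(a, c) \<in> s" if "(a, b) \<in> s" "(b, c) \<in> s" for a b c
    using s that by (meson equivE transE)
  define F where "F X = s `` (h ` X)" for X
  have F: "F (r `` {a}) = s `` {h a}" if a: "a \<in> A" for a
  proof (intro equalityI subsetI)
    fix b assume "b \<in> F (r `` {a})"
    then obtain a' where a': "(a, a') \<in> r" "(h a', b) \<in> s"
      by (auto simp: F_def)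
    then have "(h a, h a') \<in> s"
      using rs r by auto
    then show "b \<in> s `` {h a}"
      using a' trans by blast
  next
    fix b assume b: "b \<in> s `` {h a}"
    have "(a, a) \<in> r"
      using rs[OF a a] refl[OF h[OF a]] by simp
    then show "b \<in> F (r `` {a})"
      using b by (auto simp: F_def)
  qed
  have "bij_betw F (A // r) (B // s)"
  proof (rule bij_betw_imageI)
    show "inj_on F (A // r)"
    proof (rule inj_onI)
      fix X Y assume "X \<in> A // r" "Y \<in> A // r" and FXY: "F X = F Y"
      then obtain a a' where a: "a \<in> A" "X = r `` {a}" and a': "a' \<in> A" "Y = r `` {a'}"
        by (auto elim!: quotientE)
      have "s `` {h a} = s `` {h a'}"
        using FXY F a a' by simp
      then have haa': "(h a, h a') \<in> s"
        using refl[OF h[OF a'(1)]] by blast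
      have "(a, x) \<in> r \<longleftrightarrow> (a', x) \<in> r" for x
      proof (cases "x \<in> A")
        case True
        then show ?thesis
          using rs[OF a(1) True] rs[OF a'(1) True] haa' sym trans by blast
      next
        case False
        then show ?thesis
          using r by blast
      qed
      then show "X = Y"
        using a a' by auto
    qed
    show "F ` (A // r) = B // s"
    proof (intro equalityI subsetI)
      fix Z assume "Z \<in> F ` (A // r)"
      then obtain a where "a \<in> A" "Z = s `` {h a}"
        using F by (auto elim!: quotientE)
      then show "Z \<in> B // s"
        using h by (simp add: quotientI)
    next
      fix Z assume "Z \<in> B // s"
      then obtain b where b: "b \<in> B" "Z = s `` {b}"
        by (auto elim!: quotientE)
      then obtain a where a: "a \<in> A" "(h a, b) \<in> s"
        using surj by blast
      then have "Z = F (r `` {a})"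
        using F[OF a(1)] b equiv_class_eq[OF s a(2)] by simp
      then show "Z \<in> F ` (A // r)"
        using a by (simp add: quotientI)
    qed
  qed
  then show ?thesis
    by blast
qed

text \<open>\<open>R\<close> links a small cover to every digraph that represents one of its
  characteristic functions. Both equivalences are compared with \<open>sim\<close>, and one digraph
  is then chosen for each manifold.\<close>

lemma (in simplices) classes_bijection:
  assumes card: "(UNIV :: real set) \<lesssim> (UNIV :: 'a set)"
  shows "\<exists>F. bij_betw F (small_cover_classes polytope :: ('a, 'n) Z2_manifold set set) (digraph_classes m \<omega>)"
proof -
  let ?B = "acyclic_weighted_digraphs m \<omega>"
  define R :: "('a, 'n) Z2_manifold \<Rightarrow> weights \<Rightarrow> bool"
    where "R M W \<longleftrightarrow> W \<in> ?B \<and> (\<exists>\<kappa>. has_char M \<kappa> \<and> sim \<kappa> (dchar W))" for M W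
  have ex: "\<exists>W. R M W" if M: "small_cover polytope M" for M
  proof -
    obtain \<kappa> where \<kappa>: "has_char M \<kappa>"
      using M by (rule has_char_exists)
    then have "nonsing \<kappa>"
      by (simp add: has_char_def)
    then obtain W where "W \<in> ?B" "sim \<kappa> (dchar W)"
      by (rule nonsing_normal_form)
    then show ?thesis
      using \<kappa> unfolding R_def by blast
  qed
  have iff: "weakly_equivariantly_homeomorphic M M' \<longleftrightarrow> omega_equivalent m \<omega> W W'" if R: "R M W" "R M' W'" for M M' W W'
  proof -
    obtain \<kappa> \<kappa>' where k: "has_char M \<kappa>" "sim \<kappa> (dchar W)" "has_char M' \<kappa>'" "sim \<kappa>' (dchar W')"
      and W: "W \<in> ?B" "W' \<in> ?B"
      using R unfolding R_def by blast
    have "weakly_equivariantly_homeomorphic M M' \<longleftrightarrow> sim \<kappa> \<kappa>'"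
      using sim_imp_homeomorphic homeomorphic_imp_sim k by blast
    also have "\<dots> \<longleftrightarrow> sim (dchar W) (dchar W')"
      using k sim_sym sim_trans by blast
    also have "\<dots> \<longleftrightarrow> omega_equivalent m \<omega> W W'"
      by (rule omega_equivalent_iff_sim[OF W, symmetric])
    finally show ?thesis .
  qed
  define h where "h M = (SOME W. R M W)" for M :: "('a, 'n) Z2_manifold"
  have h: "R M (h M)" if "small_cover polytope M" for M
    unfolding h_def using ex[OF that] by (rule someI_ex)
  show ?thesis
    unfolding small_cover_classes_def digraph_classes_def
  proof (rule bij_betw_quotients[where h = h])
    fix M :: "('a, 'n) Z2_manifold" assume M: "M \<in> {M. small_cover polytope M}"
    then show "h M \<in> ?B"
      using h unfolding R_def by blast
  next
    fix M M' :: "('a, 'n) Z2_manifold" assume M: "M \<in> {M. small_cover polytope M}" "M' \<in> {M. small_cover polytope M}"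
    have "h M \<in> ?B" "h M' \<in> ?B"
      using M h unfolding R_def by blast+
    then show "(M, M') \<in> {(M, M'). small_cover polytope M \<and> small_cover polytope M' \<and> weakly_equivariantly_homeomorphic M M'} \<longleftrightarrow>
        (h M, h M') \<in> {(W, W'). W \<in> ?B \<and> W' \<in> ?B \<and> omega_equivalent m \<omega> W W'}"
      using iff[OF h h, of M M'] M by simp
  next
    show "equiv ?B {(W, W'). W \<in> ?B \<and> W' \<in> ?B \<and> omega_equivalent m \<omega> W W'}"
    proof (rule equivI)
      show "sym {(W, W'). W \<in> ?B \<and> W' \<in> ?B \<and> omega_equivalent m \<omega> W W'}"
        using omega_equivalent_iff_sim sim_sym by (auto simp: sym_def)
      show "trans {(W, W'). W \<in> ?B \<and> W' \<in> ?B \<and> omega_equivalent m \<omega> W W'}"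
        using omega_equivalent_iff_sim sim_trans unfolding trans_def by blast
      show "refl_on ?B {(W, W'). W \<in> ?B \<and> W' \<in> ?B \<and> omega_equivalent m \<omega> W W'}"
        by (simp add: refl_on_def omega_equivalent_def)
    qed auto
  next
    fix W assume W: "W \<in> ?B"
    obtain M :: "('a, 'n) Z2_manifold" where M: "has_char M (dchar W)"
      using nonsing_dchar[OF W] card by (rule has_char_realized)
    then have "R M W"
      unfolding R_def using W sim_refl by blast
    moreover have sc: "small_cover polytope M"
      using M by (rule has_char_imp_small_cover)
    ultimately have "omega_equivalent m \<omega> (h M) W"
      using iff[OF h[OF sc], of M W] iff[OF \<open>R M W\<close> \<open>R M W\<close>] by (simp add: omega_equivalent_def)
    then show "\<exists>M\<in>{M. small_cover polytope M}. (h M, W) \<in> {(W, W'). W \<in> ?B \<and> W' \<in> ?B \<and> omega_equivalent m \<omega> W W'}"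
      using sc W h[OF sc] unfolding R_def by blast
  qed auto
qed

text \<open>The pairs are numbered block by block, so the induction step appends the interval
  belonging to the last block.\<close>

lemma bij_betw_block_index:
  "bij_betw (\<lambda>(i, j). (\<Sum>\<alpha>=1..i-1. ms \<alpha>) + j) (SIGMA i:{1..l}. {1..ms i}) {1..\<Sum>i=1..l. ms i}"
  for ms :: "nat \<Rightarrow> nat"
proof (induction l)
  case (Suc l)
  let ?N = "\<lambda>(i, j). (\<Sum>\<alpha>=1..i-1. ms \<alpha>) + j"
  let ?S = "\<Sum>i=1..l. ms i"
  have "bij_betw ?N ({Suc l} \<times> {1..ms (Suc l)}) {?S + 1..?S + ms (Suc l)}"
    by (rule bij_betw_byWitness[where f' = "\<lambda>v. (Suc l, v - ?S)"]) auto
  then have "bij_betw ?N ((SIGMA i:{1..l}. {1..ms i}) \<union> {Suc l} \<times> {1..ms (Suc l)})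
      ({1..?S} \<union> {?S + 1..?S + ms (Suc l)})"
    by (intro bij_betw_combine[OF Suc]) auto
  moreover have "(SIGMA i:{1..l}. {1..ms i}) \<union> {Suc l} \<times> {1..ms (Suc l)} = (SIGMA i:{1..Suc l}. {1..ms i})"
    by (auto simp: le_Suc_eq)
  moreover have "{1..?S} \<union> {?S + 1..?S + ms (Suc l)} = {1..\<Sum>i=1..Suc l. ms i}"
    by auto
  ultimately show ?case
    by (simp only:)
qed (simp add: bij_betw_def)

theorem theorem4p8:
  fixes l m :: nat
    and ns ms \<omega> :: "nat \<Rightarrow> nat"
    and e :: "nat \<times> nat \<times> nat \<Rightarrow> 'n::finite"
    and P :: "(real^'n) set"
  assumes "1 \<le> l"
    and "1 \<le> ns 1"
    and "strict_mono_on {1..l} ns"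
    and "\<forall>i\<in>{1..l}. 1 \<le> ms i"
    and "CARD('n) = (\<Sum>i=1..l. ns i * ms i)"
    and "m = (\<Sum>i=1..l. ms i)"
    and "bij_betw e (coordinates l ns ms) UNIV"
    and "P = simplex_product l ns ms e"
    and "\<forall>i\<in>{1..l}. \<forall>j\<in>{1..ms i}. \<omega> ((\<Sum>\<alpha>=1..i-1. ms \<alpha>) + j) = ns i"
    and "(UNIV :: real set) \<lesssim> (UNIV :: 'a set)"
  shows "\<exists>F. bij_betw F
           (small_cover_classes P :: ('a, 'n) Z2_manifold set set)
           (digraph_classes m \<omega>)"
proof -
  let ?I = "SIGMA i:{1..l}. {1..ms i}"
  define N where "N = (\<lambda>(i, j). (\<Sum>\<alpha>=1..i-1. ms \<alpha>) + j)"
  define D where "D = inv_into ?I N"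
  have N: "bij_betw N ?I {1..m}"
    using bij_betw_block_index[of ms l] assms(6) by (simp only: N_def)
  have \<omega>N: "\<omega> (N (i, j)) = ns i" if "(i, j) \<in> ?I" for i j
    using that assms(9) by (simp add: N_def)
  have DN: "D (N (i, j)) = (i, j)" if "(i, j) \<in> ?I" for i j
    unfolding D_def by (rule bij_betw_inv_into_left[OF N that])
  have ND: "D v \<in> ?I" "N (D v) = v" if "v \<in> {1..m}" for v
    using bij_betw_inv_into_right[OF N that] bij_betwE[OF bij_betw_inv_into[OF N]] that by (auto simp: D_def)
  have N_in: "N (i, j) \<in> {1..m}" if "(i, j) \<in> ?I" for i j
    using bij_betwE[OF N] that by blast
  \<comment> \<open>A vertex \<open>v\<close> is decoded into the pair \<open>(i, j)\<close> naming
    its simplex, so that coordinates become indexed by vertices of the digraph.\<close>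
  define E where "E = (\<lambda>(v, t). e (fst (D v), snd (D v), t))"
  have EN: "E (N (i, j), t) = e (i, j, t)" if "(i, j) \<in> ?I" for i j t
    by (simp add: E_def DN[OF that])
  have \<omega>D: "\<omega> v = ns (fst (D v))" if v: "v \<in> {1..m}" for v
    using \<omega>N[of "fst (D v)" "snd (D v)"] ND[OF v] by simp
  have "bij_betw (\<lambda>(v, t). (fst (D v), snd (D v), t)) (SIGMA v:{1..m}. {1..\<omega> v}) (coordinates l ns ms)"
  proof (rule bij_betw_byWitness[where f' = "\<lambda>(i, j, t). (N (i, j), t)"])
    show "\<forall>x\<in>SIGMA v:{1..m}. {1..\<omega> v}. (case case x of (v, t) \<Rightarrow> (fst (D v), snd (D v), t) of (i, j, t) \<Rightarrow> (N (i, j), t)) = x"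
      using ND(2) by auto
    show "\<forall>x\<in>coordinates l ns ms. (case case x of (i, j, t) \<Rightarrow> (N (i, j), t) of (v, t) \<Rightarrow> (fst (D v), snd (D v), t)) = x"
      using DN by (auto simp: coordinates_def)
    show "(\<lambda>(v, t). (fst (D v), snd (D v), t)) ` (SIGMA v:{1..m}. {1..\<omega> v}) \<subseteq> coordinates l ns ms"
    proof clarify
      fix v t assume v: "v \<in> {1..m}" and t: "t \<in> {1..\<omega> v}"
      then show "(fst (D v), snd (D v), t) \<in> coordinates l ns ms"
        using ND(1)[OF v] \<omega>D[OF v] by (cases "D v") (simp add: coordinates_def)
    qed
    show "(\<lambda>(i, j, t). (N (i, j), t)) ` coordinates l ns ms \<subseteq> (SIGMA v:{1..m}. {1..\<omega> v})"
    proof clarify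
      fix i j t assume "(i, j, t) \<in> coordinates l ns ms"
      then have "(i, j) \<in> ?I" "t \<in> {1..ns i}"
        by (auto simp: coordinates_def)
      then show "N (i, j) \<in> {1..m} \<and> t \<in> {1..\<omega> (N (i, j))}"
        using N_in \<omega>N by simp
    qed
  qed
  from bij_betw_trans[OF this assms(7)] have bij_E: "bij_betw E (SIGMA v:{1..m}. {1..\<omega> v}) UNIV"
    by (simp add: E_def comp_def split_def)
  have ns_pos: "1 \<le> ns i" if "i \<in> {1..l}" for i
    using strict_mono_onD[OF assms(3), of 1 i] that assms(1,2) by (cases "i = 1") auto
  interpret simplices m \<omega> E
  proof unfold_locales
    fix v assume v: "v \<in> {1..m}"
    then show "1 \<le> \<omega> v"
      using ns_pos[of "fst (D v)"] ND(1)[OF v] \<omega>D[OF v] by (cases "D v") simp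
  qed (rule bij_E)
  \<comment> \<open>The inequality of the facet \<open>(v, 0)\<close> is the bound on the coordinate
    sum.\<close>
  have block: "(\<forall>i\<in>{0..\<omega> v}. 0 \<le> bary (v, i) x) \<longleftrightarrow>
      (\<forall>t\<in>{1..\<omega> v}. 0 \<le> x $ E (v, t)) \<and> (\<Sum>t=1..\<omega> v. x $ E (v, t)) \<le> 1" for v x
  proof -
    have "{0..\<omega> v} = insert 0 {1..\<omega> v}"
      by auto
    then show ?thesis
      by (auto simp: bary_def)
  qed
  have "polytope = {x. \<forall>v\<in>{1..m}. (\<forall>t\<in>{1..\<omega> v}. 0 \<le> x $ E (v, t)) \<and> (\<Sum>t=1..\<omega> v. x $ E (v, t)) \<le> 1}"
    unfolding polytope_def facets_def block[symmetric] by blast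
  also have "\<dots> = {x. \<forall>(i, j)\<in>?I. (\<forall>t\<in>{1..\<omega> (N (i, j))}. 0 \<le> x $ E (N (i, j), t)) \<and>
      (\<Sum>t=1..\<omega> (N (i, j)). x $ E (N (i, j), t)) \<le> 1}"
    unfolding bij_betw_imp_surj_on[OF N, symmetric] by (simp add: ball_simps split_beta)
  also have "\<dots> = {x. \<forall>(i, j)\<in>?I. (\<forall>t\<in>{1..ns i}. 0 \<le> x $ e (i, j, t)) \<and> (\<Sum>t=1..ns i. x $ e (i, j, t)) \<le> 1}"
    by (intro Collect_cong ball_cong refl) (auto simp: EN \<omega>N)
  also have "\<dots> = P"
    unfolding assms(8) simplex_product_def by auto
  finally show ?thesis
    using classes_bijection[OF assms(10)] by simp
qed

end
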